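(* Let $(W(n))_{n\ge0}$ be a Somos 5 sequence with $W(0)W(1)\ne0$ and let $E/\mathbb{Q}$ be the associated elliptic curve. Let $\mathbf{P}=(P_1,P_2)$ and $\mathbf{Q}=(Q_1,Q_2)\in E(\mathbb{Q})^2$ be the associated rational points for the even and odd index terms of $(W(n))$, respectively. Let $p$ be an odd prime, with $E$ given by a Weierstrass equation with $p$-integral coefficients, such that $P_1,P_2,Q_1,Q_2$ modulo $p$ are nonsingular, $P_1,\ P_2,\ P_2\pm P_1,\ Q_1,\ Q_2,\ Q_2\pm Q_1\not\equiv\mathcal{O}\pmod p$, and the orders of $P_1$ and $Q_1$ modulo $p$ are greater than $3$. Assume further that $\mathrm{ord}_p\left(\frac{W(2)}{W(0)}\right)\ge0$, $\mathrm{ord}_p\left(\frac{W(3)}{W(1)}\right)\ge0$, $\mathrm{ord}_p(W(0))\ge0$ and $\mathrm{ord}_p(W(1))\ge 0$. Then there is a power $q=p^N$ ($N\ge1$) such that for all $m\ge1$ the limits $\lim_{i\to\infty}W(2mq^i)$ and $\lim_{i\to\infty}W(2mq^i+1)$ exist in $\mathbb{Z}_p$.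
   Context: A Somos 5 sequence is a sequence $(W(n))_{n\ge0}$ (here of rational numbers) satisfying $W(n)W(n-5)=\tau_1W(n-1)W(n-4)+\tau_2W(n-2)W(n-3)$ for all $n\ge5$, with constant parameters $\tau_1,\tau_2$. Associated curve and points. $E/\mathbb{Q}$ and $\mathbf{P},\mathbf{Q}\in E(\mathbb{Q})^2$ are associated to $(W(n))$ if they realize Hone's sigma-function solution: for some $z_1,z_2\in\mathbb{C}$ and a uniformization $\mathbb{C}/L\cong E(\mathbb{C})$, $P_1=Q_1$ is the image of $2z_1$, $P_2$ of $z_2$, $Q_2$ of $z_1+z_2$, and for all $n\ge1$ $$W(2n)=\alpha^n\beta\,\Psi_n(\mathbf{P}),\qquad W(2n+1)=\gamma^n\delta\,\Psi_n(\mathbf{Q}),$$ where $\alpha=W(2)/W(0)$, $\beta=W(0)$, $\gamma=W(3)/W(1)$, $\delta=W(1)$. Here $\Psi_n$ are the translated division polynomials: if $(P_1,P_2)$ correspond to $(w_1,w_2)\in\mathbb{C}^2$ then $\Psi_n(\mathbf{P})=\dfrac{\sigma(nw_1+w_2)}{\sigma(w_1)^{n^2-n}\sigma(w_1+w_2)^n\sigma(w_2)^{1-n}}$ ($\sigma$ the Weierstrass sigma function of $L$). Algebraically, for $E: y^2+a_1xy+a_3y=x^3+a_2x^2+a_4x+a_6$ and $P_i=(x_i,y_i)$ with $P_1,P_2,P_2\pm P_1\ne\mathcal{O}$, the $\Psi_n(\mathbf{P})$ are the specializations at $(E,\mathbf{P})$ of the universal expressions determined by $\Psi_{-1}=x_1-x_2$,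 $\Psi_0=\Psi_1=1$, $\Psi_2=2x_1+x_2-\left(\frac{y_2-y_1}{x_2-x_1}\right)^2-a_1\frac{y_2-y_1}{x_2-x_1}+a_2$ and $\Psi_{m+2}\Psi_{m-2}=\beta_1^2\Psi_{m+1}\Psi_{m-1}-\beta_2\Psi_m^2$ ($m\in\mathbb{Z}$), $\beta_1=2y_1+a_1x_1+a_3$, $\beta_2=3x_1^4+b_2x_1^3+3b_4x_1^2+3b_6x_1+b_8$ ($b_i$ the usual Weierstrass quantities); with $a_i,x_i,y_i$ generic these lie in $\mathbb{Z}[a_1,a_2,a_3,a_4,a_6][x_1,y_1,x_2,y_2][(x_1-x_2)^{-1}]$ modulo the two Weierstrass equations. Reduction. A point of $E(\mathbb{Q})$ is nonsingular modulo $p$ if it reduces to a nonsingular point of the reduced cubic over $\mathbb{F}_p$; its order modulo $p$ is its order in the group of nonsingular points; $\equiv\mathcal{O}\pmod p$ means that it reduces to $\mathcal{O}$. *)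

theory Defs
  imports
    "HOL-Analysis.Analysis"
    "HOL-Computational_Algebra.Primes"
    "HOL-Number_Theory.Residues"
    "HOL-Algebra.Algebraic_Closure_Type"
begin

section \<open>Somos 5 sequences\<close>

definition somos5 :: "(nat \<Rightarrow> rat) \<Rightarrow> bool" where
  "somos5 W \<longleftrightarrow> (\<exists>\<tau>\<^sub>1 \<tau>\<^sub>2. \<forall>n\<ge>5.
     W n * W (n - 5) = \<tau>\<^sub>1 * W (n - 1) * W (n - 4) + \<tau>\<^sub>2 * W (n - 2) * W (n - 3))"

section \<open>Weierstrass cubics and their group law\<close>

datatype 'a wcurve =
  WCurve (wc_a1: 'a) (wc_a2: 'a) (wc_a3: 'a) (wc_a4: 'a) (wc_a6: 'a)

datatype 'a wpoint = Infinity | Affine 'a 'a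

text \<open>
  The coefficient domain is a field in the sense of HOL-Algebra, because the same definitions are
  needed over the complex and the rational numbers (as \<^const>\<open>ring_of_type_algebra\<close>) and over the
  field with p elements (as \<^const>\<open>residue_ring\<close>), where p is not fixed by a type.
  The coefficients of the cubic are supposed to lie in the carrier.
\<close>

context
  fixes R :: "('a, 'b) ring_scheme" (structure)
begin

fun on_wcurve :: "'a wcurve \<Rightarrow> 'a wpoint \<Rightarrow> bool" where
  "on_wcurve E Infinity \<longleftrightarrow> True"
| "on_wcurve (WCurve a1 a2 a3 a4 a6) (Affine x y) \<longleftrightarrow>
     x \<in> carrier R \<and> y \<in> carrier R \<and>
     y \<otimes> y \<oplus> a1 \<otimes> x \<otimes> y \<oplus> a3 \<otimes> y =
     x \<otimes> x \<otimes> x \<oplus> a2 \<otimes> x \<otimes> x \<oplus> a4 \<otimes> x \<oplus> a6"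

text \<open>
  For an affine point: the partial derivatives of the Weierstrass equation do not both vanish.
  The point at infinity is always nonsingular.
\<close>
fun wnonsingular :: "'a wcurve \<Rightarrow> 'a wpoint \<Rightarrow> bool" where
  "wnonsingular E Infinity \<longleftrightarrow> True"
| "wnonsingular (WCurve a1 a2 a3 a4 a6) (Affine x y) \<longleftrightarrow>
     [(2::nat)] \<cdot> y \<oplus> a1 \<otimes> x \<oplus> a3 \<noteq> \<zero> \<or>
     a1 \<otimes> y \<ominus> ([(3::nat)] \<cdot> (x \<otimes> x) \<oplus> [(2::nat)] \<cdot> (a2 \<otimes> x) \<oplus> a4) \<noteq> \<zero>"

fun wneg :: "'a wcurve \<Rightarrow> 'a wpoint \<Rightarrow> 'a wpoint" where
  "wneg E Infinity = Infinity"
| "wneg (WCurve a1 a2 a3 a4 a6) (Affine x y) = Affine x (\<ominus> y \<ominus> a1 \<otimes> x \<ominus> a3)"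

text \<open>Chord and tangent law; \<open>l\<close> is the slope of the chord or tangent.\<close>
fun wadd :: "'a wcurve \<Rightarrow> 'a wpoint \<Rightarrow> 'a wpoint \<Rightarrow> 'a wpoint" where
  "wadd E Infinity Q = Q"
| "wadd E P Infinity = P"
| "wadd (WCurve a1 a2 a3 a4 a6) (Affine x1 y1) (Affine x2 y2) =
     (if x1 = x2 \<and> y1 \<oplus> y2 \<oplus> a1 \<otimes> x2 \<oplus> a3 = \<zero> then Infinity
      else
        let l = (if x1 = x2
                 then ([(3::nat)] \<cdot> (x1 \<otimes> x1) \<oplus> [(2::nat)] \<cdot> (a2 \<otimes> x1) \<oplus> a4 \<ominus> a1 \<otimes> y1)
                        \<otimes> inv ([(2::nat)] \<cdot> y1 \<oplus> a1 \<otimes> x1 \<oplus> a3)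
                 else (y2 \<ominus> y1) \<otimes> inv (x2 \<ominus> x1));
            x3 = l \<otimes> l \<oplus> a1 \<otimes> l \<ominus> a2 \<ominus> x1 \<ominus> x2;
            y3 = \<ominus> (y1 \<oplus> l \<otimes> (x3 \<ominus> x1)) \<ominus> a1 \<otimes> x3 \<ominus> a3
        in Affine x3 y3)"

definition wpoints :: "'a wcurve \<Rightarrow> 'a wpoint set" where
  "wpoints E = {P. on_wcurve E P}"

text \<open>The group of nonsingular points. If \<open>E\<close> is an elliptic curve these are all points.\<close>
definition wgroup :: "'a wcurve \<Rightarrow> 'a wpoint monoid" where
  "wgroup E =
     \<lparr>carrier = {P \<in> wpoints E. wnonsingular E P},
      monoid.mult = wadd E,
      one = Infinity\<rparr>"

end

text \<open>
  Order of an element of a finite group. Unlike the constant of the group locale, this does not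
  need a proof that \<open>G\<close> is a group before it can be unfolded.
\<close>
definition elem_order :: "('a, 'b) monoid_scheme \<Rightarrow> 'a \<Rightarrow> nat" where
  "elem_order G x = (LEAST n. 0 < n \<and> x [^]\<^bsub>G\<^esub> n = \<one>\<^bsub>G\<^esub>)"

fun wc_b2 :: "'a::comm_ring_1 wcurve \<Rightarrow> 'a" where
  "wc_b2 (WCurve a1 a2 a3 a4 a6) = a1\<^sup>2 + 4 * a2"

fun wc_discriminant :: "'a::comm_ring_1 wcurve \<Rightarrow> 'a" where
  "wc_discriminant (WCurve a1 a2 a3 a4 a6) =
     (let b2 = a1\<^sup>2 + 4 * a2;
          b4 = 2 * a4 + a1 * a3;
          b6 = a3\<^sup>2 + 4 * a6;
          b8 = a1\<^sup>2 * a6 + 4 * a2 * a6 - a1 * a3 * a4 + a2 * a3\<^sup>2 - a4\<^sup>2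
      in - b2\<^sup>2 * b8 - 8 * b4 ^ 3 - 27 * b6\<^sup>2 + 9 * b2 * b4 * b6)"

definition elliptic_curve :: "'a::comm_ring_1 wcurve \<Rightarrow> bool" where
  "elliptic_curve E \<longleftrightarrow> wc_discriminant E \<noteq> 0"

abbreviation rat_field :: "rat ring" where
  "rat_field \<equiv> ring_of_type_algebra"

abbreviation complex_field :: "complex ring" where
  "complex_field \<equiv> ring_of_type_algebra"

section \<open>Weierstrass functions and uniformization\<close>

definition period_lattice :: "complex set \<Rightarrow> bool" where
  "period_lattice L \<longleftrightarrow>
     (\<exists>\<omega>\<^sub>1 \<omega>\<^sub>2. Im (\<omega>\<^sub>2 / \<omega>\<^sub>1) \<noteq> 0 \<and> L = {of_int m * \<omega>\<^sub>1 + of_int n * \<omega>\<^sub>2 | m n. True})"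

definition weierstrass_p :: "complex set \<Rightarrow> complex \<Rightarrow> complex" where
  "weierstrass_p L z = 1 / z\<^sup>2 + (\<Sum>\<^sub>\<infinity>\<omega>\<in>L - {0}. 1 / (z - \<omega>)\<^sup>2 - 1 / \<omega>\<^sup>2)"

text \<open>The infinite product is the limit of the finite products, as for unordered sums.\<close>
definition weierstrass_sigma :: "complex set \<Rightarrow> complex \<Rightarrow> complex" where
  "weierstrass_sigma L z =
     z * Lim (finite_subsets_at_top (L - {0}))
           (\<lambda>F. \<Prod>\<omega>\<in>F. (1 - z / \<omega>) * exp (z / \<omega> + (z / \<omega>)\<^sup>2 / 2))"

text \<open>
  The Weierstrass parametrization for which \<open>dz\<close> corresponds to the invariant differential
  \<open>dx / (2 y + a\<^sub>1 x + a\<^sub>3)\<close>. This normalization matters, since \<open>Psi\<close> below is not invariant under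
  scaling of the lattice.
\<close>
definition wparam :: "complex set \<Rightarrow> complex wcurve \<Rightarrow> complex \<Rightarrow> complex wpoint" where
  "wparam L E z =
     (if z \<in> L then Infinity
      else let x = weierstrass_p L z - wc_b2 E / 12;
               y = (deriv (weierstrass_p L) z - wc_a1 E * x - wc_a3 E) / 2
           in Affine x y)"

text \<open>The parametrization induces a group isomorphism from the quotient by \<open>L\<close> onto \<open>E\<close>.\<close>
definition uniformizes :: "complex set \<Rightarrow> complex wcurve \<Rightarrow> bool" where
  "uniformizes L E \<longleftrightarrow>
     period_lattice L \<and>
     range (wparam L E) = wpoints complex_field E \<and>
     (\<forall>z w. wparam L E (z + w) = wadd complex_field E (wparam L E z) (wparam L E w)) \<and>
     (\<forall>z w. wparam L E z = wparam L E w \<longleftrightarrow> z - w \<in> L)"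

section \<open>Translated division polynomials and associated curves\<close>

text \<open>The value at the pair of points with parameters \<open>w1\<close> and \<open>w2\<close>.\<close>
definition Psi :: "complex set \<Rightarrow> nat \<Rightarrow> complex \<Rightarrow> complex \<Rightarrow> complex" where
  "Psi L n w1 w2 =
     weierstrass_sigma L (of_nat n * w1 + w2) /
     (weierstrass_sigma L w1 powi (int n ^ 2 - int n) *
      weierstrass_sigma L (w1 + w2) powi (int n) *
      weierstrass_sigma L w2 powi (1 - int n))"

text \<open>Hone's sigma function solution of the Somos 5 recurrence.\<close>
definition somos5_associated ::
  "(nat \<Rightarrow> rat) \<Rightarrow> rat wcurve \<Rightarrow> rat wpoint \<times> rat wpoint \<Rightarrow> rat wpoint \<times> rat wpoint \<Rightarrow> bool" where
  "somos5_associated W E P Q \<longleftrightarrow>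
     (\<exists>L z1 z2.
        uniformizes L (map_wcurve of_rat E) \<and>
        map_wpoint of_rat (fst P) = wparam L (map_wcurve of_rat E) (2 * z1) \<and>
        map_wpoint of_rat (snd P) = wparam L (map_wcurve of_rat E) z2 \<and>
        map_wpoint of_rat (fst Q) = wparam L (map_wcurve of_rat E) (2 * z1) \<and>
        map_wpoint of_rat (snd Q) = wparam L (map_wcurve of_rat E) (z1 + z2) \<and>
        (\<forall>n\<ge>1.
           of_rat (W (2 * n)) =
             of_rat (W 2 / W 0) ^ n * of_rat (W 0) * Psi L n (2 * z1) z2 \<and>
           of_rat (W (2 * n + 1)) =
             of_rat (W 3 / W 1) ^ n * of_rat (W 1) * Psi L n (2 * z1) (z1 + z2)))"

section \<open>Reduction modulo p\<close>

definition padic_ord :: "nat \<Rightarrow> rat \<Rightarrow> ereal" where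
  "padic_ord p r =
     (if r = 0 then \<infinity>
      else ereal (real (multiplicity (int p) (fst (quotient_of r))) -
                  real (multiplicity (int p) (snd (quotient_of r)))))"

text \<open>The reduction of a p-integral rational number.\<close>
definition rat_mod :: "nat \<Rightarrow> rat \<Rightarrow> int" where
  "rat_mod p r =
     (fst (quotient_of r) mod int p) \<otimes>\<^bsub>residue_ring (int p)\<^esub>
     inv\<^bsub>residue_ring (int p)\<^esub> (snd (quotient_of r) mod int p)"

definition p_integral_wcurve :: "nat \<Rightarrow> rat wcurve \<Rightarrow> bool" where
  "p_integral_wcurve p E \<longleftrightarrow> (\<forall>a\<in>set_wcurve E. padic_ord p a \<ge> 0)"

definition reduce_wcurve :: "nat \<Rightarrow> rat wcurve \<Rightarrow> int wcurve" where
  "reduce_wcurve p E = map_wcurve (rat_mod p) E"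

text \<open>
  On a curve with p-integral coefficients, an affine point with a coordinate that is not p-integral
  has, after clearing denominators, projective reduction \<open>[0:1:0]\<close>.
\<close>
fun reduce_wpoint :: "nat \<Rightarrow> rat wpoint \<Rightarrow> int wpoint" where
  "reduce_wpoint p Infinity = Infinity"
| "reduce_wpoint p (Affine x y) =
     (if padic_ord p x \<ge> 0 \<and> padic_ord p y \<ge> 0
      then Affine (rat_mod p x) (rat_mod p y) else Infinity)"

definition nonsingular_mod :: "nat \<Rightarrow> rat wcurve \<Rightarrow> rat wpoint \<Rightarrow> bool" where
  "nonsingular_mod p E P \<longleftrightarrow>
     wnonsingular (residue_ring (int p)) (reduce_wcurve p E) (reduce_wpoint p P)"

definition order_mod :: "nat \<Rightarrow> rat wcurve \<Rightarrow> rat wpoint \<Rightarrow> nat" where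
  "order_mod p E P =
     elem_order (wgroup (residue_ring (int p)) (reduce_wcurve p E)) (reduce_wpoint p P)"

section \<open>Limits in the p-adic integers\<close>

text \<open>The p-adic integers as the inverse limit of the rings of integers modulo \<open>p ^ k\<close>.\<close>
definition padic_integers :: "nat \<Rightarrow> (nat \<Rightarrow> int) set" where
  "padic_integers p =
     {x. \<forall>k. x k \<in> {0..<int p ^ k} \<and> x (Suc k) mod int p ^ k = x k}"

text \<open>
  Convergence of rational numbers to a p-adic integer \<open>x\<close>. Since the difference of \<open>x\<close> and \<open>x k\<close> is
  divisible by \<open>p ^ k\<close>, the condition for \<open>k\<close> says that \<open>a i\<close> is eventually congruent to \<open>x\<close> modulo
  \<open>p ^ k\<close>.
\<close>
definition padic_tendsto :: "nat \<Rightarrow> (nat \<Rightarrow> rat) \<Rightarrow> (nat \<Rightarrow> int) \<Rightarrow> bool" where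
  "padic_tendsto p a x \<longleftrightarrow>
     (\<forall>k. \<forall>\<^sub>F i in sequentially. padic_ord p (a i - of_int (x k)) \<ge> ereal (real k))"

definition limit_exists_in_Zp :: "nat \<Rightarrow> (nat \<Rightarrow> rat) \<Rightarrow> bool" where
  "limit_exists_in_Zp p a \<longleftrightarrow> (\<exists>x\<in>padic_integers p. padic_tendsto p a x)"

end

theory Submission
  imports Defs "HOL-Complex_Analysis.Complex_Analysis"
begin

text \<open>
  Put \<open>A\<^sub>n = \<Psi>\<^sub>n(P)\<close>. The addition formula
  \<open>\<sigma>(u + v) \<sigma>(u - v) = - \<sigma>(u)\<^sup>2 \<sigma>(v)\<^sup>2 (\<wp>(u) - \<wp>(v))\<close> makes \<open>A\<close> satisfy a
  recurrence of length 4, with coefficients \<open>\<psi>\<^sub>2\<^sup>2\<close> and \<open>-\<psi>\<^sub>3\<close>, and one of length 5, with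
  coefficients \<open>\<psi>\<^sub>3\<close> and \<open>-\<psi>\<^sub>4/\<psi>\<^sub>2\<close>, where \<open>\<psi>\<^sub>n\<close> are the division polynomials at \<open>P\<^sub>1\<close>. The
  formula itself holds because the group law, which is part of the hypothesis that \<open>E\<close> is
  uniformized, shows that the logarithmic derivative of the quotient of both sides is constant.

  As the order of \<open>P\<^sub>1\<close> modulo \<open>p\<close> exceeds 3, \<open>\<psi>\<^sub>2\<close> and \<open>\<psi>\<^sub>3\<close> are units at \<open>p\<close>. Hence two consecutive
  terms are never both divisible by \<open>p\<close> (else the shorter recurrence would propagate divisibility
  down to \<open>A\<^sub>1 = 1\<close>), so one of the two recurrences always allows to divide. It follows that all
  \<open>A\<^sub>n\<close> are p-integral and that \<open>A\<close> modulo \<open>p\<close> is eventually periodic by the pigeonhole principle.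
  The increments of \<open>A\<close> over a period obey the linearized recurrences modulo \<open>p\<close>, which
  have only finitely many solutions; so there is a fixed \<open>M\<close> such that \<open>M p\<^sup>k\<close> is an eventual period
  modulo \<open>p\<^sup>k\<^sup>+\<^sup>1\<close> for all \<open>k\<close>. If the part of \<open>M\<close> prime to \<open>p\<close> divides \<open>q - 1\<close>, then
  \<open>i \<mapsto> A (m q\<^sup>i)\<close> is a Cauchy sequence.
\<close>

section \<open>The Weierstrass sigma function\<close>

text \<open>The points \<open>n P1 + P2\<close> may reduce to infinity modulo p, so terms divisible
  by p have to be expected. There a single recurrence neither yields the next term nor determines it
  modulo p. Recurrences of lengths 4 and 5 reach the same term by dividing by two neighbouring ones.
  Pigeonhole alone gives periods modulo \<open>p^k\<close> that are unrelated for different k.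
  Linearization relates them: for solutions congruent modulo \<open>p^k\<close>,
  \<open>k >= 1\<close>, the difference divided by \<open>p^k\<close> satisfies relations modulo p
  from which the quadratic remainder has dropped out and which see the sequence only through its
  residues modulo p. The same finite solution space thus serves all k, and with a period M of it
  each further power of p costs exactly one factor p. Periods are only eventual because the
  recurrences are followed forwards; this does no harm, as \<open>m q^i\<close> grows without bound.
  The factors \<open>(W 2 / W 0)^n\<close> and \<open>(W 3 / W 1)^n\<close> have the same kind of
  periodicity with \<open>p - 1\<close> in the role of M. On the analytic side, the constants in the
  addition formula come from the parity of sigma and from its behaviour at 0.\<close>

lemma summable_on_int_powr:
  "(\<lambda>m::int. (1 + real_of_int \<bar>m\<bar>) powr (-3/2)) summable_on UNIV"
proof -
  have "summable (\<lambda>n. real n powr (-3/2))" by (simp add: summable_real_powr_iff)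
  hence s1: "summable (\<lambda>n. (1 + real n) powr (-3/2))"
    by (subst (asm) summable_Suc_iff [symmetric]) (simp add: add.commute)
  hence s2: "summable (\<lambda>n. (1 + real (Suc n)) powr (-3/2))"
    by (subst summable_Suc_iff)
  have a: "(\<lambda>n. (1 + real n) powr (-3/2)) summable_on UNIV"
    using s1 by (subst summable_on_UNIV_nonneg_real_iff) auto
  have b: "(\<lambda>n. (1 + real (Suc n)) powr (-3/2)) summable_on UNIV"
    using s2 by (subst summable_on_UNIV_nonneg_real_iff) auto
  have A: "(\<lambda>m::int. (1 + real_of_int \<bar>m\<bar>) powr (-3/2)) summable_on range int"
    by (subst summable_on_reindex) (use a in \<open>auto simp: o_def\<close>)
  have B: "(\<lambda>m::int. (1 + real_of_int \<bar>m\<bar>) powr (-3/2)) summable_on range (\<lambda>n. - int (Suc n))"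
    by (subst summable_on_reindex) (use b in \<open>auto simp: o_def inj_on_def add.commute\<close>)
  have "range int \<inter> range (\<lambda>n. - int (Suc n)) = {}" by auto
  with A B have "(\<lambda>m::int. (1 + real_of_int \<bar>m\<bar>) powr (-3/2)) summable_on
      (range int \<union> range (\<lambda>n. - int (Suc n)))" by (intro summable_on_Un_disjoint)
  moreover have "(UNIV :: int set) = range int \<union> range (\<lambda>n. - int (Suc n))"
    by (auto simp del: of_nat_Suc) (metis int_cases rangeI)
  ultimately show ?thesis by simp
qed

text \<open>After division by \<open>\<omega>\<^sub>1\<close> the imaginary part of a lattice point
  depends on \<open>n\<close> only, which bounds \<open>n\<close>; exchanging the two periods bounds
  \<open>m\<close>.\<close>

lemma norm_lattice_ge:
  assumes "Im (\<omega>\<^sub>2 / \<omega>\<^sub>1) \<noteq> 0"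
  obtains c where "c > 0"
    "\<And>m n :: int. c * real_of_int (max \<bar>m\<bar> \<bar>n\<bar>) \<le> norm (of_int m * \<omega>\<^sub>1 + of_int n * \<omega>\<^sub>2)"
proof -
  have nz: "\<omega>\<^sub>1 \<noteq> 0" "\<omega>\<^sub>2 \<noteq> 0" using assms by auto
  define c1 where "c1 = norm \<omega>\<^sub>1 * \<bar>Im (\<omega>\<^sub>2 / \<omega>\<^sub>1)\<bar>"
  define c2 where "c2 = norm \<omega>\<^sub>2 * \<bar>Im (\<omega>\<^sub>1 / \<omega>\<^sub>2)\<bar>"
  have "\<omega>\<^sub>1 / \<omega>\<^sub>2 = inverse (\<omega>\<^sub>2 / \<omega>\<^sub>1)" by simp
  hence "Im (\<omega>\<^sub>1 / \<omega>\<^sub>2) \<noteq> 0" using assms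
    by (metis complex_is_Real_iff inverse_inverse_eq Reals_inverse)
  hence pos: "c1 > 0" "c2 > 0" using assms nz by (simp_all add: c1_def c2_def)
  have bd: "norm a * \<bar>Im (b / a)\<bar> * real_of_int \<bar>k\<bar> \<le> norm (of_int j * a + of_int k * b)"
    if "a \<noteq> 0" for a b j k
  proof -
    define w where "w = b / a"
    have "\<bar>Im (of_int j + of_int k * w)\<bar> \<le> norm (of_int j + of_int k * w)"
      by (rule abs_Im_le_cmod)
    hence "\<bar>Im w\<bar> * real_of_int \<bar>k\<bar> \<le> norm (of_int j + of_int k * w)"
      by (simp add: abs_mult mult.commute)
    hence "norm a * (\<bar>Im w\<bar> * real_of_int \<bar>k\<bar>) \<le> norm (a * (of_int j + of_int k * w))"
      unfolding norm_mult by (rule mult_left_mono) simp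
    also have "a * (of_int j + of_int k * w) = of_int j * a + of_int k * b"
      using that by (simp add: w_def distrib_left mult.commute)
    finally show ?thesis by (simp only: w_def mult.assoc)
  qed
  show ?thesis
  proof (rule that[of "min c1 c2"])
    show "min c1 c2 > 0" using pos by simp
    fix m n :: int
    have 1: "c1 * real_of_int \<bar>n\<bar> \<le> norm (of_int m * \<omega>\<^sub>1 + of_int n * \<omega>\<^sub>2)"
      using bd[OF nz(1), of \<omega>\<^sub>2 n m] by (simp add: c1_def)
    have 2: "c2 * real_of_int \<bar>m\<bar> \<le> norm (of_int m * \<omega>\<^sub>1 + of_int n * \<omega>\<^sub>2)"
      using bd[OF nz(2), of \<omega>\<^sub>1 m n] by (simp add: c2_def add.commute)
    have "min c1 c2 * real_of_int \<bar>n\<bar> \<le> c1 * real_of_int \<bar>n\<bar>" "min c1 c2 * real_of_int \<bar>m\<bar> \<le> c2 * real_of_int \<bar>m\<bar>"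
      by (simp_all add: mult_right_mono)
    with 1 2 show "min c1 c2 * real_of_int (max \<bar>m\<bar> \<bar>n\<bar>) \<le> norm (of_int m * \<omega>\<^sub>1 + of_int n * \<omega>\<^sub>2)"
      by (cases "\<bar>m\<bar> \<le> \<bar>n\<bar>") (auto simp: max_def)
  qed
qed

lemma period_lattice_summable:
  assumes "period_lattice L"
  shows "(\<lambda>\<omega>. 1 / norm \<omega> ^ 3) summable_on (L - {0})"
proof -
  obtain \<omega>\<^sub>1 \<omega>\<^sub>2 where im: "Im (\<omega>\<^sub>2 / \<omega>\<^sub>1) \<noteq> 0"
    and L: "L = {of_int m * \<omega>\<^sub>1 + of_int n * \<omega>\<^sub>2 | m n. True}"
    using assms unfolding period_lattice_def by blast
  obtain c where c: "c > 0"
    "\<And>m n :: int. c * real_of_int (max \<bar>m\<bar> \<bar>n\<bar>) \<le> norm (of_int m * \<omega>\<^sub>1 + of_int n * \<omega>\<^sub>2)"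
    using norm_lattice_ge[OF im] by metis
  define f where "f = (\<lambda>(m::int, n::int). of_int m * \<omega>\<^sub>1 + of_int n * \<omega>\<^sub>2)"
  \<comment> \<open>Half of the exponent 3 goes to each index: the inverse cube of the maximum is
    then bounded by a product of one-variable terms, and 3/2 > 1 makes each factor summable.\<close>
  define h where "h = (\<lambda>m::int. (1 + real_of_int \<bar>m\<bar>) powr (-3/2))"
  have h0: "h m \<ge> 0" for m by (simp add: h_def)
  have f0: "f x = 0 \<Longrightarrow> x = (0,0)" for x
    using c(2)[of "fst x" "snd x"] c(1)
    by (cases x) (auto simp: f_def mult_le_0_iff max_def split: if_splits)
  have inj: "inj_on f (UNIV - {(0,0)})"
  proof (rule inj_onI)
    fix x y assume "f x = f y"
    hence "f (fst x - fst y, snd x - snd y) = 0"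
      by (simp add: f_def case_prod_unfold algebra_simps)
    from f0[OF this] show "x = y" by (simp add: prod_eq_iff)
  qed
  have img: "f ` (UNIV - {(0,0)}) = L - {0}"
  proof -
    have L': "L = range f" by (auto simp: L f_def)
    have "f (0,0) = 0" by (simp add: f_def)
    with f0 have "f x = 0 \<longleftrightarrow> x = (0,0)" for x by metis
    thus ?thesis unfolding L' by fast
  qed
  have hs: "h summable_on UNIV" unfolding h_def by (rule summable_on_int_powr)
  have hh: "(\<lambda>x. h (fst x) * h (snd x)) summable_on UNIV \<times> UNIV"
  proof (rule nonneg_bdd_above_summable_on)
    show "bdd_above (sum (\<lambda>x. h (fst x) * h (snd x)) ` {F. F \<subseteq> UNIV \<times> UNIV \<and> finite F})"
    proof (rule bdd_aboveI2)
      fix F :: "(int \<times> int) set" assume "F \<in> {F. F \<subseteq> UNIV \<times> UNIV \<and> finite F}"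
      hence fin: "finite F" by simp
      have "sum (\<lambda>x. h (fst x) * h (snd x)) F \<le> sum (\<lambda>x. h (fst x) * h (snd x)) (fst ` F \<times> snd ` F)"
        by (rule sum_mono2) (use fin h0 subset_fst_snd[of F] in auto)
      also have "\<dots> = sum h (fst ` F) * sum h (snd ` F)"
        by (simp add: sum_product sum.cartesian_product case_prod_unfold)
      also have "\<dots> \<le> infsum h UNIV * infsum h UNIV"
        by (intro mult_mono finite_sum_le_infsum hs sum_nonneg infsum_nonneg) (use fin h0 in auto)
      finally show "sum (\<lambda>x. h (fst x) * h (snd x)) F \<le> infsum h UNIV * infsum h UNIV" .
    qed
  qed (use h0 in auto)
  \<comment> \<open>The 8 is the cube of the 2 in \<open>1 + \<bar>m\<bar> \<le> 2 * M\<close>;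
    \<open>c\<close> is the constant in the lower bound for the norm.\<close>
  define K where "K = 8 / c ^ 3"
  have "(\<lambda>x. K * (h (fst x) * h (snd x))) summable_on UNIV - {(0,0)}"
    by (rule summable_on_subset_banach[OF summable_on_cmult_right[OF hh]]) auto
  hence "(\<lambda>x. 1 / norm (f x) ^ 3) summable_on UNIV - {(0,0)}"
  proof (rule summable_on_comparison_test)
    fix x :: "int \<times> int" assume x: "x \<in> UNIV - {(0,0)}"
    obtain m n where [simp]: "x = (m, n)" by force
    define M where "M = real_of_int (max \<bar>m\<bar> \<bar>n\<bar>)"
    have M: "M \<ge> 1" using x by (auto simp: M_def max_def)
    have "(1 + real_of_int \<bar>m\<bar>) \<le> 2 * M" "(1 + real_of_int \<bar>n\<bar>) \<le> 2 * M"
      using M by (auto simp: M_def)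
    hence "h m \<ge> (2 * M) powr (-3/2)" "h n \<ge> (2*M) powr (-3/2)"
      unfolding h_def by (auto intro: powr_mono2')
    hence "(2 * M) powr (-3/2) * (2 * M) powr (-3/2) \<le> h m * h n"
      by (intro mult_mono) (auto simp: h0)
    moreover have "(2 * M) powr (-3/2) * (2 * M) powr (-3/2) = 1 / (2 * M) ^ 3"
      using M by (simp add: powr_add [symmetric] powr_minus_divide powr_numeral)
    ultimately have h': "1 / (8 * M ^ 3) \<le> h m * h n" by (simp add: power_mult_distrib)
    have "c * M \<le> norm (f x)" using c(2)[of m n] by (simp add: f_def M_def)
    hence "(c * M) ^ 3 \<le> norm (f x) ^ 3" using c(1) M by (intro power_mono) auto
    moreover have "(c * M) ^ 3 > 0" using c(1) M by simp
    ultimately have "1 / norm (f x) ^ 3 \<le> 1 / (c * M) ^ 3"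
      by (intro divide_left_mono mult_pos_pos) auto
    also have "\<dots> = K * (1 / (8 * M ^ 3))" by (simp add: K_def power_mult_distrib)
    also have "\<dots> \<le> K * (h m * h n)" using h' c(1) by (intro mult_left_mono) (auto simp: K_def)
    finally show "1 / norm (f x) ^ 3 \<le> K * (h (fst x) * h (snd x))" by simp
  qed auto
  thus ?thesis by (simp add: img [symmetric] summable_on_reindex[OF inj] o_def)
qed

lemma period_lattice_finite:
  assumes "period_lattice L"
  shows "finite {\<omega> \<in> L. norm \<omega> \<le> R}"
proof -
  obtain \<omega>\<^sub>1 \<omega>\<^sub>2 where im: "Im (\<omega>\<^sub>2 / \<omega>\<^sub>1) \<noteq> 0"
    and L: "L = {of_int m * \<omega>\<^sub>1 + of_int n * \<omega>\<^sub>2 | m n. True}"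
    using assms unfolding period_lattice_def by blast
  obtain c where c: "c > 0"
    "\<And>m n :: int. c * real_of_int (max \<bar>m\<bar> \<bar>n\<bar>) \<le> norm (of_int m * \<omega>\<^sub>1 + of_int n * \<omega>\<^sub>2)"
    using norm_lattice_ge[OF im] by metis
  define B where "B = \<lceil>R / c\<rceil>"
  have "{\<omega> \<in> L. norm \<omega> \<le> R} \<subseteq> (\<lambda>(m, n). of_int m * \<omega>\<^sub>1 + of_int n * \<omega>\<^sub>2) ` ({-B..B} \<times> {-B..B})"
  proof
    fix \<omega> assume "\<omega> \<in> {\<omega> \<in> L. norm \<omega> \<le> R}"
    then obtain m n where mn: "\<omega> = of_int m * \<omega>\<^sub>1 + of_int n * \<omega>\<^sub>2" "norm \<omega> \<le> R"
      by (auto simp: L)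
    with c have "c * real_of_int (max \<bar>m\<bar> \<bar>n\<bar>) \<le> R" by (meson order_trans)
    hence "real_of_int (max \<bar>m\<bar> \<bar>n\<bar>) \<le> R / c" using c(1) by (simp add: field_simps)
    hence "max \<bar>m\<bar> \<bar>n\<bar> \<le> B" unfolding B_def by linarith
    thus "\<omega> \<in> (\<lambda>(m, n). of_int m * \<omega>\<^sub>1 + of_int n * \<omega>\<^sub>2) ` ({-B..B} \<times> {-B..B})"
      by (intro image_eqI[of _ _ "(m, n)"]) (auto simp: mn)
  qed
  thus ?thesis by (rule finite_subset) auto
qed

section \<open>The sigma function as a locally uniform limit of finite products\<close>

locale complex_lattice =
  fixes L :: "complex set"
  assumes lattice: "period_lattice L"
begin

abbreviation finsets :: "complex set filter" where
  "finsets \<equiv> finite_subsets_at_top (L - {0})"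

abbreviation \<sigma> :: "complex \<Rightarrow> complex" where "\<sigma> \<equiv> weierstrass_sigma L"
abbreviation wp :: "complex \<Rightarrow> complex" where "wp \<equiv> weierstrass_p L"

text \<open>\<open>weierstrass_factor 2 u\<close> is \<open>(1 - u) * exp (u + u^2 / 2)\<close>, so
  these are the partial products of the limit that defines \<open>\<sigma>\<close>.\<close>

definition sigma_prod :: "complex set \<Rightarrow> complex \<Rightarrow> complex" where
  "sigma_prod V z = z * (\<Prod>\<omega>\<in>V. weierstrass_factor 2 (z / \<omega>))"

lemma zero_in_L: "0 \<in> L"
proof -
  obtain \<omega>\<^sub>1 \<omega>\<^sub>2 where "L = {of_int m * \<omega>\<^sub>1 + of_int n * \<omega>\<^sub>2 | m n. True}"
    using lattice unfolding period_lattice_def by blast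
  thus ?thesis by (auto intro: exI[of _ 0])
qed

lemma uminus_in_L: "x \<in> L \<Longrightarrow> - x \<in> L"
proof -
  assume xL: "x \<in> L"
  obtain \<omega>\<^sub>1 \<omega>\<^sub>2 where L: "L = {of_int m * \<omega>\<^sub>1 + of_int n * \<omega>\<^sub>2 | m n. True}"
    using lattice unfolding period_lattice_def by blast
  obtain m n where x: "x = of_int m * \<omega>\<^sub>1 + of_int n * \<omega>\<^sub>2" using xL unfolding L by blast
  have "- x = of_int (- m) * \<omega>\<^sub>1 + of_int (- n) * \<omega>\<^sub>2" unfolding x by simp
  thus ?thesis unfolding L by blast
qed

lemma uminus_in_L_iff [simp]: "- x \<in> L \<longleftrightarrow> x \<in> L"
  using uminus_in_L[of x] uminus_in_L[of "- x"] by auto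

lemma countable_L: "countable L"
proof -
  have eq: "L = (\<Union>n::nat. {\<omega>\<in>L. norm \<omega> \<le> real n})" using real_arch_simple by blast
  show ?thesis by (subst eq) (rule countable_UN, auto intro: countable_finite period_lattice_finite lattice)
qed

lemma not_islimpt_L: "\<not> w islimpt L"
proof
  assume "w islimpt L"
  have "w islimpt (L \<inter> cball w 1)"
  proof (rule islimpt_Int_eventually)
    show "\<forall>\<^sub>F y in at w. y \<in> cball w 1"
      by (intro eventually_at_in_open' [THEN eventually_mono, of "ball w 1"]) auto
  qed fact
  hence "infinite (L \<inter> cball w 1)" using islimpt_finite by blast
  moreover have "norm x \<le> norm w + 1" if "x \<in> cball w 1" for x
    using norm_triangle_sub[of x w] that by (simp add: dist_norm norm_minus_commute)
  hence "finite (L \<inter> cball w 1)"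
    by (intro finite_subset[OF _ period_lattice_finite[OF lattice, of "norm w + 1"]]) auto
  ultimately show False by simp
qed

lemma closed_L: "closed L"
  by (simp add: closed_limpt not_islimpt_L)

lemma discrete_L: "\<forall>\<^sub>F z in at w. z \<notin> L"
  using not_islimpt_L by (simp add: islimpt_iff_eventually)

text \<open>Only the finitely many factors with \<open>norm \<omega> \<le> 2 * R\<close> can vanish
  on the disc. The others stay within 1/2 of 1, so their product is the exponential of a uniformly
  convergent sum of logarithms and contributes no zeros.\<close>

lemma sigma_prod_converges:
  assumes "R > 0"
  obtains g where "uniform_limit (ball 0 R) (\<lambda>V z. \<Prod>\<omega>\<in>V. weierstrass_factor 2 (z / \<omega>)) g finsets"
    "\<And>z. z \<in> ball 0 R \<Longrightarrow> g z = 0 \<longleftrightarrow> z \<in> L - {0}" "bounded (g ` ball 0 R)"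
proof -
  define E where "E = (\<lambda>\<omega> z. weierstrass_factor 2 (z / \<omega>))"
  define F0 where "F0 = {\<omega> \<in> L. norm \<omega> \<le> 2 * R} - {0}"
  have F0: "finite F0" "F0 \<subseteq> L - {0}"
    using period_lattice_finite[OF lattice] by (auto simp: F0_def)
  \<comment> \<open>The value 0 on \<open>F0\<close> removes the exceptional factors from every
    partial sum; they return below as the fixed finite product \<open>G\<close>.\<close>
  define l where "l = (\<lambda>\<omega> z. if \<omega> \<in> F0 then 0 else Ln (E \<omega> z))"
  \<comment> \<open>The 6 is a 3 from the bound on the Weierstrass factor times a 2 from the bound
    on \<open>Ln\<close> near 1.\<close>
  define M where "M = (\<lambda>\<omega>::complex. 6 * R ^ 3 * (1 / norm \<omega> ^ 3))"
  have M0: "M \<omega> \<ge> 0" for \<omega> using assms by (simp add: M_def)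
  have E1: "norm (E \<omega> z - 1) \<le> 3 * (R / norm \<omega>) ^ 3 \<and> norm (E \<omega> z - 1) < 1 / 2"
    if "\<omega> \<in> L - {0} - F0" "z \<in> ball 0 R" for \<omega> z
  proof -
    have n: "norm \<omega> > 2 * R" using that by (auto simp: F0_def)
    have z: "norm z < R" using that by simp
    have q: "norm (z / \<omega>) \<le> R / norm \<omega>"
      using z n assms by (simp add: norm_divide divide_right_mono)
    have "norm \<omega> > 0" using n assms by linarith
    hence q2: "R / norm \<omega> \<le> 1 / 2" using n by (simp add: divide_le_eq)
    have "norm (E \<omega> z - 1) \<le> 3 * norm (z / \<omega>) ^ Suc 2"
      unfolding E_def using q q2 by (intro weierstrass_factor_bound) linarith
    also have "norm (z / \<omega>) ^ Suc 2 \<le> (R / norm \<omega>) ^ Suc 2"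
      using q by (intro power_mono) auto
    finally have 1: "norm (E \<omega> z - 1) \<le> 3 * (R / norm \<omega>) ^ 3"
      by (simp add: numeral_3_eq_3 numeral_2_eq_2)
    have "(R / norm \<omega>) ^ 3 \<le> (1 / 2) ^ 3"
      using q2 assms by (intro power_mono) auto
    with 1 show ?thesis by (simp add: power3_eq_cube)
  qed
  have bound: "norm (l \<omega> z) \<le> M \<omega>" if "\<omega> \<in> L - {0}" "z \<in> ball 0 R" for \<omega> z
  proof (cases "\<omega> \<in> F0")
    case False
    with E1[of \<omega> z] that have e: "norm (E \<omega> z - 1) \<le> 3 * (R / norm \<omega>) ^ 3" "norm (E \<omega> z - 1) < 1 / 2"
      by auto
    have "norm (Ln (1 + (E \<omega> z - 1))) \<le> 2 * norm (E \<omega> z - 1)" by (rule norm_Ln_le[OF e(2)])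
    hence "norm (l \<omega> z) \<le> 2 * norm (E \<omega> z - 1)" using False by (simp add: l_def)
    also have "\<dots> \<le> M \<omega>" using e(1) by (simp add: M_def power_divide)
    finally show ?thesis .
  qed (use M0 in \<open>simp add: l_def\<close>)
  have Ms: "M summable_on L - {0}"
    unfolding M_def by (intro summable_on_cmult_right period_lattice_summable lattice)
  define S where "S = (\<lambda>z. \<Sum>\<^sub>\<infinity>\<omega>\<in>L - {0}. l \<omega> z)"
  have S: "uniform_limit (ball 0 R) (\<lambda>V z. \<Sum>\<omega>\<in>V. l \<omega> z) S finsets"
    unfolding S_def by (rule Weierstrass_m_test_general[OF bound Ms])
  \<comment> \<open>Composition with \<open>exp\<close> preserves uniform convergence where
    \<open>exp\<close> is uniformly continuous; partial sums and limit are therefore confined to one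
    compact disc.\<close>
  define B where "B = infsum M (L - {0})"
  have evX: "\<forall>\<^sub>F V in finsets. finite V \<and> V \<subseteq> L - {0} \<and> F0 \<subseteq> V"
    using F0 by (auto simp: eventually_finite_subsets_at_top)
  have evB: "\<forall>\<^sub>F V in finsets. \<forall>z\<in>ball 0 R. (\<Sum>\<omega>\<in>V. l \<omega> z) \<in> cball 0 B"
    using evX
  proof eventually_elim
    case (elim V)
    show ?case
    proof
      fix z :: complex assume z: "z \<in> ball 0 R"
      have "norm (\<Sum>\<omega>\<in>V. l \<omega> z) \<le> (\<Sum>\<omega>\<in>V. M \<omega>)"
        using elim z by (intro order_trans[OF norm_sum] sum_mono bound) auto
      also have "\<dots> \<le> B" unfolding B_def using elim M0 by (intro finite_sum_le_infsum Ms) auto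
      finally show "(\<Sum>\<omega>\<in>V. l \<omega> z) \<in> cball 0 B" by simp
    qed
  qed
  have nt: "finsets \<noteq> bot" by simp
  have SB: "S z \<in> cball 0 B" if "z \<in> ball 0 R" for z
  proof (rule Lim_in_closed_set)
    show "((\<lambda>V. \<Sum>\<omega>\<in>V. l \<omega> z) \<longlongrightarrow> S z) finsets" using S that by (rule tendsto_uniform_limitI)
    show "\<forall>\<^sub>F V in finsets. (\<Sum>\<omega>\<in>V. l \<omega> z) \<in> cball 0 B" using evB by eventually_elim (use that in blast)
  qed (use nt in auto)
  have uc: "uniformly_continuous_on (cball (0::complex) B) exp"
    by (intro compact_uniformly_continuous continuous_intros compact_cball)
  have expS: "uniform_limit (ball 0 R) (\<lambda>V z. exp (\<Sum>\<omega>\<in>V. l \<omega> z)) (\<lambda>z. exp (S z)) finsets"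
    by (rule uniform_limit_compose_uniformly_continuous_on[OF S uc evB]) simp
  define G where "G = (\<lambda>z. \<Prod>\<omega>\<in>F0. E \<omega> z)"
  have "continuous_on (cball 0 R) G"
    unfolding G_def E_def using F0 by (auto intro!: continuous_intros)
  hence bG: "bounded (G ` ball 0 R)"
    by (intro bounded_subset[OF compact_imp_bounded[OF compact_continuous_image[OF _ compact_cball]]]) auto
  have "bounded (exp ` cball (0::complex) B)"
    by (intro compact_imp_bounded compact_continuous_image continuous_intros compact_cball)
  hence bE: "bounded ((\<lambda>z. exp (S z)) ` ball 0 R)"
    by (rule bounded_subset) (use SB in blast)
  have "uniform_limit (ball 0 R) (\<lambda>V z. G z * exp (\<Sum>\<omega>\<in>V. l \<omega> z)) (\<lambda>z. G z * exp (S z)) finsets"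
    by (intro uniform_lim_mult expS bG bE) (simp add: uniform_limit_const)
  moreover have "\<forall>\<^sub>F V in finsets. \<forall>z\<in>ball 0 R. G z * exp (\<Sum>\<omega>\<in>V. l \<omega> z) = (\<Prod>\<omega>\<in>V. E \<omega> z)"
    using evX
  proof eventually_elim
    case (elim V)
    show ?case
    proof
      fix z :: complex assume z: "z \<in> ball 0 R"
      have "exp (\<Sum>\<omega>\<in>V. l \<omega> z) = (\<Prod>\<omega>\<in>V. exp (l \<omega> z))" using elim by (simp add: exp_sum)
      also have "\<dots> = (\<Prod>\<omega>\<in>V-F0. exp (l \<omega> z)) * (\<Prod>\<omega>\<in>F0. exp (l \<omega> z))"
        using elim by (intro prod.subset_diff) auto
      also have "(\<Prod>\<omega>\<in>F0. exp (l \<omega> z)) = 1" by (intro prod.neutral) (simp add: l_def)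
      also have "(\<Prod>\<omega>\<in>V-F0. exp (l \<omega> z)) = (\<Prod>\<omega>\<in>V-F0. E \<omega> z)"
      proof (intro prod.cong refl)
        fix \<omega> assume w: "\<omega> \<in> V - F0"
        have "norm (E \<omega> z - 1) < 1 / 2" using E1[of \<omega> z] w z elim by auto
        hence "E \<omega> z \<noteq> 0" by auto
        thus "exp (l \<omega> z) = E \<omega> z" using w by (simp add: l_def)
      qed
      finally show "G z * exp (\<Sum>\<omega>\<in>V. l \<omega> z) = (\<Prod>\<omega>\<in>V. E \<omega> z)"
        using prod.subset_diff[of F0 V "\<lambda>\<omega>. E \<omega> z"] elim by (simp add: G_def mult.commute)
    qed
  qed
  ultimately have "uniform_limit (ball 0 R) (\<lambda>V z. \<Prod>\<omega>\<in>V. E \<omega> z) (\<lambda>z. G z * exp (S z)) finsets"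
    by (rule uniform_limit_cong[THEN iffD1, rotated 2]) auto
  moreover have "G z * exp (S z) = 0 \<longleftrightarrow> z \<in> L - {0}" if "z \<in> ball 0 R" for z
  proof -
    have "G z * exp (S z) = 0 \<longleftrightarrow> (\<exists>\<omega>\<in>F0. z / \<omega> = 1)" using F0 by (simp add: G_def E_def)
    also have "\<dots> \<longleftrightarrow> z \<in> F0" by (auto simp: F0_def)
    also have "\<dots> \<longleftrightarrow> z \<in> L - {0}" using that assms by (auto simp: F0_def)
    finally show ?thesis .
  qed
  moreover have "bounded ((\<lambda>z. G z * exp (S z)) ` ball 0 R)"
  proof -
    obtain a b where "\<And>z. z \<in> ball 0 R \<Longrightarrow> norm (G z) \<le> a" "\<And>z. z \<in> ball 0 R \<Longrightarrow> norm (exp (S z)) \<le> b"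
      using bG bE unfolding bounded_iff by (metis image_eqI)
    hence "norm (G z * exp (S z)) \<le> \<bar>a\<bar> * \<bar>b\<bar>" if "z \<in> ball 0 R" for z
      unfolding norm_mult using that by (intro mult_mono) force+
    thus ?thesis unfolding bounded_iff by blast
  qed
  ultimately show ?thesis using that unfolding E_def by blast
qed

lemma uniform_limit_sigma: "uniform_limit (ball 0 R) sigma_prod \<sigma> finsets"
  and sigma_eq_0_iff: "\<sigma> z = 0 \<longleftrightarrow> z \<in> L"
proof -
  have *: "uniform_limit (ball 0 R) sigma_prod \<sigma> finsets \<and> (\<forall>z\<in>ball 0 R. \<sigma> z = 0 \<longleftrightarrow> z \<in> L)" if "R > 0" for R
  proof -
    obtain g where g: "uniform_limit (ball 0 R) (\<lambda>V z. \<Prod>\<omega>\<in>V. weierstrass_factor 2 (z / \<omega>)) g finsets"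
      "\<And>z. z \<in> ball 0 R \<Longrightarrow> g z = 0 \<longleftrightarrow> z \<in> L - {0}" "bounded (g ` ball 0 R)"
      using sigma_prod_converges[OF \<open>R > 0\<close>] by blast
    have factor: "(1 - z / \<omega>) * exp (z / \<omega> + (z / \<omega>)\<^sup>2 / 2) = weierstrass_factor 2 (z / \<omega>)" for z \<omega> :: complex
      by (simp add: weierstrass_factor_def numeral_2_eq_2)
    have s: "\<sigma> z = z * g z" if "z \<in> ball 0 R" for z
    proof -
      have "((\<lambda>V. \<Prod>\<omega>\<in>V. weierstrass_factor 2 (z / \<omega>)) \<longlongrightarrow> g z) finsets"
        using g(1) that by (rule tendsto_uniform_limitI)
      hence "Lim finsets (\<lambda>V. \<Prod>\<omega>\<in>V. weierstrass_factor 2 (z / \<omega>)) = g z"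
        by (intro tendsto_Lim) auto
      thus ?thesis by (simp only: weierstrass_sigma_def factor)
    qed
    have "uniform_limit (ball 0 R) (\<lambda>V z. z * (\<Prod>\<omega>\<in>V. weierstrass_factor 2 (z / \<omega>))) (\<lambda>z. z * g z) finsets"
      by (intro uniform_lim_mult g uniform_limit_const) auto
    hence "uniform_limit (ball 0 R) sigma_prod \<sigma> finsets"
      unfolding sigma_prod_def [abs_def]
      by (rule uniform_limit_cong[THEN iffD1, rotated 2]) (use s in auto)
    moreover have "\<forall>z\<in>ball 0 R. \<sigma> z = 0 \<longleftrightarrow> z \<in> L" using s g(2) zero_in_L by auto
    ultimately show ?thesis by blast
  qed
  show "uniform_limit (ball 0 R) sigma_prod \<sigma> finsets"
    by (cases "R > 0") (use * in \<open>auto simp: ball_empty\<close>)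
  show "\<sigma> z = 0 \<longleftrightarrow> z \<in> L" using *[of "norm z + 1"] by (auto simp: add_nonneg_pos)
qed

lemma holomorphic_sigma_prod:
  assumes "V \<subseteq> L - {0}" shows "sigma_prod V holomorphic_on A"
  unfolding sigma_prod_def [abs_def] using assms by (auto intro!: holomorphic_intros)

lemma eventually_finsets: "(\<And>V. finite V \<Longrightarrow> V \<subseteq> L - {0} \<Longrightarrow> P V) \<Longrightarrow> eventually P finsets"
  by (rule eventually_finite_subsets_at_top_weakI)

lemma holomorphic_sigma: "\<sigma> holomorphic_on A"
proof -
  have "\<sigma> field_differentiable at z" for z
  proof -
    have "\<sigma> holomorphic_on ball 0 (norm z + 1)"
    proof (rule holomorphic_uniform_limit)
      show "uniform_limit (cball 0 (norm z + 1)) sigma_prod \<sigma> finsets"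
        by (rule uniform_limit_on_subset[OF uniform_limit_sigma[of "norm z + 2"]]) auto
      show "\<forall>\<^sub>F V in finsets. continuous_on (cball 0 (norm z + 1)) (sigma_prod V) \<and>
              sigma_prod V holomorphic_on ball 0 (norm z + 1)"
        by (rule eventually_finsets)
           (auto intro!: holomorphic_sigma_prod holomorphic_on_imp_continuous_on)
    qed auto
    thus ?thesis by (rule holomorphic_on_imp_differentiable_at) (auto simp: add_nonneg_pos)
  qed
  thus ?thesis by (simp add: holomorphic_on_def field_differentiable_at_within)
qed

lemma tendsto_deriv_sigma: "((\<lambda>V. (deriv ^^ m) (sigma_prod V) z) \<longlongrightarrow> (deriv ^^ m) \<sigma> z) finsets"
proof (rule higher_deriv_complex_uniform_limit[OF uniform_limit_sigma[of "norm z + 1"]])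
  show "\<forall>\<^sub>F V in finsets. sigma_prod V holomorphic_on ball 0 (norm z + 1)"
    by (rule eventually_finsets) (rule holomorphic_sigma_prod)
qed (auto simp: add_nonneg_pos)

lemma sigma_has_field_derivative: "(\<sigma> has_field_derivative deriv \<sigma> z) (at z)"
  by (rule holomorphic_derivI[OF holomorphic_sigma open_UNIV UNIV_I])

lemma deriv_sigma_has_field_derivative: "(deriv \<sigma> has_field_derivative deriv (deriv \<sigma>) z) (at z)"
  by (rule holomorphic_derivI[OF holomorphic_deriv[OF holomorphic_sigma open_UNIV] open_UNIV UNIV_I])

lemma continuous_sigma: "isCont \<sigma> z" "isCont (deriv \<sigma>) z" "isCont (deriv (deriv \<sigma>)) z"
proof -
  have "deriv \<sigma> holomorphic_on UNIV" by (intro holomorphic_deriv holomorphic_sigma open_UNIV)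
  from holomorphic_deriv[OF this open_UNIV] show "isCont (deriv (deriv \<sigma>)) z"
    using holomorphic_on_imp_continuous_on continuous_on_eq_continuous_at[OF open_UNIV] by blast
  show "isCont \<sigma> z" using DERIV_isCont[OF sigma_has_field_derivative] .
  show "isCont (deriv \<sigma>) z" using DERIV_isCont[OF deriv_sigma_has_field_derivative] .
qed

section \<open>Parity and normalization of sigma, and its relation to the p-function\<close>

text \<open>Replacing \<open>V\<close> by its negative preserves the filter of finite subsets, the
  lattice being symmetric, and exchanges \<open>z\<close> and \<open>- z\<close> in the partial
  products.\<close>

lemma sigma_uminus: "\<sigma> (- z) = - \<sigma> z"
proof -
  have conv: "((\<lambda>V. sigma_prod V z) \<longlongrightarrow> \<sigma> z) finsets" for z
    using tendsto_deriv_sigma[of 0 z] by simp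
  have "filtermap (image uminus) finsets = finite_subsets_at_top (uminus ` (L - {0}))"
    by (rule filtermap_image_finite_subsets_at_top) simp
  also have "uminus ` (L - {0}) = L - {0}"
  proof -
    have "x \<in> uminus ` (L - {0})" if "x \<in> L - {0}" for x
      using that by (intro image_eqI[of _ _ "- x"]) auto
    thus ?thesis by auto
  qed
  finally have "filterlim (image uminus) finsets finsets" by (simp add: filterlim_def)
  from filterlim_compose[OF conv this] have "((\<lambda>V. sigma_prod (uminus ` V) z) \<longlongrightarrow> \<sigma> z) finsets" .
  moreover have "sigma_prod (uminus ` V) z = - sigma_prod V (- z)" for V
    unfolding sigma_prod_def by (subst prod.reindex) simp_all
  ultimately have "((\<lambda>V. - sigma_prod V (- z)) \<longlongrightarrow> \<sigma> z) finsets" by simp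
  from tendsto_minus[OF this] have "((\<lambda>V. sigma_prod V (- z)) \<longlongrightarrow> - \<sigma> z) finsets" by simp
  from tendsto_unique[OF _ conv this] show ?thesis by simp
qed

lemma deriv_sigma_uminus: "deriv \<sigma> (- z) = deriv \<sigma> z"
proof -
  have "((\<lambda>z. - \<sigma> (- z)) has_field_derivative deriv \<sigma> (- z)) (at z)"
    by (auto intro!: derivative_eq_intros DERIV_chain2[OF sigma_has_field_derivative])
  moreover have "(\<lambda>z. - \<sigma> (- z)) = \<sigma>" by (simp add: sigma_uminus)
  ultimately show ?thesis using DERIV_imp_deriv by metis
qed

text \<open>Each partial product is \<open>z\<close> times a function with value 1 at 0, and
  derivatives pass to the limit. This fixes the constant in the addition formula.\<close>

lemma deriv_sigma_0: "deriv \<sigma> 0 = 1"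
proof -
  have "deriv (sigma_prod V) 0 = 1" if "V \<subseteq> L - {0}" for V
  proof (rule DERIV_imp_deriv)
    have "(\<lambda>z. \<Prod>\<omega>\<in>V. weierstrass_factor 2 (z / \<omega>)) holomorphic_on UNIV"
      using that by (auto intro!: holomorphic_intros)
    hence "((\<lambda>z. \<Prod>\<omega>\<in>V. weierstrass_factor 2 (z / \<omega>)) has_field_derivative
        deriv (\<lambda>z. \<Prod>\<omega>\<in>V. weierstrass_factor 2 (z / \<omega>)) 0) (at 0)"
      by (rule holomorphic_derivI) auto
    from DERIV_mult[OF DERIV_ident this] show "(sigma_prod V has_field_derivative 1) (at 0)"
      unfolding sigma_prod_def [abs_def] by simp
  qed
  hence "\<forall>\<^sub>F V in finsets. deriv (sigma_prod V) 0 = 1" by (intro eventually_finsets)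
  hence "((\<lambda>V. deriv (sigma_prod V) 0) \<longlongrightarrow> 1) finsets" by (rule tendsto_eventually)
  with tendsto_deriv_sigma[of 1 0] show ?thesis by (auto dest: tendsto_unique[rotated])
qed

text \<open>Both sides are minus the derivative of \<open>Z\<close>, the logarithmic derivative of
  the partial product. In terms of derivatives of \<open>sigma_prod V\<close> the identity survives
  the limit.\<close>

lemma weierstrass_p_partial_sum:
  assumes V: "finite V" "V \<subseteq> L - {0}" and z: "z \<notin> L"
  shows "1 / z\<^sup>2 + (\<Sum>\<omega>\<in>V. 1 / (z - \<omega>)\<^sup>2 - 1 / \<omega>\<^sup>2) =
    (deriv (sigma_prod V) z / sigma_prod V z)\<^sup>2 - deriv (deriv (sigma_prod V)) z / sigma_prod V z"
proof -
  define Z where "Z = (\<lambda>z. 1 / z + (\<Sum>\<omega>\<in>V. 1 / (z - \<omega>) + 1 / \<omega> + z / \<omega>\<^sup>2))"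
  have nz: "w \<noteq> 0" "\<And>\<omega>. \<omega> \<in> V \<Longrightarrow> \<omega> \<noteq> 0 \<and> w \<noteq> \<omega>" if "w \<notin> L" for w
    using that V zero_in_L by auto
  have fac: "((\<lambda>w. weierstrass_factor 2 (w / \<omega>)) has_field_derivative
      weierstrass_factor 2 (w / \<omega>) * (1 / (w - \<omega>) + 1 / \<omega> + w / \<omega>\<^sup>2)) (at w)"
    if "\<omega> \<noteq> 0" "w \<noteq> \<omega>" for w \<omega>
  proof -
    have eq: "weierstrass_factor 2 (w / \<omega>) = (1 - w / \<omega>) * exp (w / \<omega> + (w / \<omega>)\<^sup>2 / 2)" for w
      by (simp add: weierstrass_factor_def numeral_2_eq_2)
    have "1 - w / \<omega> = - (1 / \<omega>) * (w - \<omega>)" using that by (simp add: diff_divide_distrib)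
    hence one: "(1 - w / \<omega>) * (1 / (w - \<omega>)) = - (1 / \<omega>)" using that by simp
    have key: "- (1 / \<omega>) + (1 - w / \<omega>) * (1 / \<omega> + w / \<omega>\<^sup>2) = (1 - w / \<omega>) * (1 / (w - \<omega>) + 1 / \<omega> + w / \<omega>\<^sup>2)"
      by (simp only: distrib_left one add.assoc)
    have 1: "((\<lambda>w. 1 - w / \<omega>) has_field_derivative - (1 / \<omega>)) (at w)"
      using that by (auto intro!: derivative_eq_intros)
    have 2: "((\<lambda>w. w / \<omega> + (w / \<omega>)\<^sup>2 / 2) has_field_derivative 1 / \<omega> + w / \<omega>\<^sup>2) (at w)"
      using that by (auto intro!: derivative_eq_intros simp: power2_eq_square)
    have gen: "a * e + e * b * c = e * (a + c * b)" for a b c e :: complex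
      by (simp add: algebra_simps)
    show ?thesis
      unfolding eq
      by (rule DERIV_cong[OF DERIV_mult[OF 1 DERIV_fun_exp[OF 2]]]) (unfold gen key, simp only: mult_ac)
  qed
  have D: "(sigma_prod V has_field_derivative sigma_prod V w * Z w) (at w)" if w: "w \<notin> L" for w
  proof -
    have gen: "F * e * P + P * S * F = F * P * (e + S)" for F e P S :: complex
      by (simp add: algebra_simps)
    have "((\<lambda>w. \<Prod>\<omega>\<in>V. weierstrass_factor 2 (w / \<omega>)) has_field_derivative
       (\<Prod>\<omega>\<in>V. weierstrass_factor 2 (w / \<omega>)) * (\<Sum>\<omega>\<in>V. 1 / (w - \<omega>) + 1 / \<omega> + w / \<omega>\<^sup>2)) (at w)"
      using V(1) nz(2)[OF w]
    proof (induction V)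
      case (insert x Y)
      have x: "x \<noteq> 0" "w \<noteq> x" using insert.prems[of x] by auto
      have IH: "((\<lambda>w. \<Prod>\<omega>\<in>Y. weierstrass_factor 2 (w / \<omega>)) has_field_derivative
         (\<Prod>\<omega>\<in>Y. weierstrass_factor 2 (w / \<omega>)) * (\<Sum>\<omega>\<in>Y. 1 / (w - \<omega>) + 1 / \<omega> + w / \<omega>\<^sup>2)) (at w)"
        using insert by simp
      show ?case
        unfolding prod.insert[OF insert.hyps] sum.insert[OF insert.hyps]
        by (rule DERIV_cong[OF DERIV_mult[OF fac[OF x] IH]]) (rule gen)
    qed auto
    from DERIV_mult[OF DERIV_ident this] show ?thesis
      unfolding sigma_prod_def [abs_def] Z_def
      by (rule DERIV_cong) (use nz(1)[OF w] in \<open>simp add: distrib_left mult_ac\<close>)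
  qed
  have DZ: "(Z has_field_derivative - (1 / z\<^sup>2 + (\<Sum>\<omega>\<in>V. 1 / (z - \<omega>)\<^sup>2 - 1 / \<omega>\<^sup>2))) (at z)"
  proof -
    have "((\<lambda>z. 1 / (z - \<omega>) + 1 / \<omega> + z / \<omega>\<^sup>2) has_field_derivative - (1 / (z - \<omega>)\<^sup>2 - 1 / \<omega>\<^sup>2)) (at z)"
      if "\<omega> \<in> V" for \<omega>
    proof -
      have "z - \<omega> \<noteq> 0" "\<omega> \<noteq> 0" using nz(2)[OF z that] by simp_all
      thus ?thesis by (auto intro!: derivative_eq_intros simp: power2_eq_square)
    qed
    hence "((\<lambda>z. \<Sum>\<omega>\<in>V. 1 / (z - \<omega>) + 1 / \<omega> + z / \<omega>\<^sup>2) has_field_derivative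
        (\<Sum>\<omega>\<in>V. - (1 / (z - \<omega>)\<^sup>2 - 1 / \<omega>\<^sup>2))) (at z)" by (rule DERIV_sum)
    moreover have "((\<lambda>z. 1 / z) has_field_derivative - (1 / z\<^sup>2)) (at z)"
      using nz(1)[OF z] by (auto intro!: derivative_eq_intros simp: power2_eq_square)
    ultimately show ?thesis unfolding Z_def
      by (intro DERIV_cong[OF DERIV_add]) (assumption, assumption, simp only: sum_negf minus_add_distrib)
  qed
  have d1: "deriv (sigma_prod V) w = sigma_prod V w * Z w" if "w \<notin> L" for w
    using D[OF that] by (rule DERIV_imp_deriv)
  have "(deriv (sigma_prod V) has_field_derivative
      sigma_prod V z * Z z * Z z + (- (1 / z\<^sup>2 + (\<Sum>\<omega>\<in>V. 1 / (z - \<omega>)\<^sup>2 - 1 / \<omega>\<^sup>2))) * sigma_prod V z) (at z)"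
    by (rule has_field_derivative_transform_within_open[OF DERIV_mult[OF D[OF z] DZ], of "- L"])
       (use z closed_L d1 in \<open>auto simp: open_Compl\<close>)
  hence d2: "deriv (deriv (sigma_prod V)) z =
      sigma_prod V z * Z z * Z z + (- (1 / z\<^sup>2 + (\<Sum>\<omega>\<in>V. 1 / (z - \<omega>)\<^sup>2 - 1 / \<omega>\<^sup>2))) * sigma_prod V z"
    by (rule DERIV_imp_deriv)
  have "sigma_prod V z \<noteq> 0" using nz[OF z] V by (auto simp: sigma_prod_def)
  thus ?thesis unfolding d1[OF z] d2 by (simp add: power2_eq_square add_divide_distrib diff_divide_distrib)
qed

text \<open>The classical fact that the p-function is minus the second derivative of
  \<open>log \<sigma>\<close>. The convergence of its series comes out of the same limit.\<close>

lemma weierstrass_p_eq: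
  assumes z: "z \<notin> L"
  shows "wp z = (deriv \<sigma> z / \<sigma> z)\<^sup>2 - deriv (deriv \<sigma>) z / \<sigma> z"
proof -
  have nz: "\<sigma> z \<noteq> 0" using z by (simp add: sigma_eq_0_iff)
  have lim: "((\<lambda>V. (deriv (sigma_prod V) z / sigma_prod V z)\<^sup>2 - deriv (deriv (sigma_prod V)) z / sigma_prod V z)
     \<longlongrightarrow> (deriv \<sigma> z / \<sigma> z)\<^sup>2 - deriv (deriv \<sigma>) z / \<sigma> z) finsets"
    using tendsto_deriv_sigma[of 0 z] tendsto_deriv_sigma[of 1 z] tendsto_deriv_sigma[of 2 z] nz
    by (intro tendsto_intros) (simp_all add: numeral_2_eq_2)
  have "((\<lambda>V. 1 / z\<^sup>2 + (\<Sum>\<omega>\<in>V. 1 / (z - \<omega>)\<^sup>2 - 1 / \<omega>\<^sup>2))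
     \<longlongrightarrow> (deriv \<sigma> z / \<sigma> z)\<^sup>2 - deriv (deriv \<sigma>) z / \<sigma> z) finsets"
    by (rule Lim_transform_eventually[OF lim])
       (rule eventually_finsets, rule weierstrass_p_partial_sum [symmetric], use z in auto)
  from tendsto_diff[OF this tendsto_const[of "1 / z\<^sup>2"]]
  have "((\<lambda>\<omega>. 1 / (z - \<omega>)\<^sup>2 - 1 / \<omega>\<^sup>2) has_sum ((deriv \<sigma> z / \<sigma> z)\<^sup>2 - deriv (deriv \<sigma>) z / \<sigma> z - 1 / z\<^sup>2)) (L - {0})"
    unfolding has_sum_def by simp
  from infsumI[OF this] show ?thesis by (simp add: weierstrass_p_def)
qed

definition zeta :: "complex \<Rightarrow> complex" where "zeta z = deriv \<sigma> z / \<sigma> z"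

lemma zeta_has_field_derivative:
  assumes "z \<notin> L" shows "(zeta has_field_derivative - wp z) (at z)"
proof -
  have nz: "\<sigma> z \<noteq> 0" using assms by (simp add: sigma_eq_0_iff)
  have "((\<lambda>z. deriv \<sigma> z / \<sigma> z) has_field_derivative - wp z) (at z)"
    by (rule DERIV_cong[OF DERIV_divide[OF deriv_sigma_has_field_derivative sigma_has_field_derivative nz]])
       (use nz in \<open>simp add: weierstrass_p_eq[OF assms] field_simps power2_eq_square\<close>)
  thus ?thesis by (simp add: zeta_def [abs_def])
qed

lemma holomorphic_weierstrass_p: "wp holomorphic_on - L"
proof -
  have "(\<lambda>z. (deriv \<sigma> z / \<sigma> z)\<^sup>2 - deriv (deriv \<sigma>) z / \<sigma> z) holomorphic_on - L"
    by (intro holomorphic_intros holomorphic_deriv holomorphic_sigma)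
       (use closed_L in \<open>auto simp: open_Compl sigma_eq_0_iff\<close>)
  thus ?thesis by (rule holomorphic_transform) (simp add: weierstrass_p_eq)
qed

end

section \<open>The addition formula for sigma\<close>

text \<open>The last equation needs \<open>y \<noteq> 0\<close>, because the inverse in a ring
  record is unspecified at 0.\<close>

lemma ring_of_type_algebra_simps:
  fixes x y :: "'a :: Fields.field"
  defines "R \<equiv> (ring_of_type_algebra :: 'a ring)"
  shows "carrier R = UNIV" "\<zero>\<^bsub>R\<^esub> = 0" "\<one>\<^bsub>R\<^esub> = 1" "x \<oplus>\<^bsub>R\<^esub> y = x + y" "x \<otimes>\<^bsub>R\<^esub> y = x * y"
    "\<ominus>\<^bsub>R\<^esub> x = - x" "x \<ominus>\<^bsub>R\<^esub> y = x - y"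
    "[(2::nat)] \<cdot>\<^bsub>R\<^esub> x = 2 * x" "[(3::nat)] \<cdot>\<^bsub>R\<^esub> x = 3 * x"
    "y \<noteq> 0 \<Longrightarrow> inv\<^bsub>R\<^esub> y = inverse y"
proof -
  interpret R: Ring.field R unfolding R_def by (rule field_from_type_algebra)
  show 1: "carrier R = UNIV" "\<zero>\<^bsub>R\<^esub> = 0" "\<one>\<^bsub>R\<^esub> = 1"
    and add: "x \<oplus>\<^bsub>R\<^esub> y = x + y" and mult: "x \<otimes>\<^bsub>R\<^esub> y = x * y" for x y :: 'a
    by (simp_all add: R_def ring_of_type_algebra_def)
  show neg: "\<ominus>\<^bsub>R\<^esub> x = - x" for x
    by (rule R.minus_equality) (simp_all add: 1 add)
  show "x \<ominus>\<^bsub>R\<^esub> y = x - y" by (simp add: a_minus_def add neg)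
  show "[(2::nat)] \<cdot>\<^bsub>R\<^esub> x = 2 * x" "[(3::nat)] \<cdot>\<^bsub>R\<^esub> x = 3 * x"
    by (simp_all add: numeral_2_eq_2 numeral_3_eq_3 R.add.nat_pow_Suc add 1)
  show "inv\<^bsub>R\<^esub> y = inverse y" if "y \<noteq> 0"
    by (rule R.comm_inv_char) (use that in \<open>simp_all add: 1 mult\<close>)
qed

lemma wadd_eq_Infinity_iff:
  fixes x1 :: "'a :: Fields.field"
  shows "wadd ring_of_type_algebra (WCurve a1 a2 a3 a4 a6) (Affine x1 y1) (Affine x2 y2) = Infinity \<longleftrightarrow>
    x1 = x2 \<and> y1 + y2 + a1 * x2 + a3 = 0"
  by (simp add: Let_def ring_of_type_algebra_simps)

lemma wadd_chord:
  fixes x1 x2 y1 y2 a1 a2 a3 a4 a6 :: "'a :: Fields.field"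
  assumes "x1 \<noteq> x2"
  defines "l \<equiv> (y2 - y1) / (x2 - x1)"
  defines "x3 \<equiv> l\<^sup>2 + a1 * l - a2 - x1 - x2"
  shows "wadd ring_of_type_algebra (WCurve a1 a2 a3 a4 a6) (Affine x1 y1) (Affine x2 y2) =
    Affine x3 (- (y1 + l * (x3 - x1)) - a1 * x3 - a3)"
  using assms(1) unfolding l_def x3_def
  by (simp add: Let_def ring_of_type_algebra_simps divide_inverse power2_eq_square)

lemma wadd_tangent:
  fixes x y a1 a2 a3 a4 a6 :: "'a :: Fields.field"
  assumes "2 * y + a1 * x + a3 \<noteq> 0"
  defines "l \<equiv> (3 * x\<^sup>2 + 2 * a2 * x + a4 - a1 * y) / (2 * y + a1 * x + a3)"
  defines "x3 \<equiv> l\<^sup>2 + a1 * l - a2 - 2 * x"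
  shows "wadd ring_of_type_algebra (WCurve a1 a2 a3 a4 a6) (Affine x y) (Affine x y) =
    Affine x3 (- (y + l * (x3 - x)) - a1 * x3 - a3)"
proof -
  have y: "y + y + a1 * x + a3 \<noteq> 0" using assms(1) by (simp only: mult_2 not_False_eq_True)
  have x: "x3 = l * l + a1 * l - a2 - x - x" by (simp add: x3_def power2_eq_square)
  have l: "l = (3 * (x * x) + 2 * (a2 * x) + a4 - a1 * y) * inverse (2 * y + a1 * x + a3)"
    by (simp add: l_def divide_inverse power2_eq_square mult.assoc)
  show ?thesis unfolding x l using y assms(1)
    by (simp only: wadd.simps Let_def ring_of_type_algebra_simps if_True if_False simp_thms)
qed

lemma wneg_field:
  "wneg (ring_of_type_algebra :: 'a :: Fields.field ring) (WCurve a1 a2 a3 a4 a6) (Affine x y) =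
    Affine x (- y - a1 * x - a3)"
  by (simp add: ring_of_type_algebra_simps)

lemma on_wcurve_field:
  "on_wcurve (ring_of_type_algebra :: 'a :: Fields.field ring) (WCurve a1 a2 a3 a4 a6) (Affine x y) \<longleftrightarrow>
    y\<^sup>2 + a1 * x * y + a3 * y = x ^ 3 + a2 * x\<^sup>2 + a4 * x + a6"
  by (simp add: ring_of_type_algebra_simps power2_eq_square power3_eq_cube mult.assoc)

text \<open>The algebraic core of the addition formula. \<open>Xu\<close>, \<open>Xv\<close> are
  x-coordinates, \<open>Du\<close>, \<open>Dv\<close> their derivatives, and \<open>c2\<close>,
  \<open>c4\<close>, \<open>c6\<close> the quantities \<open>b2\<close>, \<open>b4\<close>,
  \<open>b6\<close>. The two brackets are the x-coordinates at \<open>u + v\<close> and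
  \<open>u - v\<close> by the chord law; the fraction is the derivative of
  \<open>Du / (Xu - Xv)\<close>, with \<open>6 * Xu\<^sup>2 + c2 * Xu + c4\<close> as the derivative
  of \<open>Du\<close>.\<close>

lemma addition_identity:
  fixes Xu Xv Du Dv c2 c4 c6 :: complex
  assumes "Xu \<noteq> Xv"
    and "Du\<^sup>2 = 4 * Xu ^ 3 + c2 * Xu\<^sup>2 + 2 * c4 * Xu + c6"
    and "Dv\<^sup>2 = 4 * Xv ^ 3 + c2 * Xv\<^sup>2 + 2 * c4 * Xv + c6"
  shows "(((Dv - Du) / (Xv - Xu))\<^sup>2 / 4 - c2 / 4 - Xu - Xv) + (((- Dv - Du) / (Xv - Xu))\<^sup>2 / 4 - c2 / 4 - Xu - Xv)
    - 2 * Xu + ((6 * Xu\<^sup>2 + c2 * Xu + c4) * (Xu - Xv) - Du * Du) / ((Xu - Xv) * (Xu - Xv)) = 0"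
proof -
  define d where "d = Xv - Xu"
  have d: "d \<noteq> 0" using assms by (simp add: d_def)
  have sum: "((Dv - Du) / d)\<^sup>2 + ((- Dv - Du) / d)\<^sup>2 = 2 * (Dv\<^sup>2 + Du\<^sup>2) / d\<^sup>2"
    by (simp add: power_divide add_divide_distrib [symmetric]) (simp add: power2_eq_square algebra_simps)
  have "(Dv\<^sup>2 + Du\<^sup>2) - (c2 + 8 * Xu + 4 * Xv) * d\<^sup>2 - 2 * (6 * Xu\<^sup>2 + c2 * Xu + c4) * d - 2 * Du\<^sup>2 = 0"
    unfolding assms(2,3) d_def by Groebner_Basis.algebra
  moreover have "A / 2 - (c2 / 2 + 4 * Xu + 2 * Xv) * B - C - D = (A - (c2 + 8 * Xu + 4 * Xv) * B - 2 * C - 2 * D) / 2"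
    for A B C D :: complex by (simp add: diff_divide_distrib add_divide_distrib distrib_right)
  ultimately have "(Dv\<^sup>2 + Du\<^sup>2) / 2 - (c2 / 2 + 4 * Xu + 2 * Xv) * d\<^sup>2 - (6 * Xu\<^sup>2 + c2 * Xu + c4) * d - Du\<^sup>2 = 0"
    by (simp only: mult.assoc) simp
  hence zero: "((Dv\<^sup>2 + Du\<^sup>2) / 2 - (c2 / 2 + 4 * Xu + 2 * Xv) * d\<^sup>2 - (6 * Xu\<^sup>2 + c2 * Xu + c4) * d - Du\<^sup>2) / d\<^sup>2 = 0"
    by simp
  have key: "(Dv\<^sup>2 + Du\<^sup>2) / 2 / d\<^sup>2 - (c2 / 2 + 4 * Xu + 2 * Xv) - ((6 * Xu\<^sup>2 + c2 * Xu + c4) * d + Du\<^sup>2) / d\<^sup>2 = 0"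
  proof -
    have "(A - K * B - C - D) / B = A / B - K - (C + D) / B" if "B \<noteq> 0" for A K B C D :: complex
      using that by (simp add: diff_divide_distrib add_divide_distrib)
    moreover have "d\<^sup>2 \<noteq> 0" using d by simp
    ultimately show ?thesis using zero by metis
  qed
  have "Xu - Xv = - d" by (simp add: d_def)
  hence 2: "((6 * Xu\<^sup>2 + c2 * Xu + c4) * (Xu - Xv) - Du * Du) / ((Xu - Xv) * (Xu - Xv)) =
      - (((6 * Xu\<^sup>2 + c2 * Xu + c4) * d + Du\<^sup>2) / d\<^sup>2)"
    by (simp add: power2_eq_square minus_divide_left)
  have "(((Dv - Du) / d)\<^sup>2 / 4 - c2 / 4 - Xu - Xv) + (((- Dv - Du) / d)\<^sup>2 / 4 - c2 / 4 - Xu - Xv) - 2 * Xu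
     = (((Dv - Du) / d)\<^sup>2 + ((- Dv - Du) / d)\<^sup>2) / 4 - (c2 / 2 + 4 * Xu + 2 * Xv)"
    by (simp add: add_divide_distrib)
  also have "\<dots> = (Dv\<^sup>2 + Du\<^sup>2) / 2 / d\<^sup>2 - (c2 / 2 + 4 * Xu + 2 * Xv)" unfolding sum
  proof -
    have "2 * A / B / 4 = A / 2 / B" for A B :: complex by (cases "B = 0") (simp_all add: frac_eq_eq)
    thus "2 * (Dv\<^sup>2 + Du\<^sup>2) / d\<^sup>2 / 4 - (c2 / 2 + 4 * Xu + 2 * Xv) = (Dv\<^sup>2 + Du\<^sup>2) / 2 / d\<^sup>2 - (c2 / 2 + 4 * Xu + 2 * Xv)"
      by (simp only:)
  qed
  finally show ?thesis using key unfolding 2 d_def [symmetric] by (simp only: add_uminus_conv_diff)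
qed

section \<open>Coordinates of the uniformization and their derivatives\<close>

locale uniformized =
  fixes L :: "complex set" and a1 a2 a3 a4 a6 :: complex
  assumes unif: "uniformizes L (WCurve a1 a2 a3 a4 a6)"

sublocale uniformized \<subseteq> complex_lattice
  using unif by unfold_locales (simp add: uniformizes_def)

context uniformized
begin

abbreviation "b2 \<equiv> a1\<^sup>2 + 4 * a2"
abbreviation "b4 \<equiv> 2 * a4 + a1 * a3"
abbreviation "b6 \<equiv> a3\<^sup>2 + 4 * a6"

abbreviation param :: "complex \<Rightarrow> complex wpoint" where "param \<equiv> wparam L (WCurve a1 a2 a3 a4 a6)"

definition xp :: "complex \<Rightarrow> complex" where "xp z = weierstrass_p L z - b2 / 12"
definition dxp :: "complex \<Rightarrow> complex" where "dxp z = deriv (weierstrass_p L) z"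
definition yp :: "complex \<Rightarrow> complex" where "yp z = (dxp z - a1 * xp z - a3) / 2"

lemma param_in: "z \<in> L \<Longrightarrow> param z = Infinity"
  and param_notin: "z \<notin> L \<Longrightarrow> param z = Affine (xp z) (yp z)"
  by (simp_all add: wparam_def xp_def yp_def dxp_def Let_def)

lemma param_eq_Infinity_iff: "param z = Infinity \<longleftrightarrow> z \<in> L"
  using param_in param_notin by (cases "z \<in> L") auto

lemma dxp_eq: "dxp z = 2 * yp z + a1 * xp z + a3"
  by (simp add: yp_def)

lemma param_add: "param (z + w) = wadd complex_field (WCurve a1 a2 a3 a4 a6) (param z) (param w)"
  and param_eq_iff: "param z = param w \<longleftrightarrow> z - w \<in> L"
  using unif unfolding uniformizes_def by blast+

text \<open>The differential equation of the p-function is read off from the parametrized point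
  lying on the curve; \<open>dxp\<close> is the coordinate that completes the square in
  \<open>yp\<close>.\<close>

lemma curve_eq:
  assumes "z \<notin> L"
  shows "(dxp z)\<^sup>2 = 4 * xp z ^ 3 + b2 * (xp z)\<^sup>2 + 2 * b4 * xp z + b6"
proof -
  have "param z \<in> wpoints complex_field (WCurve a1 a2 a3 a4 a6)"
    using unif unfolding uniformizes_def by blast
  hence "(yp z)\<^sup>2 + a1 * xp z * yp z + a3 * yp z = xp z ^ 3 + a2 * (xp z)\<^sup>2 + a4 * xp z + a6"
    by (simp only: wpoints_def mem_Collect_eq param_notin[OF assms] on_wcurve_field)
  thus ?thesis unfolding dxp_eq by Groebner_Basis.algebra
qed

lemma xp_uminus: "z \<notin> L \<Longrightarrow> xp (- z) = xp z"
  and dxp_uminus: "z \<notin> L \<Longrightarrow> dxp (- z) = - dxp z"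
proof -
  assume z: "z \<notin> L"
  have "param (z + - z) = Infinity" using zero_in_L by (simp add: param_in)
  hence "wadd complex_field (WCurve a1 a2 a3 a4 a6) (Affine (xp z) (yp z)) (Affine (xp (- z)) (yp (- z))) = Infinity"
    unfolding param_add using z by (simp only: param_notin uminus_in_L_iff not_False_eq_True)
  hence *: "xp z = xp (- z)" "yp z + yp (- z) + a1 * xp (- z) + a3 = 0"
    by (simp_all only: wadd_eq_Infinity_iff)
  thus "xp (- z) = xp z" by simp
  show "dxp (- z) = - dxp z" using *(2) unfolding dxp_eq *(1) [symmetric] by Groebner_Basis.algebra
qed

text \<open>With \<open>dxp\<close> in place of \<open>yp\<close> the slope becomes
  \<open>2 * l + a1\<close>, and completing the square in \<open>l\<^sup>2 + a1 * l - a2\<close>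
  turns \<open>a1\<close>, \<open>a2\<close> into \<open>b2\<close>.\<close>

lemma xp_add:
  assumes "u \<notin> L" "v \<notin> L" "xp u \<noteq> xp v"
  shows "xp (u + v) = ((dxp v - dxp u) / (xp v - xp u))\<^sup>2 / 4 - b2 / 4 - xp u - xp v"
    and "u + v \<notin> L"
proof -
  define l where "l = (yp v - yp u) / (xp v - xp u)"
  define x3 where "x3 = l\<^sup>2 + a1 * l - a2 - xp u - xp v"
  have nz: "xp v - xp u \<noteq> 0" using assms by simp
  have p: "param (u + v) = Affine x3 (- (yp u + l * (x3 - xp u)) - a1 * x3 - a3)"
    using assms by (simp only: param_add param_notin wadd_chord l_def x3_def not_False_eq_True)
  thus "u + v \<notin> L" by (auto simp: param_in)
  with p have "xp (u + v) = x3" by (simp add: param_notin)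
  also have "x3 = (2 * l + a1)\<^sup>2 / 4 - b2 / 4 - xp u - xp v"
  proof -
    have "x3 * 4 = (2 * l + a1)\<^sup>2 - b2 - 4 * xp u - 4 * xp v"
      unfolding x3_def by Groebner_Basis.algebra
    hence "x3 = ((2 * l + a1)\<^sup>2 - b2 - 4 * xp u - 4 * xp v) / 4"
      by (simp only: eq_divide_eq) simp
    thus ?thesis by (simp only: diff_divide_distrib) simp
  qed
  also have "2 * l + a1 = (dxp v - dxp u) / (xp v - xp u)"
  proof -
    have "dxp v - dxp u = 2 * (yp v - yp u) + a1 * (xp v - xp u)"
      by (simp add: dxp_eq algebra_simps)
    thus ?thesis using nz by (simp add: l_def add_divide_distrib)
  qed
  finally show "xp (u + v) = ((dxp v - dxp u) / (xp v - xp u))\<^sup>2 / 4 - b2 / 4 - xp u - xp v" .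
qed

lemma xp_eqD:
  assumes "u \<notin> L" "v \<notin> L" "xp u = xp v"
  shows "u - v \<in> L \<or> u + v \<in> L"
proof -
  have "(dxp u)\<^sup>2 = (dxp v)\<^sup>2" using curve_eq[OF assms(1)] curve_eq[OF assms(2)] assms(3) by simp
  hence "dxp u = dxp v \<or> dxp u = - dxp v" by (simp add: power2_eq_iff)
  thus ?thesis
  proof
    assume "dxp u = dxp v"
    hence "param u = param v" using assms by (simp add: param_notin yp_def)
    thus ?thesis by (simp add: param_eq_iff)
  next
    assume "dxp u = - dxp v"
    hence "yp u + yp v + a1 * xp v + a3 = 0" using assms(3) unfolding dxp_eq by Groebner_Basis.algebra
    hence "param (u + v) = Infinity"
      unfolding param_add param_notin[OF assms(1)] param_notin[OF assms(2)] wadd_eq_Infinity_iff using assms(3) by simp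
    thus ?thesis by (simp add: param_eq_Infinity_iff)
  qed
qed

lemma dxp_eq_0D:
  assumes "z \<notin> L" "dxp z = 0"
  shows "2 * z \<in> L"
proof -
  have "yp z + yp z + a1 * xp z + a3 = 0" using assms(2) unfolding dxp_eq by Groebner_Basis.algebra
  hence "param (z + z) = Infinity"
    unfolding param_add param_notin[OF assms(1)] wadd_eq_Infinity_iff by simp
  thus ?thesis by (simp add: param_eq_Infinity_iff)
qed

lemma xp_has_field_derivative: "z \<notin> L \<Longrightarrow> (xp has_field_derivative dxp z) (at z)"
proof -
  assume z: "z \<notin> L"
  have "(weierstrass_p L has_field_derivative deriv (weierstrass_p L) z) (at z)"
    by (rule holomorphic_derivI[OF holomorphic_weierstrass_p]) (use z closed_L in \<open>auto simp: open_Compl\<close>)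
  thus ?thesis unfolding xp_def [abs_def] dxp_def by (auto intro!: derivative_eq_intros)
qed

text \<open>The curve equation is differentiated and divided by \<open>2 * dxp z\<close>, which is
  nonzero away from the 2-torsion.\<close>

lemma dxp_has_field_derivative:
  assumes z: "z \<notin> L" "2 * z \<notin> L"
  shows "(dxp has_field_derivative 6 * (xp z)\<^sup>2 + b2 * xp z + b4) (at z)"
proof -
  have op: "open (- L)" using closed_L by (simp add: open_Compl)
  have "dxp holomorphic_on - L"
    unfolding dxp_def [abs_def] by (rule holomorphic_deriv[OF holomorphic_weierstrass_p op])
  hence D: "(dxp has_field_derivative deriv dxp z) (at z)"
    by (rule holomorphic_derivI) (use z op in auto)
  have "((\<lambda>w. 4 * xp w ^ 3 + b2 * (xp w)\<^sup>2 + 2 * b4 * xp w + b6) has_field_derivative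
      4 * (3 * (xp z)\<^sup>2 * dxp z) + b2 * (2 * xp z * dxp z) + 2 * b4 * dxp z) (at z)"
    using xp_has_field_derivative[OF z(1)]
    by (auto intro!: derivative_eq_intros simp: numeral_2_eq_2)
  moreover have "((\<lambda>w. 4 * xp w ^ 3 + b2 * (xp w)\<^sup>2 + 2 * b4 * xp w + b6) has_field_derivative
      2 * dxp z * deriv dxp z) (at z)"
  proof (rule has_field_derivative_transform_within_open[where S = "- L"])
    show "((\<lambda>w. (dxp w)\<^sup>2) has_field_derivative 2 * dxp z * deriv dxp z) (at z)"
      using D by (auto intro!: derivative_eq_intros)
  qed (use op z curve_eq in auto)
  ultimately have "2 * dxp z * deriv dxp z = 4 * (3 * (xp z)\<^sup>2 * dxp z) + b2 * (2 * xp z * dxp z) + 2 * b4 * dxp z"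
    by (rule DERIV_unique[rotated])
  hence "2 * dxp z * (deriv dxp z - (6 * (xp z)\<^sup>2 + b2 * xp z + b4)) = 0" by Groebner_Basis.algebra
  moreover have "dxp z \<noteq> 0" using dxp_eq_0D z by blast
  ultimately have "deriv dxp z = 6 * (xp z)\<^sup>2 + b2 * xp z + b4" by simp
  with D show ?thesis by simp
qed

lemma eventually_affine_notin_L:
  assumes "a \<noteq> 0"
  shows "\<forall>\<^sub>F w in at u. a * w + b \<notin> L"
proof -
  have "((\<lambda>w. a * w + b) \<longlongrightarrow> a * u + b) (at u)" by (intro tendsto_intros)
  moreover have "\<forall>\<^sub>F w in at u. a * w + b \<noteq> a * u + b"
    using eventually_neq_at_within[of u u UNIV] by eventually_elim (use assms in auto)
  ultimately have "filterlim (\<lambda>w. a * w + b) (at (a * u + b)) (at u)"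
    by (simp add: filterlim_at)
  from eventually_compose_filterlim[OF discrete_L this] show ?thesis .
qed

section \<open>Addition, duplication and three-term formulas for sigma\<close>

text \<open>Off the first three translates both sides of the addition formula are nonzero and have
  logarithmic derivatives; excluding \<open>2 * u \<in> L\<close> gives access to the derivative of
  \<open>dxp\<close>.\<close>

definition generic :: "complex \<Rightarrow> complex set" where
  "generic v = {u. u \<notin> L \<and> u + v \<notin> L \<and> u - v \<notin> L \<and> 2 * u \<notin> L}"

lemma eventually_generic: "\<forall>\<^sub>F w in at u. w \<in> generic v"
proof -
  note ev = eventually_affine_notin_L[of _ _ u]
  have "\<forall>\<^sub>F w in at u. 1 * w + 0 \<notin> L \<and> 1 * w + v \<notin> L \<and> 1 * w + (- v) \<notin> L \<and> 2 * w + 0 \<notin> L"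
    by (intro eventually_conj ev) auto
  thus ?thesis by (rule eventually_mono) (simp add: generic_def)
qed

lemma generic_open: "open (generic v)"
proof -
  have "generic v = - L \<inter> (\<lambda>u. u + v) -` (- L) \<inter> (\<lambda>u. u - v) -` (- L) \<inter> (\<lambda>u. 2 * u) -` (- L)"
    by (auto simp: generic_def)
  thus ?thesis using closed_L
    by (auto intro!: open_Int open_vimage continuous_intros simp: open_Compl)
qed

text \<open>Removing a countable set from the plane leaves it connected, so a vanishing derivative
  on \<open>generic v\<close> means a single constant.\<close>

lemma generic_connected: "connected (generic v)"
proof -
  have "generic v = UNIV - (L \<union> (\<lambda>u. u - v) ` L \<union> (\<lambda>u. u + v) ` L \<union> (\<lambda>u. u / 2) ` L)"
  proof -
    have "x \<in> (\<lambda>u. u - v) ` L \<longleftrightarrow> x + v \<in> L" for x by (force intro: image_eqI[of _ _ "x + v"])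
    moreover have "x \<in> (\<lambda>u. u + v) ` L \<longleftrightarrow> x - v \<in> L" for x by (force intro: image_eqI[of _ _ "x - v"])
    moreover have "x \<in> (\<lambda>u. u / 2) ` L \<longleftrightarrow> 2 * x \<in> L" for x by (force intro: image_eqI[of _ _ "2 * x"])
    ultimately show ?thesis unfolding generic_def by blast
  qed
  moreover have "connected (UNIV - (L \<union> (\<lambda>u. u - v) ` L \<union> (\<lambda>u. u + v) ` L \<union> (\<lambda>u. u / 2) ` L))"
    by (rule connected_open_diff_countable) (auto intro: countable_L countable_image)
  ultimately show ?thesis by simp
qed

text \<open>\<open>H\<close> is the logarithmic derivative of the quotient \<open>h\<close>. Once
  \<open>H\<close> is constant, its oddness on the symmetric set \<open>generic v\<close> makes it
  0, so \<open>h\<close> is constant too; letting \<open>u\<close> tend to 0 identifies that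
  constant.\<close>

lemma sigma_add_generic:
  assumes v: "v \<notin> L" and u: "u \<in> generic v"
  shows "weierstrass_sigma L (u + v) * weierstrass_sigma L (u - v) =
    - (weierstrass_sigma L u)\<^sup>2 * (weierstrass_sigma L v)\<^sup>2 * (xp u - xp v)"
proof -
  define H where "H = (\<lambda>u. zeta (u + v) + zeta (u - v) - 2 * zeta u - dxp u / (xp u - xp v))"
  have gen: "u \<notin> L" "u + v \<notin> L" "u - v \<notin> L" "2 * u \<notin> L" "xp u \<noteq> xp v" "xp u - xp v \<noteq> 0" if "u \<in> generic v" for u
    using that v xp_eqD[of u v] by (auto simp: generic_def)
  have dH: "(H has_field_derivative 0) (at u)" if u: "u \<in> generic v" for u
  proof -
    note g = gen[OF u]
    have mv: "- v \<notin> L" "xp (- v) = xp v" "dxp (- v) = - dxp v" using v by (simp_all add: xp_uminus dxp_uminus)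
    have p1: "xp (u + v) = ((dxp v - dxp u) / (xp v - xp u))\<^sup>2 / 4 - b2 / 4 - xp u - xp v"
      by (rule xp_add[OF g(1) v g(5)])
    have p2: "xp (u - v) = ((- dxp v - dxp u) / (xp v - xp u))\<^sup>2 / 4 - b2 / 4 - xp u - xp v"
      using xp_add(1)[OF g(1) mv(1)] g(5) by (simp add: mv)
    have wp: "weierstrass_p L z = xp z + b2 / 12" for z by (simp add: xp_def)
    have z: "(zeta has_field_derivative - (xp z + b2 / 12)) (at z)" if "z \<notin> L" for z
      using zeta_has_field_derivative[OF that] by (simp only: wp)
    have "(H has_field_derivative - (xp (u + v) + b2 / 12) + - (xp (u - v) + b2 / 12) - 2 * - (xp u + b2 / 12)
        - ((6 * (xp u)\<^sup>2 + b2 * xp u + b4) * (xp u - xp v) - dxp u * dxp u) / ((xp u - xp v) * (xp u - xp v))) (at u)"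
      unfolding H_def
    proof (intro DERIV_diff DERIV_add DERIV_cmult)
      show "((\<lambda>u. zeta (u + v)) has_field_derivative - (xp (u + v) + b2 / 12)) (at u)"
        using z[OF g(2)] by (subst (asm) DERIV_shift)
      show "((\<lambda>u. zeta (u - v)) has_field_derivative - (xp (u - v) + b2 / 12)) (at u)"
        using z[OF g(3)] DERIV_shift[of zeta _ u "- v"] by simp
      show "(zeta has_field_derivative - (xp u + b2 / 12)) (at u)" by (rule z[OF g(1)])
      show "((\<lambda>u. dxp u / (xp u - xp v)) has_field_derivative
          ((6 * (xp u)\<^sup>2 + b2 * xp u + b4) * (xp u - xp v) - dxp u * dxp u) / ((xp u - xp v) * (xp u - xp v))) (at u)"
        using DERIV_divide[OF dxp_has_field_derivative[OF g(1) g(4)]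
            DERIV_diff[OF xp_has_field_derivative[OF g(1)] DERIV_const[of "xp v"]] g(6)] by simp
    qed
    moreover have "- (xp (u + v) + b2 / 12) + - (xp (u - v) + b2 / 12) - 2 * - (xp u + b2 / 12)
        - ((6 * (xp u)\<^sup>2 + b2 * xp u + b4) * (xp u - xp v) - dxp u * dxp u) / ((xp u - xp v) * (xp u - xp v)) =
        - (xp (u + v) + xp (u - v) - 2 * xp u
        + ((6 * (xp u)\<^sup>2 + b2 * xp u + b4) * (xp u - xp v) - dxp u * dxp u) / ((xp u - xp v) * (xp u - xp v)))"
      by simp
    moreover have "xp (u + v) + xp (u - v) - 2 * xp u
        + ((6 * (xp u)\<^sup>2 + b2 * xp u + b4) * (xp u - xp v) - dxp u * dxp u) / ((xp u - xp v) * (xp u - xp v)) = 0"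
      unfolding p1 p2 by (rule addition_identity[OF g(5) curve_eq[OF g(1)] curve_eq[OF v]])
    ultimately show ?thesis by simp
  qed
  have "H constant_on generic v"
    by (rule has_field_derivative_0_imp_constant_on[OF dH generic_connected generic_open])
  then obtain c where c: "\<And>u. u \<in> generic v \<Longrightarrow> H u = c" by (auto simp: constant_on_def)
  have zeta_uminus: "zeta (- z) = - zeta z" for z
    by (simp add: zeta_def deriv_sigma_uminus sigma_uminus)
  have "H (- u) = - H u"
  proof -
    have "zeta (- u + v) = - zeta (u - v)" "zeta (- u - v) = - zeta (u + v)"
      using zeta_uminus[of "u - v"] zeta_uminus[of "u + v"] by simp_all
    thus ?thesis using gen[OF u] by (simp add: H_def zeta_uminus xp_uminus dxp_uminus)
  qed
  moreover have "- u \<in> generic v"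
    using u uminus_in_L_iff[of "u + v"] uminus_in_L_iff[of "u - v"] uminus_in_L_iff[of "2 * u"]
    by (auto simp: generic_def)
  ultimately have "c = - c" using c u by metis
  hence "c = 0" by simp
  with c have H0: "H w = 0" if "w \<in> generic v" for w using that by simp
  define h where "h = (\<lambda>u. weierstrass_sigma L (u + v) * weierstrass_sigma L (u - v) / ((weierstrass_sigma L u)\<^sup>2 * (xp u - xp v)))"
  have "(h has_field_derivative 0) (at u)" if u: "u \<in> generic v" for u
  proof -
    note g = gen[OF u]
    let ?s = "weierstrass_sigma L"
    have nz: "?s u \<noteq> 0" "?s (u + v) \<noteq> 0" "?s (u - v) \<noteq> 0" using g by (simp_all add: sigma_eq_0_iff)
    have s: "(?s has_field_derivative ?s z * zeta z) (at z)" if "?s z \<noteq> 0" for z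
      using sigma_has_field_derivative[of z] that by (simp add: zeta_def)
    have s1: "((\<lambda>u. ?s (u + v)) has_field_derivative ?s (u + v) * zeta (u + v)) (at u)"
      using s[OF nz(2)] by (subst (asm) DERIV_shift)
    have s2: "((\<lambda>u. ?s (u - v)) has_field_derivative ?s (u - v) * zeta (u - v)) (at u)"
      using s[OF nz(3)] DERIV_shift[of ?s _ u "- v"] by simp
    have s3: "((\<lambda>u. (?s u)\<^sup>2 * (xp u - xp v)) has_field_derivative
        (?s u)\<^sup>2 * (xp u - xp v) * (2 * zeta u + dxp u / (xp u - xp v))) (at u)"
      using s[OF nz(1)] xp_has_field_derivative[OF g(1)] g(6)
      by (auto intro!: derivative_eq_intros simp: power2_eq_square distrib_left mult_ac)
    have *: "(a * za * b + b * zb * a) = a * b * (za + zb)" for a b za zb :: complex by (simp add: algebra_simps)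
    have **: "(N * zn * M - N * (M * zm)) / (M * M) = N / M * (zn - zm)" if "M \<noteq> 0" for N M zn zm :: complex
      using that by (simp add: field_simps)
    have M: "(?s u)\<^sup>2 * (xp u - xp v) \<noteq> 0" using nz g by simp
    have "(h has_field_derivative ?s (u + v) * ?s (u - v) / ((?s u)\<^sup>2 * (xp u - xp v)) *
        ((zeta (u + v) + zeta (u - v)) - (2 * zeta u + dxp u / (xp u - xp v)))) (at u)"
      unfolding h_def by (rule DERIV_cong[OF DERIV_divide[OF DERIV_mult[OF s1 s2] s3 M]]) (simp only: * **[OF M])
    moreover have "(zeta (u + v) + zeta (u - v)) - (2 * zeta u + dxp u / (xp u - xp v)) = 0"
      using H0[OF u] by (simp only: H_def diff_diff_eq)
    ultimately show ?thesis by simp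
  qed
  hence "h constant_on generic v"
    by (rule has_field_derivative_0_imp_constant_on[OF _ generic_connected generic_open])
  then obtain K where K: "\<And>u. u \<in> generic v \<Longrightarrow> h u = K" by (auto simp: constant_on_def)
  let ?s = "weierstrass_sigma L"
  have hK: "?s (u + v) * ?s (u - v) = K * ((?s u)\<^sup>2 * (xp u - xp v))" if "u \<in> generic v" for u
    using K[OF that] gen[OF that] by (simp add: h_def sigma_eq_0_iff field_simps)
  \<comment> \<open>At 0 the double pole of \<open>xp\<close> meets the double zero of the squared
    sigma. Written through derivatives of sigma, the product is visibly continuous there, with value
    1.\<close>
  define f where "f = (\<lambda>u. (deriv ?s u)\<^sup>2 - deriv (deriv ?s) u * ?s u - (?s u)\<^sup>2 * weierstrass_p L v)"
  have fu: "(?s u)\<^sup>2 * (xp u - xp v) = f u" if "u \<in> generic v" for u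
    using gen[OF that] by (simp add: f_def xp_def weierstrass_p_eq[OF gen(1)[OF that]] sigma_eq_0_iff field_simps power2_eq_square)
  have ev: "\<forall>\<^sub>F w in at 0. ?s (w + v) * ?s (w - v) = K * f w"
    by (rule eventually_mono[OF eventually_generic[of v 0]]) (simp add: hK fu)
  have sc: "(?s \<longlongrightarrow> ?s z) (at z)" "(deriv ?s \<longlongrightarrow> deriv ?s z) (at z)" "(deriv (deriv ?s) \<longlongrightarrow> deriv (deriv ?s) z) (at z)" for z
    using continuous_sigma[of z] by (simp_all add: isCont_def)
  have "(f \<longlongrightarrow> (deriv ?s 0)\<^sup>2 - deriv (deriv ?s) 0 * ?s 0 - (?s 0)\<^sup>2 * weierstrass_p L v) (at 0)"
    unfolding f_def by (intro tendsto_intros sc)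
  hence "(f \<longlongrightarrow> 1) (at 0)" using sigma_eq_0_iff[of 0] zero_in_L by (simp add: deriv_sigma_0)
  hence "((\<lambda>w. K * f w) \<longlongrightarrow> K * 1) (at 0)" by (intro tendsto_intros)
  moreover have "((\<lambda>w. ?s (w + v) * ?s (w - v)) \<longlongrightarrow> ?s (0 + v) * ?s (0 - v)) (at 0)"
    by (intro tendsto_intros isCont_tendsto_compose[OF continuous_sigma(1)])
  hence "((\<lambda>w. K * f w) \<longlongrightarrow> ?s (0 + v) * ?s (0 - v)) (at 0)"
    by (rule Lim_transform_eventually) (rule ev)
  ultimately have "K * 1 = ?s (0 + v) * ?s (0 - v)" by (intro tendsto_unique) auto
  hence "K = - (?s v)\<^sup>2" by (simp add: sigma_uminus power2_eq_square)
  with hK[OF u] show ?thesis by (simp add: mult_ac)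
qed

text \<open>Continuity in \<open>u\<close> extends the generic case to all \<open>u\<close> off the
  lattice.\<close>

theorem sigma_add:
  assumes u: "u \<notin> L" and v: "v \<notin> L"
  shows "weierstrass_sigma L (u + v) * weierstrass_sigma L (u - v) =
    - (weierstrass_sigma L u)\<^sup>2 * (weierstrass_sigma L v)\<^sup>2 * (xp u - xp v)"
proof -
  let ?s = "weierstrass_sigma L"
  have x: "(xp \<longlongrightarrow> xp u) (at u)"
    using DERIV_isCont[OF xp_has_field_derivative[OF u]] by (simp add: isCont_def)
  have s: "(?s \<longlongrightarrow> ?s u) (at u)" using continuous_sigma(1)[of u] by (simp add: isCont_def)
  have "((\<lambda>w. ?s (w + v) * ?s (w - v)) \<longlongrightarrow> ?s (u + v) * ?s (u - v)) (at u)"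
    by (intro tendsto_intros isCont_tendsto_compose[OF continuous_sigma(1)])
  moreover have "\<forall>\<^sub>F w in at u. ?s (w + v) * ?s (w - v) = - (?s w)\<^sup>2 * (?s v)\<^sup>2 * (xp w - xp v)"
    using eventually_generic[of v u] by eventually_elim (rule sigma_add_generic[OF v])
  ultimately have "((\<lambda>w. - (?s w)\<^sup>2 * (?s v)\<^sup>2 * (xp w - xp v)) \<longlongrightarrow> ?s (u + v) * ?s (u - v)) (at u)"
    by (rule Lim_transform_eventually)
  moreover have "((\<lambda>w. - (?s w)\<^sup>2 * (?s v)\<^sup>2 * (xp w - xp v)) \<longlongrightarrow> - (?s u)\<^sup>2 * (?s v)\<^sup>2 * (xp u - xp v)) (at u)"
    by (intro tendsto_intros x s)
  ultimately show ?thesis by (intro tendsto_unique) auto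
qed

text \<open>The addition formula at \<open>w\<close>, \<open>u\<close> is divided by
  \<open>w - u\<close> before \<open>w\<close> tends to \<open>u\<close>; the quotient
  \<open>?s (w - u) / (w - u)\<close> tends to 1 and the difference quotient of \<open>xp\<close> to
  \<open>dxp u\<close>.\<close>

lemma sigma_double:
  assumes u: "u \<notin> L"
  shows "weierstrass_sigma L (2 * u) = - (weierstrass_sigma L u ^ 4 * dxp u)"
proof -
  let ?s = "weierstrass_sigma L"
  have s: "(?s \<longlongrightarrow> ?s u) (at u)" using continuous_sigma(1)[of u] by (simp add: isCont_def)
  have x: "((\<lambda>w. (xp w - xp u) / (w - u)) \<longlongrightarrow> dxp u) (at u)"
    using xp_has_field_derivative[OF u] by (simp add: has_field_derivative_iff)
  have s0: "?s 0 = 0" using zero_in_L sigma_eq_0_iff by blast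
  have "((\<lambda>h. ?s h / h) \<longlongrightarrow> 1) (at 0)"
    using sigma_has_field_derivative[of 0] by (simp add: has_field_derivative_iff deriv_sigma_0 s0)
  moreover have "filterlim (\<lambda>w. w - u) (at 0) (at u)"
    by (subst at_to_0 [of u]) (simp add: filterlim_filtermap filterlim_ident)
  ultimately have q: "((\<lambda>w. ?s (w - u) / (w - u)) \<longlongrightarrow> 1) (at u)" by (rule filterlim_compose)
  have "((\<lambda>w. ?s (w + u) * (?s (w - u) / (w - u))) \<longlongrightarrow> ?s (u + u) * 1) (at u)"
    by (intro tendsto_mult q isCont_tendsto_compose[OF continuous_sigma(1)] tendsto_intros)
  moreover have "\<forall>\<^sub>F w in at u. ?s (w + u) * (?s (w - u) / (w - u)) = - (?s w)\<^sup>2 * (?s u)\<^sup>2 * ((xp w - xp u) / (w - u))"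
    using eventually_generic[of u u]
  proof eventually_elim
    case (elim w)
    from sigma_add_generic[OF u this] show ?case by (simp add: times_divide_eq_right)
  qed
  ultimately have "((\<lambda>w. - (?s w)\<^sup>2 * (?s u)\<^sup>2 * ((xp w - xp u) / (w - u))) \<longlongrightarrow> ?s (u + u) * 1) (at u)"
    by (rule Lim_transform_eventually)
  moreover have "((\<lambda>w. - (?s w)\<^sup>2 * (?s u)\<^sup>2 * ((xp w - xp u) / (w - u))) \<longlongrightarrow> - (?s u)\<^sup>2 * (?s u)\<^sup>2 * dxp u) (at u)"
    by (intro tendsto_intros s x)
  ultimately have "?s (u + u) * 1 = - (?s u)\<^sup>2 * (?s u)\<^sup>2 * dxp u" by (intro tendsto_unique) auto
  hence "?s (2 * u) = - (?s u)\<^sup>2 * (?s u)\<^sup>2 * dxp u" by (simp only: mult_2 mult_1_right)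
  thus ?thesis by (simp add: power2_eq_square power4_eq_xxxx mult.assoc)
qed

text \<open>By the addition formula the sigma factors are common to the three terms, which leaves
  \<open>(A-B)(C-D) - (A-C)(B-D) + (A-D)(B-C) = 0\<close> for the x-coordinates. The translation
  \<open>t\<close> moves all four arguments off the lattice and then tends to 0.\<close>

theorem sigma_three_term:
  fixes a b c d :: complex
  defines "s \<equiv> weierstrass_sigma L"
  shows "s (a + b) * s (a - b) * s (c + d) * s (c - d) - s (a + c) * s (a - c) * s (b + d) * s (b - d)
    + s (a + d) * s (a - d) * s (b + c) * s (b - c) = 0"
proof -
  define T where "T = (\<lambda>t. (s ((t + a) + (t + b)) * s ((t + a) - (t + b))) * (s ((t + c) + (t + d)) * s ((t + c) - (t + d)))
    - (s ((t + a) + (t + c)) * s ((t + a) - (t + c))) * (s ((t + b) + (t + d)) * s ((t + b) - (t + d)))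
    + (s ((t + a) + (t + d)) * s ((t + a) - (t + d))) * (s ((t + b) + (t + c)) * s ((t + b) - (t + c))))"
  have id: "(- sa * sb * (A - B)) * (- sc * sd * (C - D)) - (- sa * sc * (A - C)) * (- sb * sd * (B - D))
    + (- sa * sd * (A - D)) * (- sb * sc * (B - C)) = 0" for A B C D sa sb sc sd :: complex
    by Groebner_Basis.algebra
  have "T t = 0" if t: "t + a \<notin> L" "t + b \<notin> L" "t + c \<notin> L" "t + d \<notin> L" for t
    unfolding T_def s_def sigma_add[OF t(1) t(2)] sigma_add[OF t(1) t(3)] sigma_add[OF t(1) t(4)]
      sigma_add[OF t(2) t(3)] sigma_add[OF t(2) t(4)] sigma_add[OF t(3) t(4)]
    by (rule id)
  then have "\<forall>\<^sub>F t in at 0. T t = 0"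
  proof -
    assume T0: "\<And>t. t + a \<notin> L \<Longrightarrow> t + b \<notin> L \<Longrightarrow> t + c \<notin> L \<Longrightarrow> t + d \<notin> L \<Longrightarrow> T t = 0"
    have "\<forall>\<^sub>F t in at 0. 1 * t + a \<notin> L \<and> 1 * t + b \<notin> L \<and> 1 * t + c \<notin> L \<and> 1 * t + d \<notin> L"
      by (intro eventually_conj eventually_affine_notin_L) auto
    thus ?thesis by (rule eventually_mono) (simp add: T0)
  qed
  hence "(T \<longlongrightarrow> 0) (at 0)" by (rule tendsto_eventually)
  moreover have "(T \<longlongrightarrow> T 0) (at 0)"
    unfolding T_def s_def by (intro tendsto_intros isCont_tendsto_compose[OF continuous_sigma(1)])
  ultimately have "T 0 = 0" by (intro tendsto_unique) auto
  thus ?thesis by (simp add: T_def mult.assoc)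
qed

end

section \<open>Congruences modulo powers of p\<close>

text \<open>The ideal generated by \<open>p^k\<close> in the ring of p-integral rationals, which is
  the case \<open>k = 0\<close>. Congruence of x and y modulo \<open>p^k\<close> is expressed as
  \<open>x - y \<in> pideal p k\<close>.\<close>

definition pideal :: "nat \<Rightarrow> nat \<Rightarrow> rat set" where
  "pideal p k = {x. \<exists>a b::int. \<not> int p dvd b \<and> x = of_int (int p ^ k * a) / of_int b}"

locale prime_nat =
  fixes p :: nat
  assumes prime: "Factorial_Ring.prime p"
begin

lemma prime_int: "Factorial_Ring.prime (int p)"
  using prime by simp

lemma p_gt_1: "p > 1"
  using prime by (rule prime_gt_1_nat)

lemma pidealI: "\<not> int p dvd b \<Longrightarrow> x = of_int (int p ^ k * a) / of_int b \<Longrightarrow> x \<in> pideal p k"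
  unfolding pideal_def by blast

lemma pidealE:
  assumes "x \<in> pideal p k"
  obtains a b :: int where "\<not> int p dvd b" "b \<noteq> 0" "x = of_int (int p ^ k * a) / of_int b"
proof -
  obtain a b where "\<not> int p dvd b" "x = of_int (int p ^ k * a) / of_int b"
    using assms unfolding pideal_def by blast
  thus ?thesis using that[of b a] by (metis dvd_0_right)
qed

lemma pideal_of_int: "int p ^ k dvd a \<Longrightarrow> of_int a \<in> pideal p k"
  using p_gt_1 by (elim dvdE, intro pidealI[of 1]) auto

lemma pideal_0_of_int [simp]: "of_int a \<in> pideal p 0"
  by (rule pideal_of_int) simp

lemma pideal_0_numerals [simp]: "0 \<in> pideal p k" "1 \<in> pideal p 0" "of_nat n \<in> pideal p 0"
    "numeral w \<in> pideal p 0"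
  using pideal_of_int[of k 0] pideal_0_of_int[of 1] pideal_0_of_int[of "int n"] pideal_0_of_int[of "numeral w"]
  by simp_all

lemma of_int_pideal_iff: "of_int z \<in> pideal p k \<longleftrightarrow> int p ^ k dvd z"
proof
  assume "of_int z \<in> pideal p k"
  then obtain a b where ab: "\<not> int p dvd b" "b \<noteq> 0" "(of_int z :: rat) = of_int (int p ^ k * a) / of_int b"
    by (rule pidealE)
  hence "(of_int (z * b) :: rat) = of_int (int p ^ k * a)" by (simp add: field_simps)
  hence "z * b = int p ^ k * a" by (simp only: of_int_eq_iff)
  hence "int p ^ k dvd z * b" by simp
  moreover have "coprime (int p ^ k) b"
    using ab(1) prime_int by (simp add: prime_imp_coprime)
  ultimately show "int p ^ k dvd z" by (simp add: coprime_dvd_mult_left_iff)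
qed (rule pideal_of_int)

lemma pideal_uminus: "x \<in> pideal p k \<Longrightarrow> - x \<in> pideal p k"
  by (elim pidealE, rule pidealI[where a = "- _"], assumption) auto

lemma pideal_add:
  assumes "x \<in> pideal p k" "y \<in> pideal p k"
  shows "x + y \<in> pideal p k"
proof -
  obtain a b where 1: "\<not> int p dvd b" "b \<noteq> 0" "x = of_int (int p ^ k * a) / of_int b"
    using assms(1) by (rule pidealE)
  obtain c d where 2: "\<not> int p dvd d" "d \<noteq> 0" "y = of_int (int p ^ k * c) / of_int d"
    using assms(2) by (rule pidealE)
  show ?thesis
    by (rule pidealI[of "b * d" _ _ "a * d + c * b"])
      (use 1 2 in \<open>auto simp: prime_dvd_mult_iff[OF prime_int] field_simps\<close>)
qed

lemma pideal_diff: "x \<in> pideal p k \<Longrightarrow> y \<in> pideal p k \<Longrightarrow> x - y \<in> pideal p k"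
  using pideal_add[of x k "- y"] pideal_uminus by simp

lemma pideal_mult:
  assumes "x \<in> pideal p j" "y \<in> pideal p k"
  shows "x * y \<in> pideal p (j + k)"
proof -
  obtain a b where 1: "\<not> int p dvd b" "b \<noteq> 0" "x = of_int (int p ^ j * a) / of_int b"
    using assms(1) by (rule pidealE)
  obtain c d where 2: "\<not> int p dvd d" "d \<noteq> 0" "y = of_int (int p ^ k * c) / of_int d"
    using assms(2) by (rule pidealE)
  show ?thesis
    by (rule pidealI[of "b * d" _ _ "a * c"])
      (use 1 2 in \<open>auto simp: prime_dvd_mult_iff[OF prime_int] power_add\<close>)
qed

lemma pideal_mult_left: "x \<in> pideal p 0 \<Longrightarrow> y \<in> pideal p k \<Longrightarrow> x * y \<in> pideal p k"
  using pideal_mult[of x 0 y k] by simp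

lemma pideal_mult_right: "x \<in> pideal p k \<Longrightarrow> y \<in> pideal p 0 \<Longrightarrow> x * y \<in> pideal p k"
  using pideal_mult[of x k y 0] by simp

lemma pideal_antimono:
  assumes "x \<in> pideal p k" "j \<le> k"
  shows "x \<in> pideal p j"
proof -
  obtain a b where 1: "\<not> int p dvd b" "b \<noteq> 0" "x = of_int (int p ^ k * a) / of_int b"
    using assms(1) by (rule pidealE)
  show ?thesis
    by (rule pidealI[OF 1(1), of _ _ "int p ^ (k - j) * a"])
      (use 1 assms in \<open>simp add: mult.assoc [symmetric] power_add [symmetric]\<close>)
qed

lemma pideal_imp_0: "x \<in> pideal p k \<Longrightarrow> x \<in> pideal p 0"
  by (rule pideal_antimono) auto

lemma pideal_power: "x \<in> pideal p 0 \<Longrightarrow> x ^ n \<in> pideal p 0"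
  by (induction n) (auto intro: pideal_mult_left)

lemma pideal_div_power:
  assumes "x \<in> pideal p (j + k)"
  shows "x / of_nat p ^ j \<in> pideal p k"
proof -
  obtain a b where 1: "\<not> int p dvd b" "b \<noteq> 0" "x = of_int (int p ^ (j + k) * a) / of_int b"
    using assms(1) by (rule pidealE)
  show ?thesis
    by (rule pidealI[OF 1(1), of _ _ a]) (use 1 p_gt_1 in \<open>simp add: power_add\<close>)
qed

lemma power_mult_pideal: "x \<in> pideal p k \<Longrightarrow> of_nat p ^ j * x \<in> pideal p (j + k)"
  using pideal_mult[OF pideal_of_int[of j "int p ^ j"], of x k] by simp

text \<open>Membership in \<open>pideal p 0\<close> without membership in \<open>pideal p 1\<close>
  is the form in which units at p appear from here on.\<close>

lemma pideal_inverse: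
  assumes "x \<in> pideal p 0" "x \<notin> pideal p 1"
  shows "inverse x \<in> pideal p 0"
proof -
  obtain a b where 1: "\<not> int p dvd b" "b \<noteq> 0" "x = of_int (int p ^ 0 * a) / of_int b"
    using assms(1) by (rule pidealE)
  have "\<not> int p dvd a"
  proof
    assume "int p dvd a"
    then obtain c where "a = int p * c" by (rule dvdE)
    hence "x \<in> pideal p 1" using 1 by (intro pidealI[of b _ _ c]) auto
    thus False using assms by simp
  qed
  thus ?thesis by (rule pidealI[of a _ _ b]) (use 1 in simp)
qed

lemma pideal_unit_cancel:
  assumes "u \<in> pideal p 0" "u \<notin> pideal p 1" "u * x \<in> pideal p k"
  shows "x \<in> pideal p k"
proof -
  have "u \<noteq> 0" using assms(2) by auto
  hence "inverse u * (u * x) = x" by simp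
  thus ?thesis using pideal_mult_left[OF pideal_inverse[OF assms(1,2)] assms(3)] by argo
qed

lemma pideal_1_prime:
  assumes "x \<in> pideal p 0" "y \<in> pideal p 0" "x * y \<in> pideal p 1"
  shows "x \<in> pideal p 1 \<or> y \<in> pideal p 1"
  using pideal_unit_cancel[of x y 1] assms by blast

lemma one_notin_pideal: "1 \<notin> pideal p 1"
  using of_int_pideal_iff[of 1 1] p_gt_1 by auto

lemma padic_ord_ge_iff: "padic_ord p x \<ge> ereal (real k) \<longleftrightarrow> x \<in> pideal p k"
proof (cases "x = 0")
  case True
  thus ?thesis by (simp add: padic_ord_def)
next
  case False
  obtain a b where q: "quotient_of x = (a, b)" by force
  have b: "b > 0" and cop: "coprime a b" and x: "x = of_int a / of_int b"
    using quotient_of_denom_pos[OF q] quotient_of_coprime[OF q] quotient_of_div[OF q] by auto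
  have a: "a \<noteq> 0" using False x by auto
  let ?m = "multiplicity (int p)"
  have "padic_ord p x \<ge> ereal (real k) \<longleftrightarrow> k + ?m b \<le> ?m a"
    using False by (simp add: padic_ord_def q) linarith
  also have "\<dots> \<longleftrightarrow> x \<in> pideal p k"
  proof
    assume le: "k + ?m b \<le> ?m a"
    have "\<not> int p dvd b"
    proof
      assume pb: "int p dvd b"
      hence "?m b \<ge> 1" using b prime_int 
        by (intro multiplicity_geI) (auto simp: not_prime_unit)
      hence "?m a \<ge> 1" using le by simp
      hence "int p dvd a" by (metis not_dvd_imp_multiplicity_0 not_one_le_zero)
      hence "is_unit (int p)" using pb cop by (metis coprime_common_divisor)
      thus False using p_gt_1 by simp
    qed
    moreover have "int p ^ k dvd a" using le by (meson le_add1 order_trans multiplicity_dvd')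
    then obtain c where "a = int p ^ k * c" by (rule dvdE)
    ultimately show "x \<in> pideal p k" using x by (intro pidealI[of b _ _ c]) simp_all
  next
    assume "x \<in> pideal p k"
    then obtain c d where cd: "\<not> int p dvd d" "d \<noteq> 0" "x = of_int (int p ^ k * c) / of_int d"
      by (rule pidealE)
    have "(of_int (a * d) :: rat) = of_int (int p ^ k * c * b)"
      using cd x b by (simp add: field_simps)
    hence eq: "a * d = int p ^ k * c * b" by (simp only: of_int_eq_iff)
    have c0: "c \<noteq> 0" using False cd by auto
    have pe: "prime_elem (int p)" using prime_int by simp
    have "?m (a * d) = ?m a" using pe a cd
      by (simp add: prime_elem_multiplicity_mult_distrib not_dvd_imp_multiplicity_0)
    moreover have "?m (int p ^ k * c * b) = k + ?m c + ?m b"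
      using pe c0 b p_gt_1 by (simp add: prime_elem_multiplicity_mult_distrib multiplicity_same_power)
    ultimately show "k + ?m b \<le> ?m a" using eq by simp
  qed
  finally show ?thesis .
qed

lemma padic_ord_nonneg_iff: "padic_ord p x \<ge> 0 \<longleftrightarrow> x \<in> pideal p 0"
  using padic_ord_ge_iff[of 0 x] by (simp add: zero_ereal_def)

text \<open>For p-integral \<open>x\<close> this representative is unique. It turns congruences into
  equalities in a finite set, the form that pigeonhole arguments require.\<close>

definition presidue :: "nat \<Rightarrow> rat \<Rightarrow> int" where
  "presidue k x = (SOME r. r \<in> {0..<int p ^ k} \<and> x - of_int r \<in> pideal p k)"

lemma presidue:
  assumes "x \<in> pideal p 0"
  shows "presidue k x \<in> {0..<int p ^ k}" "x - of_int (presidue k x) \<in> pideal p k"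
proof -
  obtain a b where 1: "\<not> int p dvd b" "b \<noteq> 0" "x = of_int (int p ^ 0 * a) / of_int b"
    using assms(1) by (rule pidealE)
  have "coprime b (int p ^ k)"
    using prime_imp_power_coprime[OF prime_int 1(1)] by (simp add: coprime_commute)
  then obtain c where c: "[b * c = 1] (mod int p ^ k)"
    using cong_solve_coprime_int by blast
  define r where "r = (a * c) mod (int p ^ k)"
  have "[b * r = a * (b * c)] (mod int p ^ k)"
    unfolding r_def cong_def by (simp add: mod_mult_right_eq algebra_simps)
  also have "[a * (b * c) = a * 1] (mod int p ^ k)" using c by (rule cong_scalar_left)
  finally have "int p ^ k dvd a - b * r"
    by (simp add: cong_iff_dvd_diff dvd_diff_commute)
  then obtain d where d: "a - b * r = int p ^ k * d" by (rule dvdE)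
  have "x - of_int r = of_int (a - b * r) / of_int b" using 1 by (simp add: field_simps)
  hence "x - of_int r \<in> pideal p k" using 1 d by (intro pidealI[of b _ _ d]) simp_all
  moreover have "r \<in> {0..<int p ^ k}" using p_gt_1 by (simp add: r_def)
  ultimately have "\<exists>r. r \<in> {0..<int p ^ k} \<and> x - of_int r \<in> pideal p k" by blast
  from someI_ex[OF this] show "presidue k x \<in> {0..<int p ^ k}" "x - of_int (presidue k x) \<in> pideal p k"
    unfolding presidue_def by auto
qed

lemma presidue_eqI:
  assumes "x \<in> pideal p 0" "r \<in> {0..<int p ^ k}" "x - of_int r \<in> pideal p k"
  shows "presidue k x = r"
proof -
  have "of_int (presidue k x - r) \<in> pideal p k"
    using pideal_diff[OF assms(3) presidue(2)[OF assms(1), of k]] by simp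
  hence "int p ^ k dvd presidue k x - r" by (simp only: of_int_pideal_iff)
  hence "[presidue k x = r] (mod int p ^ k)" by (simp add: cong_iff_dvd_diff)
  thus ?thesis using presidue(1)[OF assms(1), of k] assms(2) by (simp add: cong_def)
qed

lemma presidue_eq_iff:
  assumes "x \<in> pideal p 0" "y \<in> pideal p 0"
  shows "presidue k x = presidue k y \<longleftrightarrow> x - y \<in> pideal p k"
proof
  assume "presidue k x = presidue k y"
  thus "x - y \<in> pideal p k"
    using pideal_diff[OF presidue(2)[OF assms(1), of k] presidue(2)[OF assms(2), of k]] by simp
next
  assume "x - y \<in> pideal p k"
  hence "x - of_int (presidue k y) \<in> pideal p k"
    using pideal_add[OF _ presidue(2)[OF assms(2), of k]] by fastforce
  with presidue(1)[OF assms(2), of k] assms(1) show "presidue k x = presidue k y"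
    by (intro presidue_eqI)
qed

text \<open>Consecutive differences suffice for a Cauchy sequence, since sums of elements of an
  ideal stay in it. The limit is assembled from the eventual residues modulo each
  \<open>p^k\<close>.\<close>

lemma limit_exists_in_ZpI:
  assumes int: "\<And>i. b i \<in> pideal p 0"
    and cauchy: "\<And>k. \<exists>i0. \<forall>i\<ge>i0. b (Suc i) - b i \<in> pideal p k"
  shows "limit_exists_in_Zp p b"
proof -
  obtain I where I: "\<And>k i. i \<ge> I k \<Longrightarrow> b (Suc i) - b i \<in> pideal p k"
    using cauchy by metis
  have I': "b i - b (I k) \<in> pideal p k" if "i \<ge> I k" for i k
    using that
  proof (induction rule: dec_induct)
    case (step i)
    show ?case using pideal_add[OF step.IH I[OF step.hyps(1)]] by simp
  qed simp
  define x where "x = (\<lambda>k. presidue k (b (I k)))"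
  have bx: "b i - of_int (x k) \<in> pideal p k" if "i \<ge> I k" for i k
    using pideal_add[OF I'[OF that] presidue(2)[OF int, of "I k" k]] by (simp add: x_def)
  have "x \<in> padic_integers p"
    unfolding padic_integers_def
  proof (intro CollectI allI conjI)
    fix k
    show "x k \<in> {0..<int p ^ k}" unfolding x_def by (rule presidue(1)[OF int])
    define i where "i = max (I k) (I (Suc k))"
    have "b i - of_int (x (Suc k)) \<in> pideal p k"
      by (rule pideal_antimono[OF bx]) (auto simp: i_def)
    from pideal_diff[OF bx[of k i] this] have "of_int (x (Suc k) - x k) \<in> pideal p k"
      by (simp add: i_def)
    hence "int p ^ k dvd x (Suc k) - x k" by (simp only: of_int_pideal_iff)
    hence "[x (Suc k) = x k] (mod int p ^ k)" by (simp add: cong_iff_dvd_diff)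
    thus "x (Suc k) mod int p ^ k = x k" using \<open>x k \<in> {0..<int p ^ k}\<close> by (simp add: cong_def)
  qed
  moreover have "padic_tendsto p b x"
    unfolding padic_tendsto_def padic_ord_ge_iff eventually_sequentially using bx by blast
  ultimately show ?thesis unfolding limit_exists_in_Zp_def by blast
qed

end

section \<open>Periodicity of Somos sequences modulo powers of p\<close>

text \<open>\<open>card S\<close> bounds every pre-period, and \<open>fact (card S)\<close> is a
  multiple of every possible cycle length. Neither depends on \<open>s\<close>, so one period fits
  all sequences in \<open>S\<close>.\<close>

lemma deterministic_eventually_periodic:
  fixes f :: "nat \<Rightarrow> 's"
  assumes fin: "finite S" and S: "\<And>j. s j \<in> S"
    and det: "\<And>i j. s i = s j \<Longrightarrow> s (Suc i) = s (Suc j)"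
    and j: "j \<ge> card S"
  shows "s (j + fact (card S)) = s j"
proof -
  have "card (s ` {0..card S}) \<le> card S" by (rule card_mono) (use fin S in auto)
  hence "\<not> inj_on s {0..card S}" using card_image[of s "{0..card S}"] by auto
  then obtain a b where "a \<le> card S" "b \<le> card S" "a \<noteq> b" "s a = s b"
    unfolding inj_on_def by auto
  then obtain a b where ab: "a < b" "b \<le> card S" "s a = s b"
    by (metis linorder_neqE_nat)
  define d where "d = b - a"
  have d: "d > 0" "d \<le> card S" using ab by (auto simp: d_def)
  have shift: "s (a + n) = s (b + n)" for n
    by (induction n) (use ab det[of "a + _" "b + _"] in simp_all)
  have per: "s (n + d) = s n" if "n \<ge> a" for n
  proof -
    have "b + (n - a) = n + d" "a + (n - a) = n" using that ab by (auto simp: d_def)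
    thus ?thesis using shift[of "n - a"] by simp
  qed
  have "s (n + k * d) = s n" if "n \<ge> a" for n k
  proof (induction k)
    case (Suc k)
    have "s (n + k * d + d) = s (n + k * d)" by (rule per) (use that in simp)
    with Suc show ?case by (simp add: algebra_simps)
  qed simp
  moreover have "d dvd fact (card S)" using d by (intro dvd_fact) auto
  then obtain k where "fact (card S) = k * d" by (metis dvdE mult.commute)
  ultimately show ?thesis using j ab by auto
qed

text \<open>A member of the family is encoded by its first \<open>m\<close> values. The shift by
  \<open>T\<close> acts on these finitely many codes, so all members share one period and one
  threshold.\<close>

lemma shift_family_eventually_periodic:
  fixes \<D> :: "(nat \<Rightarrow> int) set"
  assumes T: "T \<ge> 1" and q: "\<And>D n. D \<in> \<D> \<Longrightarrow> D n \<in> {0..<q}"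
    and shift: "\<And>D. D \<in> \<D> \<Longrightarrow> (\<lambda>n. D (n + T)) \<in> \<D>"
    and det: "\<And>D D'. D \<in> \<D> \<Longrightarrow> D' \<in> \<D> \<Longrightarrow> (\<And>i. i < m \<Longrightarrow> D i = D' i) \<Longrightarrow> D = D'"
  obtains M n0 where "M \<ge> 1" "T dvd M" "\<And>D n. D \<in> \<D> \<Longrightarrow> n \<ge> n0 \<Longrightarrow> D (n + M) = D n"
proof -
  define S where "S = {xs :: int list. set xs \<subseteq> {0..<q} \<and> length xs = m}"
  have fin: "finite S" unfolding S_def by (rule finite_lists_length_eq) simp
  define M where "M = T * fact (card S)"
  have "D (n + M) = D n" if D: "D \<in> \<D>" and n: "n \<ge> T * card S" for D n
  proof -
    define sh where "sh = (\<lambda>j n. D (n + j * T))"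
    have sh: "sh j \<in> \<D>" for j
    proof (induction j)
      case (Suc j)
      from shift[OF this] show ?case by (simp add: sh_def add_ac)
    qed (simp add: sh_def D)
    define s where "s = (\<lambda>j. map (sh j) [0..<m])"
    have s_eq: "sh i = sh j" if "s i = s j" for i j
      by (rule det[OF sh sh]) (use that in \<open>simp add: s_def\<close>)
    have "s (card S + fact (card S)) = s (card S)"
    proof (rule deterministic_eventually_periodic[OF fin])
      show "s j \<in> S" for j using q[OF sh] by (auto simp: S_def s_def)
      show "s (Suc i) = s (Suc j)" if "s i = s j" for i j
      proof -
        have "sh (Suc k) = (\<lambda>n. sh k (n + T))" for k by (simp add: sh_def add_ac)
        with s_eq[OF that] have "sh (Suc i) = sh (Suc j)" by simp
        thus ?thesis by (simp add: s_def)
      qed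
    qed simp
    from s_eq[OF this] have "sh (card S + fact (card S)) (n - T * card S) = sh (card S) (n - T * card S)"
      by simp
    thus ?thesis using n by (simp add: sh_def M_def algebra_simps)
  qed
  moreover have "M \<ge> 1" using T by (simp add: M_def Suc_le_eq)
  ultimately show ?thesis using that[of M "T * card S"] by (simp add: M_def)
qed

section \<open>Pairs of recurrences, their linearization, and periods modulo powers of p\<close>

context prime_nat
begin

lemma pideal_diff_trans: "x - y \<in> pideal p k \<Longrightarrow> y - z \<in> pideal p k \<Longrightarrow> x - z \<in> pideal p k"
  using pideal_add[of "x - y" k "y - z"] by simp

lemma pideal_iterate:
  fixes U :: "nat \<Rightarrow> rat"
  assumes step: "\<And>n. n \<ge> n0 \<Longrightarrow> U (n + t) - U n \<in> pideal p k" and n: "n \<ge> n0"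
  shows "U (n + m * t) - U n \<in> pideal p k"
proof (induction m)
  case (Suc m)
  have "U (n + m * t + t) - U (n + m * t) \<in> pideal p k" by (rule step) (use n in simp)
  from pideal_diff_trans[OF this Suc] show ?case by (simp add: algebra_simps)
qed simp

lemma pideal_diff_commute: "x - y \<in> pideal p k \<longleftrightarrow> y - x \<in> pideal p k"
  using pideal_uminus[of "x - y" k] pideal_uminus[of "y - x" k] by auto

lemma pideal_mult_diff:
  assumes "x - x' \<in> pideal p k" "y - y' \<in> pideal p k" "x \<in> pideal p 0" "y' \<in> pideal p 0"
  shows "x * y - x' * y' \<in> pideal p k"
proof -
  have "x * y - x' * y' = x * (y - y') + (x - x') * y'" by (simp add: algebra_simps)
  thus ?thesis
    using pideal_add[OF pideal_mult_left[OF assms(3,2)] pideal_mult_right[OF assms(1,4)]] by (simp only:)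
qed

text \<open>
  Division by \<open>W n\<close> is possible in one of the two relations as soon as \<open>W n\<close> and \<open>W (n + 1)\<close> are
  not both divisible by \<open>p\<close>.
\<close>

definition somos_pair :: "rat \<Rightarrow> rat \<Rightarrow> rat \<Rightarrow> rat \<Rightarrow> (nat \<Rightarrow> rat) \<Rightarrow> bool" where
  "somos_pair a b c d W \<longleftrightarrow>
     (\<forall>n. W n \<in> pideal p 0 \<and> (W n \<notin> pideal p 1 \<or> W (n + 1) \<notin> pideal p 1) \<and>
       W (n + 4) * W n = a * W (n + 3) * W (n + 1) + b * (W (n + 2))\<^sup>2 \<and>
       W (n + 5) * W n = c * W (n + 4) * W (n + 1) + d * W (n + 3) * W (n + 2))"

lemma somos_pair_integral: "somos_pair a b c d W \<Longrightarrow> W i \<in> pideal p 0"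
  unfolding somos_pair_def by blast

lemma somos_pair_shift: "somos_pair a b c d W \<Longrightarrow> somos_pair a b c d (\<lambda>n. W (n + i))"
  unfolding somos_pair_def
proof (intro allI)
  fix n
  assume *: "\<forall>n. W n \<in> pideal p 0 \<and> (W n \<notin> pideal p 1 \<or> W (n + 1) \<notin> pideal p 1) \<and>
       W (n + 4) * W n = a * W (n + 3) * W (n + 1) + b * (W (n + 2))\<^sup>2 \<and>
       W (n + 5) * W n = c * W (n + 4) * W (n + 1) + d * W (n + 3) * W (n + 2)"
  have "n + j + i = n + i + j" for j by simp
  with spec[OF *, of "n + i"] show "W (n + i) \<in> pideal p 0 \<and> (W (n + i) \<notin> pideal p 1 \<or> W (n + 1 + i) \<notin> pideal p 1) \<and>
       W (n + 4 + i) * W (n + i) = a * W (n + 3 + i) * W (n + 1 + i) + b * (W (n + 2 + i))\<^sup>2 \<and>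
       W (n + 5 + i) * W (n + i) = c * W (n + 4 + i) * W (n + 1 + i) + d * W (n + 3 + i) * W (n + 2 + i)"
    by metis
qed


text \<open>The part of first order in \<open>D\<close> of the two relations for
  \<open>W n + P * D n\<close>, taken modulo p.\<close>

definition lin_somos_pair :: "rat \<Rightarrow> rat \<Rightarrow> rat \<Rightarrow> rat \<Rightarrow> (nat \<Rightarrow> rat) \<Rightarrow> (nat \<Rightarrow> rat) \<Rightarrow> bool" where
  "lin_somos_pair a b c d W D \<longleftrightarrow>
     (\<forall>n. D n \<in> pideal p 0 \<and>
       D (n + 4) * W n + W (n + 4) * D n -
         (a * (D (n + 3) * W (n + 1) + W (n + 3) * D (n + 1)) + b * (2 * W (n + 2) * D (n + 2))) \<in> pideal p 1 \<and>
       D (n + 5) * W n + W (n + 5) * D n -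
         (c * (D (n + 4) * W (n + 1) + W (n + 4) * D (n + 1)) +
          d * (D (n + 3) * W (n + 2) + W (n + 3) * D (n + 2))) \<in> pideal p 1)"

context
  fixes a b c d :: rat
  assumes abcd: "a \<in> pideal p 0" "b \<in> pideal p 0" "c \<in> pideal p 0" "d \<in> pideal p 0"
begin

lemma lin_somos_pair_integral: "lin_somos_pair a b c d W D \<Longrightarrow> D i \<in> pideal p 0"
  unfolding lin_somos_pair_def by blast

lemma lin_somos_pair_shift:
  assumes "lin_somos_pair a b c d W D"
  shows "lin_somos_pair a b c d (\<lambda>n. W (n + i)) (\<lambda>n. D (n + i))"
proof -
  have e: "n + j + i = n + i + j" for n j by simp
  show ?thesis unfolding lin_somos_pair_def e
    using assms[unfolded lin_somos_pair_def] by blast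
qed

text \<open>The linearized relations see \<open>W\<close> only modulo p. Hence they are the same at
  every precision, and their solutions may be shifted by a period of \<open>W\<close> modulo
  p.\<close>

lemma lin_somos_pair_cong:
  assumes D: "lin_somos_pair a b c d W D" and close: "\<And>n. V n - W n \<in> pideal p 1"
  shows "lin_somos_pair a b c d V D"
  unfolding lin_somos_pair_def
proof (intro allI conjI)
  fix n
  note Dn = D[unfolded lin_somos_pair_def, rule_format, of n]
  have J: "D i \<in> pideal p 0" for i by (rule lin_somos_pair_integral[OF D])
  have m1: "D j * V i - D j * W i \<in> pideal p 1" for i j
    using close[of i] J[of j] by (simp only: right_diff_distrib [symmetric] pideal_mult_left)
  have m2: "V i * D j - W i * D j \<in> pideal p 1" for i j
    using close[of i] J[of j] by (simp only: left_diff_distrib [symmetric] pideal_mult_right)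
  have m3: "2 * V i * D j - 2 * W i * D j \<in> pideal p 1" for i j
    using pideal_mult_left[OF _ m2, of 2 i j] by (simp add: algebra_simps)
  have sum: "(x + y) - (x' + y') \<in> pideal p 1" if "x - x' \<in> pideal p 1" "y - y' \<in> pideal p 1" for x y x' y'
    using pideal_add[OF that] by (simp add: algebra_simps)
  have dif: "(x - y) - (x' - y') \<in> pideal p 1" if "x - x' \<in> pideal p 1" "y - y' \<in> pideal p 1" for x y x' y'
    using pideal_diff[OF that] by (simp add: algebra_simps)
  have mul: "k * x - k * y \<in> pideal p 1" if "x - y \<in> pideal p 1" "k \<in> pideal p 0" for x y k
    using pideal_mult_left[OF that(2,1)] by (simp add: algebra_simps)
  have fin: "x \<in> pideal p 1" if "x - y \<in> pideal p 1" "y \<in> pideal p 1" for x y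
    using pideal_add[OF that] by simp
  show "D n \<in> pideal p 0" by (rule J)
  show "D (n + 4) * V n + V (n + 4) * D n -
     (a * (D (n + 3) * V (n + 1) + V (n + 3) * D (n + 1)) + b * (2 * V (n + 2) * D (n + 2))) \<in> pideal p 1"
    by (rule fin[OF _ conjunct1[OF conjunct2[OF Dn]]]) (intro sum dif mul m1 m2 m3 abcd)
  show "D (n + 5) * V n + V (n + 5) * D n -
     (c * (D (n + 4) * V (n + 1) + V (n + 4) * D (n + 1)) +
      d * (D (n + 3) * V (n + 2) + V (n + 3) * D (n + 2))) \<in> pideal p 1"
    by (rule fin[OF _ conjunct2[OF conjunct2[OF Dn]]]) (intro sum dif mul m1 m2 m3 abcd)
qed

text \<open>If \<open>W m\<close> is a unit, the long relation at \<open>m\<close> gives the term at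
  \<open>m + 5\<close>; otherwise \<open>W (m + 1)\<close> is a unit, and the short relation at
  \<open>m + 1\<close> gives that same term.\<close>

lemma somos_pair_determined:
  assumes W: "somos_pair a b c d W" and V: "somos_pair a b c d V"
    and init: "\<And>i. i < 5 \<Longrightarrow> W i - V i \<in> pideal p 1"
  shows "W n - V n \<in> pideal p 1"
proof (induction n rule: less_induct)
  case (less n)
  show ?case
  proof (cases "n < 5")
    case True thus ?thesis by (rule init)
  next
    case False
    then obtain m where n: "n = m + 5" by (metis add.commute le_Suc_ex not_less)
    note Wm = W[unfolded somos_pair_def, rule_format]
    note Vm = V[unfolded somos_pair_def, rule_format]
    have I: "W i \<in> pideal p 0" "V i \<in> pideal p 0" for i using Wm Vm by auto
    have IH: "W (m + i) - V (m + i) \<in> pideal p 1" if "i < 5" for i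
      using less.IH[of "m + i"] that n by simp
    note IH' = IH[of 0] IH[of 1] IH[of 2] IH[of 3] IH[of 4]
    show ?thesis
    proof (cases "W m \<in> pideal p 1")
      case False
      have "c * (W (m + 4) * W (m + 1)) - c * (V (m + 4) * V (m + 1)) \<in> pideal p 1"
        "d * (W (m + 3) * W (m + 2)) - d * (V (m + 3) * V (m + 2)) \<in> pideal p 1"
        using IH' by (auto intro!: pideal_mult_diff I abcd pideal_mult_left[of _ _ 0])
      from pideal_add[OF this] have "W (m + 5) * W m - V (m + 5) * V m \<in> pideal p 1"
        using Wm[of m] Vm[of m] by (simp add: algebra_simps)
      moreover have "V (m + 5) * (W m - V m) \<in> pideal p 1"
        using IH'(1) by (intro pideal_mult_left I) simp
      ultimately have "(W (m + 5) * W m - V (m + 5) * V m) - V (m + 5) * (W m - V m) \<in> pideal p 1"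
        by (rule pideal_diff)
      hence "W m * (W (m + 5) - V (m + 5)) \<in> pideal p 1" by (simp add: algebra_simps)
      thus ?thesis unfolding n by (rule pideal_unit_cancel[OF I(1) False])
    next
      case True
      hence u: "W (m + 1) \<notin> pideal p 1" using Wm[of m] by auto
      have e: "m + 1 + 4 = m + 5" "m + 1 + 3 = m + 4" "m + 1 + 1 = m + 2" "m + 1 + 2 = m + 3" by simp_all
      have "a * (W (m + 4) * W (m + 2)) - a * (V (m + 4) * V (m + 2)) \<in> pideal p 1"
        "b * (W (m + 3) * W (m + 3)) - b * (V (m + 3) * V (m + 3)) \<in> pideal p 1"
        using IH' by (auto intro!: pideal_mult_diff I abcd pideal_mult_left[of _ _ 0])
      from pideal_add[OF this] have "W (m + 5) * W (m + 1) - V (m + 5) * V (m + 1) \<in> pideal p 1"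
        using Wm[of "m + 1"] Vm[of "m + 1"] unfolding e by (simp add: algebra_simps power2_eq_square)
      moreover have "V (m + 5) * (W (m + 1) - V (m + 1)) \<in> pideal p 1"
        using IH'(2) by (intro pideal_mult_left I) simp
      ultimately have "(W (m + 5) * W (m + 1) - V (m + 5) * V (m + 1)) - V (m + 5) * (W (m + 1) - V (m + 1)) \<in> pideal p 1"
        by (rule pideal_diff)
      hence "W (m + 1) * (W (m + 5) - V (m + 5)) \<in> pideal p 1" by (simp add: algebra_simps)
      thus ?thesis unfolding n by (rule pideal_unit_cancel[OF I(1) u])
    qed
  qed
qed

lemma lin_somos_pair_diff:
  assumes W: "somos_pair a b c d W" and D: "lin_somos_pair a b c d W D" and E: "lin_somos_pair a b c d W E"
  shows "lin_somos_pair a b c d W (\<lambda>n. D n - E n)"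
  unfolding lin_somos_pair_def
proof (intro allI conjI)
  note Dn = D[unfolded lin_somos_pair_def, rule_format]
  note En = E[unfolded lin_somos_pair_def, rule_format]
  fix n
  show "D n - E n \<in> pideal p 0" using Dn En by (auto intro: pideal_diff)
  have "(x - y \<in> pideal p 1)" if "x = e - e'" "y = f - f'" "e - f \<in> pideal p 1" "e' - f' \<in> pideal p 1" for x y e e' f f'
  proof -
    have "x - y = (e - f) - (e' - f')" unfolding that(1,2) by simp
    thus ?thesis using pideal_diff[OF that(3,4)] by (simp only:)
  qed
  note c = this
  show "(D (n + 4) - E (n + 4)) * W n + W (n + 4) * (D n - E n) -
         (a * ((D (n + 3) - E (n + 3)) * W (n + 1) + W (n + 3) * (D (n + 1) - E (n + 1))) +
          b * (2 * W (n + 2) * (D (n + 2) - E (n + 2)))) \<in> pideal p 1"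
    by (rule c[OF _ _ conjunct1[OF conjunct2[OF Dn[of n]]] conjunct1[OF conjunct2[OF En[of n]]]])
       (simp_all add: algebra_simps)
  show "(D (n + 5) - E (n + 5)) * W n + W (n + 5) * (D n - E n) -
         (c * ((D (n + 4) - E (n + 4)) * W (n + 1) + W (n + 4) * (D (n + 1) - E (n + 1))) +
          d * ((D (n + 3) - E (n + 3)) * W (n + 2) + W (n + 3) * (D (n + 2) - E (n + 2)))) \<in> pideal p 1"
    by (rule c[OF _ _ conjunct2[OF conjunct2[OF Dn[of n]]] conjunct2[OF conjunct2[OF En[of n]]]])
       (simp_all add: algebra_simps)
qed

text \<open>The coefficient of \<open>D (m + 5)\<close> is \<open>W m\<close> in the long relation
  at \<open>m\<close> and \<open>W (m + 1)\<close> in the short one at \<open>m + 1\<close>, so the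
  same alternative applies. Applied to differences, this shows that five values determine a solution
  modulo p.\<close>

lemma lin_somos_pair_zero:
  assumes W: "somos_pair a b c d W" and D: "lin_somos_pair a b c d W D"
    and init: "\<And>i. i < 5 \<Longrightarrow> D i \<in> pideal p 1"
  shows "D n \<in> pideal p 1"
proof (induction n rule: less_induct)
  case (less n)
  show ?case
  proof (cases "n < 5")
    case True thus ?thesis by (rule init)
  next
    case False
    then obtain m where n: "n = m + 5" by (metis add.commute le_Suc_ex not_less)
    note Wm = W[unfolded somos_pair_def, rule_format]
    note Dm = D[unfolded lin_somos_pair_def, rule_format]
    have I: "W i \<in> pideal p 0" for i using Wm by auto
    have IH: "D (m + i) \<in> pideal p 1" if "i < 5" for i
      using less.IH[of "m + i"] that n by simp
    have m1: "D (m + i) * W j \<in> pideal p 1" and m2: "W j * D (m + i) \<in> pideal p 1"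
      and m3: "2 * W j * D (m + i) \<in> pideal p 1" if "i < 5" for i j
    proof -
      note Dm = IH[OF that]
      show "D (m + i) * W j \<in> pideal p 1" by (rule pideal_mult_right[OF Dm I])
      show m2: "W j * D (m + i) \<in> pideal p 1" by (rule pideal_mult_left[OF I Dm])
      show "2 * W j * D (m + i) \<in> pideal p 1"
        using pideal_mult_left[OF _ m2, of 2] by (simp add: mult.assoc)
    qed
    have m0: "W j * D m \<in> pideal p 1" for j using m2[of 0 j] by simp
    show ?thesis
    proof (cases "W m \<in> pideal p 1")
      case False
      have "D (m + 5) * W m + W (m + 5) * D m - (c * (D (m + 4) * W (m + 1) + W (m + 4) * D (m + 1)) +
          d * (D (m + 3) * W (m + 2) + W (m + 3) * D (m + 2))) \<in> pideal p 1"
        using Dm by blast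
      moreover have "c * (D (m + 4) * W (m + 1) + W (m + 4) * D (m + 1)) +
          d * (D (m + 3) * W (m + 2) + W (m + 3) * D (m + 2)) - W (m + 5) * D m \<in> pideal p 1"
        by (intro pideal_diff pideal_add pideal_mult_left[OF abcd(3)] pideal_mult_left[OF abcd(4)] m0 m1 m2) simp_all
      ultimately have "D (m + 5) * W m \<in> pideal p 1" by (auto dest: pideal_add)
      thus ?thesis unfolding n using pideal_unit_cancel[OF I False, of "D (m + 5)" 1] by (simp add: mult.commute)
    next
      case True
      hence u: "W (m + 1) \<notin> pideal p 1" using Wm[of m] by auto
      have e: "m + 1 + 4 = m + 5" "m + 1 + 3 = m + 4" "m + 1 + 1 = m + 2" "m + 1 + 2 = m + 3" by simp_all
      have "D (m + 5) * W (m + 1) + W (m + 5) * D (m + 1) - (a * (D (m + 4) * W (m + 2) + W (m + 4) * D (m + 2)) +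
          b * (2 * W (m + 3) * D (m + 3))) \<in> pideal p 1"
        using Dm[of "m + 1", unfolded e] by blast
      moreover have "a * (D (m + 4) * W (m + 2) + W (m + 4) * D (m + 2)) +
          b * (2 * W (m + 3) * D (m + 3)) - W (m + 5) * D (m + 1) \<in> pideal p 1"
        by (intro pideal_diff pideal_add pideal_mult_left[OF abcd(1)] pideal_mult_left[OF abcd(2)] m1 m2 m3) simp_all
      ultimately have "D (m + 5) * W (m + 1) \<in> pideal p 1" by (auto dest: pideal_add)
      thus ?thesis unfolding n using pideal_unit_cancel[OF I u, of "D (m + 5)" 1] by (simp add: mult.commute)
    qed
  qed
qed

lemma somos_pair_periodic_mod_p:
  assumes W: "somos_pair a b c d W"
  obtains T n0 where "T \<ge> 1" "\<And>n. n \<ge> n0 \<Longrightarrow> W (n + T) - W n \<in> pideal p 1"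
proof -
  have I: "W i \<in> pideal p 0" for i using W by (rule somos_pair_integral)
  \<comment> \<open>All shifts of the one sequence are taken together, so that the family is closed
    under the shift by 1.\<close>
  define \<D> where "\<D> = {\<lambda>n. presidue 1 (W (n + i)) | i. True}"
  have "\<exists>M n0. M \<ge> 1 \<and> (\<forall>D\<in>\<D>. \<forall>n\<ge>n0. D (n + M) = D n)"
  proof (rule shift_family_eventually_periodic[of 1 \<D> "int p" 5])
    show "D n \<in> {0..<int p}" if "D \<in> \<D>" for D n
      using that presidue(1)[OF I, of 1] by (auto simp: \<D>_def)
    show "(\<lambda>n. D (n + 1)) \<in> \<D>" if D: "D \<in> \<D>" for D
    proof -
      obtain i where "D = (\<lambda>n. presidue 1 (W (n + i)))" using D by (auto simp: \<D>_def)
      hence "(\<lambda>n. D (n + 1)) = (\<lambda>n. presidue 1 (W (n + (i + 1))))" by (simp add: add_ac)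
      thus ?thesis unfolding \<D>_def by blast
    qed
    show "D = D'" if DD: "D \<in> \<D>" "D' \<in> \<D>" and eq: "\<And>i. i < 5 \<Longrightarrow> D i = D' i" for D D'
    proof -
      obtain i j where D: "D = (\<lambda>n. presidue 1 (W (n + i)))" and D': "D' = (\<lambda>n. presidue 1 (W (n + j)))"
        using DD by (auto simp: \<D>_def)
      have "W (n + i) - W (n + j) \<in> pideal p 1" for n
      proof (rule somos_pair_determined[OF somos_pair_shift[OF W] somos_pair_shift[OF W]])
        show "W (n + i) - W (n + j) \<in> pideal p 1" if "n < 5" for n
          using eq[OF that] by (simp only: D D' presidue_eq_iff[OF I I])
      qed
      thus ?thesis unfolding D D' by (intro ext) (simp only: presidue_eq_iff[OF I I])
    qed
  qed auto
  then obtain M n0 where M: "M \<ge> 1" "\<And>D n. D \<in> \<D> \<Longrightarrow> n \<ge> n0 \<Longrightarrow> D (n + M) = D n" by blast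
  have "W (n + M) - W n \<in> pideal p 1" if "n \<ge> n0" for n
  proof -
    have "(\<lambda>n. presidue 1 (W (n + 0))) \<in> \<D>" unfolding \<D>_def by blast
    from M(2)[OF this that] show ?thesis by (simp only: add_0_right presidue_eq_iff[OF I I])
  qed
  with M(1) show ?thesis using that by blast
qed

text \<open>Shifting a solution gives a solution for the shifted \<open>W\<close>. Only shifts by a
  period \<open>T\<close> of \<open>W\<close> modulo p lead back to the same relations, hence the
  family is shifted by \<open>T\<close>.\<close>

lemma lin_somos_pair_periodic:
  assumes W: "somos_pair a b c d W" and T: "T \<ge> 1" "\<And>n. W (n + T) - W n \<in> pideal p 1"
  obtains M n0 where "M \<ge> 1" "T dvd M"
    "\<And>D n. lin_somos_pair a b c d W D \<Longrightarrow> n \<ge> n0 \<Longrightarrow> D (n + M) - D n \<in> pideal p 1"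
proof -
  have I: "W i \<in> pideal p 0" for i using W by (rule somos_pair_integral)
  define \<D> where "\<D> = {\<lambda>n. presidue 1 (D n) | D. lin_somos_pair a b c d W D}"
  have "\<exists>M n0. M \<ge> 1 \<and> T dvd M \<and> (\<forall>D\<in>\<D>. \<forall>n\<ge>n0. D (n + M) = D n)"
  proof (rule shift_family_eventually_periodic[of T \<D> "int p" 5])
    show "D n \<in> {0..<int p}" if D: "D \<in> \<D>" for D n
    proof -
      obtain D0 where "lin_somos_pair a b c d W D0" "D = (\<lambda>n. presidue 1 (D0 n))"
        using D by (auto simp: \<D>_def)
      thus ?thesis using presidue(1)[of "D0 n" 1] lin_somos_pair_integral by simp
    qed
    show "(\<lambda>n. D (n + T)) \<in> \<D>" if D: "D \<in> \<D>" for D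
    proof -
      obtain D0 where D0: "lin_somos_pair a b c d W D0" "D = (\<lambda>n. presidue 1 (D0 n))"
        using D by (auto simp: \<D>_def)
      have "lin_somos_pair a b c d W (\<lambda>n. D0 (n + T))"
        by (rule lin_somos_pair_cong[OF lin_somos_pair_shift[OF D0(1)]]) (rule pideal_diff_commute[THEN iffD1, OF T(2)])
      thus ?thesis unfolding D0(2) \<D>_def
        by (intro CollectI exI[of _ "\<lambda>n. D0 (n + T)"] conjI refl)
    qed
    show "D = D'" if DD: "D \<in> \<D>" "D' \<in> \<D>" and eq: "\<And>i. i < 5 \<Longrightarrow> D i = D' i" for D D'
    proof -
      obtain E E' where E: "lin_somos_pair a b c d W E" "D = (\<lambda>n. presidue 1 (E n))"
        and E': "lin_somos_pair a b c d W E'" "D' = (\<lambda>n. presidue 1 (E' n))"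
        using DD by (auto simp: \<D>_def)
      have J: "E i \<in> pideal p 0" "E' i \<in> pideal p 0" for i using lin_somos_pair_integral E(1) E'(1) by blast+
      have "E n - E' n \<in> pideal p 1" for n
      proof (rule lin_somos_pair_zero[OF W lin_somos_pair_diff[OF W E(1) E'(1)]])
        show "E n - E' n \<in> pideal p 1" if "n < 5" for n
          using eq[OF that] by (simp only: E E' presidue_eq_iff[OF J])
      qed
      thus ?thesis unfolding E E' by (intro ext) (simp only: presidue_eq_iff[OF J])
    qed
  qed (use T in auto)
  then obtain M n0 where M: "M \<ge> 1" "T dvd M" "\<And>D n. D \<in> \<D> \<Longrightarrow> n \<ge> n0 \<Longrightarrow> D (n + M) = D n" by blast
  have "D (n + M) - D n \<in> pideal p 1" if D: "lin_somos_pair a b c d W D" and n: "n \<ge> n0" for D n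
  proof -
    have J: "D i \<in> pideal p 0" for i by (rule lin_somos_pair_integral[OF D])
    have "(\<lambda>n. presidue 1 (D n)) \<in> \<D>" unfolding \<D>_def using D by blast
    from M(3)[OF this n] show ?thesis by (simp only: presidue_eq_iff[OF J J])
  qed
  with M(1,2) show ?thesis using that by blast
qed

text \<open>Inserting \<open>V = W + P * D\<close> into the quadratic relations and cancelling
  \<open>P\<close> leaves the linear part equal to \<open>P\<close> times a quadratic expression in
  \<open>D\<close>, which vanishes modulo p because \<open>k \<ge> 1\<close>.\<close>

lemma somos_pair_difference:
  assumes W: "somos_pair a b c d W" and V: "somos_pair a b c d V"
    and k: "k \<ge> 1" and close: "\<And>n. V n - W n \<in> pideal p k"
  shows "lin_somos_pair a b c d W (\<lambda>n. (V n - W n) / of_nat p ^ k)"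
  unfolding lin_somos_pair_def
proof (intro allI)
  note Wn = W[unfolded somos_pair_def, rule_format]
  note Vn = V[unfolded somos_pair_def, rule_format]
  define D where "D = (\<lambda>n. (V n - W n) / of_nat p ^ k)"
  define P where "P = (of_nat p ^ k :: rat)"
  have P: "P \<noteq> 0" "P \<in> pideal p 1" using p_gt_1 k power_mult_pideal[of 1 0 k] pideal_antimono[of P k 1]
    by (auto simp: P_def)
  have D: "D n \<in> pideal p 0" for n
    unfolding D_def by (rule pideal_div_power) (use close in simp)
  have V_eq: "V n = W n + P * D n" for n using P by (simp add: D_def P_def)
  fix n
  have "P * (D (n + 4) * W n + W (n + 4) * D n -
         (a * (D (n + 3) * W (n + 1) + W (n + 3) * D (n + 1)) + b * (2 * W (n + 2) * D (n + 2)))) =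
        P * (P * (a * (D (n + 3) * D (n + 1)) + b * (D (n + 2) * D (n + 2)) - D (n + 4) * D n))"
    using conjunct1[OF conjunct2[OF conjunct2[OF Wn[of n]]]] conjunct1[OF conjunct2[OF conjunct2[OF Vn[of n]]]]
    unfolding V_eq by Groebner_Basis.algebra
  hence 1: "D (n + 4) * W n + W (n + 4) * D n -
         (a * (D (n + 3) * W (n + 1) + W (n + 3) * D (n + 1)) + b * (2 * W (n + 2) * D (n + 2))) =
        P * (a * (D (n + 3) * D (n + 1)) + b * (D (n + 2) * D (n + 2)) - D (n + 4) * D n)"
    using P by simp
  have "P * (D (n + 5) * W n + W (n + 5) * D n -
         (c * (D (n + 4) * W (n + 1) + W (n + 4) * D (n + 1)) +
          d * (D (n + 3) * W (n + 2) + W (n + 3) * D (n + 2)))) =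
        P * (P * (c * (D (n + 4) * D (n + 1)) + d * (D (n + 3) * D (n + 2)) - D (n + 5) * D n))"
    using conjunct2[OF conjunct2[OF conjunct2[OF Wn[of n]]]] conjunct2[OF conjunct2[OF conjunct2[OF Vn[of n]]]]
    unfolding V_eq by Groebner_Basis.algebra
  hence 2: "D (n + 5) * W n + W (n + 5) * D n -
         (c * (D (n + 4) * W (n + 1) + W (n + 4) * D (n + 1)) +
          d * (D (n + 3) * W (n + 2) + W (n + 3) * D (n + 2))) =
        P * (c * (D (n + 4) * D (n + 1)) + d * (D (n + 3) * D (n + 2)) - D (n + 5) * D n)"
    using P by simp
  have "D n \<in> pideal p 0 \<and>
       D (n + 4) * W n + W (n + 4) * D n -
         (a * (D (n + 3) * W (n + 1) + W (n + 3) * D (n + 1)) + b * (2 * W (n + 2) * D (n + 2))) \<in> pideal p 1 \<and>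
       D (n + 5) * W n + W (n + 5) * D n -
         (c * (D (n + 4) * W (n + 1) + W (n + 4) * D (n + 1)) +
          d * (D (n + 3) * W (n + 2) + W (n + 3) * D (n + 2))) \<in> pideal p 1"
    unfolding 1 2 by (intro conjI D pideal_mult_right[OF P(2)] pideal_add pideal_diff pideal_mult_left abcd)
  thus "(V n - W n) / of_nat p ^ k \<in> pideal p 0 \<and>
       (V (n + 4) - W (n + 4)) / of_nat p ^ k * W n + W (n + 4) * ((V n - W n) / of_nat p ^ k) -
         (a * ((V (n + 3) - W (n + 3)) / of_nat p ^ k * W (n + 1) + W (n + 3) * ((V (n + 1) - W (n + 1)) / of_nat p ^ k)) +
          b * (2 * W (n + 2) * ((V (n + 2) - W (n + 2)) / of_nat p ^ k))) \<in> pideal p 1 \<and>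
       (V (n + 5) - W (n + 5)) / of_nat p ^ k * W n + W (n + 5) * ((V n - W n) / of_nat p ^ k) -
         (c * ((V (n + 4) - W (n + 4)) / of_nat p ^ k * W (n + 1) + W (n + 4) * ((V (n + 1) - W (n + 1)) / of_nat p ^ k)) +
          d * ((V (n + 3) - W (n + 3)) / of_nat p ^ k * W (n + 2) + W (n + 3) * ((V (n + 2) - W (n + 2)) / of_nat p ^ k))) \<in> pideal p 1"
    by (simp only: D_def)
qed

end

definition p_power_periodic :: "nat \<Rightarrow> (nat \<Rightarrow> rat) \<Rightarrow> bool" where
  "p_power_periodic M W \<longleftrightarrow> (\<forall>n. W n \<in> pideal p 0) \<and>
     (\<forall>k. \<exists>n0. \<forall>n\<ge>n0. W (n + M * p ^ k) - W n \<in> pideal p (Suc k))"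

text \<open>
  Passing from period \<open>t = M p ^ k\<close> modulo \<open>p ^ (k + 1)\<close> to period \<open>p t\<close> modulo \<open>p ^ (k + 2)\<close>:
  the increments \<open>W (n + t) - W n\<close>, divided by \<open>p ^ (k + 1)\<close>, solve the linearized relations, so
  they are \<open>t\<close>-periodic modulo \<open>p\<close>, and \<open>p\<close> of them add up to \<open>0\<close>.
\<close>
lemma somos_pair_p_power_periodic:
  assumes abcd: "a \<in> pideal p 0" "b \<in> pideal p 0" "c \<in> pideal p 0" "d \<in> pideal p 0"
    and W: "somos_pair a b c d W"
  obtains M where "M \<ge> 1" "p_power_periodic M W"
proof -
  have I: "W i \<in> pideal p 0" for i using W by (rule somos_pair_integral)
  obtain T n1 where T: "T \<ge> 1" "\<And>n. n \<ge> n1 \<Longrightarrow> W (n + T) - W n \<in> pideal p 1"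
    using somos_pair_periodic_mod_p[OF abcd W] by blast
  have Tm: "W (n + m * T) - W n \<in> pideal p 1" if "n \<ge> n1" for n m
    by (rule pideal_iterate[where U = W and t = T and n = n, OF T(2) that])
  \<comment> \<open>Dropping the pre-period makes \<open>T\<close> a period modulo p from index 0
    on, so a single \<open>M\<close> can be fixed before the induction on \<open>k\<close>.\<close>
  define V where "V = (\<lambda>n. W (n + n1))"
  have V: "somos_pair a b c d V" unfolding V_def by (rule somos_pair_shift[OF W])
  have VT: "V (n + T) - V n \<in> pideal p 1" for n
    using T(2)[of "n + n1"] by (simp add: V_def add_ac)
  obtain M n2 where M: "M \<ge> 1" "T dvd M"
    and lin: "\<And>D n. lin_somos_pair a b c d V D \<Longrightarrow> n \<ge> n2 \<Longrightarrow> D (n + M) - D n \<in> pideal p 1"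
    using lin_somos_pair_periodic[OF abcd V T(1) VT] by blast
  have "\<exists>n0. \<forall>n\<ge>n0. W (n + M * p ^ k) - W n \<in> pideal p (Suc k)" for k
  proof (induction k)
    case 0
    obtain m where "M = m * T" using M(2) by (metis dvdE mult.commute)
    thus ?case using Tm[of _ m] by auto
  next
    case (Suc k)
    then obtain n3 where n3: "\<And>n. n \<ge> n3 \<Longrightarrow> W (n + M * p ^ k) - W n \<in> pideal p (Suc k)" by blast
    define t where "t = M * p ^ k"
    define P where "P = (of_nat p ^ Suc k :: rat)"
    have P0: "P \<noteq> 0" using p_gt_1 by (simp add: P_def)
    define D where "D = (\<lambda>n. (W (n + t) - W n) / P)"
    \<comment> \<open>A start beyond \<open>n3\<close> that differs from \<open>n1\<close> by a
      multiple of \<open>T\<close>: the shift of \<open>W\<close> by \<open>r\<close> has the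
      residues of \<open>V\<close>, so the increments solve the relations for \<open>V\<close>, to
      which \<open>M\<close> belongs.\<close>
    define r where "r = n1 + n3 * T"
    have r: "r \<ge> n1" "r \<ge> n3" using T(1) by (auto simp: r_def trans_le_add2)
    have linD: "lin_somos_pair a b c d (\<lambda>n. W (n + r)) (\<lambda>n. (W (n + t + r) - W (n + r)) / of_nat p ^ Suc k)"
    proof (rule somos_pair_difference[OF abcd])
      show "somos_pair a b c d (\<lambda>n. W (n + t + r))"
        using somos_pair_shift[OF W, of "t + r"] by (simp add: add.assoc)
      show "W (n + t + r) - W (n + r) \<in> pideal p (Suc k)" for n
        using n3[of "n + r"] r by (simp add: t_def add_ac)
    qed (use somos_pair_shift[OF W] in auto)
    have lin': "lin_somos_pair a b c d V (\<lambda>n. D (n + r))"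
    proof (rule lin_somos_pair_cong[OF abcd])
      have "(W (n + t + r) - W (n + r)) / of_nat p ^ Suc k = D (n + r)" for n
        by (simp add: D_def P_def add_ac)
      with linD show "lin_somos_pair a b c d (\<lambda>n. W (n + r)) (\<lambda>n. D (n + r))" by simp
      show "V n - W (n + r) \<in> pideal p 1" for n
        using Tm[of "n + n1" n3] pideal_diff_commute by (simp add: V_def r_def add_ac)
    qed
    have DM: "D (n + M) - D n \<in> pideal p 1" if "n \<ge> n2 + r" for n
      using lin[OF lin', of "n - r"] that by simp
    have DMm: "D (n + m * M) - D n \<in> pideal p 1" if "n \<ge> n2 + r" for n m
      by (rule pideal_iterate[where U = D and t = M and n = n, OF DM that])
    have Dt: "D (n + m * t) - D n \<in> pideal p 1" if "n \<ge> n2 + r" for n m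
      using DMm[OF that, of "m * p ^ k"] by (simp add: t_def mult_ac)
    have WD: "W (n + t) = W n + P * D n" for n using P0 by (simp add: D_def)
    have PI: "P * x \<in> pideal p (Suc (Suc k))" if "x \<in> pideal p 1" for x
      using power_mult_pideal[OF that, of "Suc k"] by (simp add: P_def)
    have "W (n + m * t) - (W n + of_nat m * (P * D n)) \<in> pideal p (Suc (Suc k))" if n: "n \<ge> n2 + r" for n m
    proof (induction m)
      case (Suc m)
      have eq: "W (n + Suc m * t) - (W n + of_nat (Suc m) * (P * D n)) =
        (W (n + m * t) - (W n + of_nat m * (P * D n))) + P * (D (n + m * t) - D n)"
        using WD[of "n + m * t"] by (simp add: algebra_simps)
      show ?case unfolding eq by (rule pideal_add[OF Suc PI[OF Dt[OF n, of m]]])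
    qed simp
    from this[of _ p] have *: "W (n + p * t) - (W n + of_nat p * (P * D n)) \<in> pideal p (Suc (Suc k))"
      if "n \<ge> n2 + r" for n using that by blast
    have "W (n + p * t) - W n \<in> pideal p (Suc (Suc k))" if "n \<ge> n2 + r" for n
    proof -
      have "D n \<in> pideal p 0" unfolding D_def P_def
        by (rule pideal_div_power) (use n3[of n] r that in \<open>simp add: t_def\<close>)
      hence "of_nat p ^ Suc (Suc k) * D n \<in> pideal p (Suc (Suc k))"
        using power_mult_pideal[of "D n" 0 "Suc (Suc k)"] by simp
      moreover have "of_nat p ^ Suc (Suc k) * D n = of_nat p * (P * D n)" by (simp add: P_def mult.assoc)
      ultimately have "of_nat p * (P * D n) \<in> pideal p (Suc (Suc k))" by (simp only:)
      from pideal_add[OF *[OF that] this] show ?thesis by simp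
    qed
    thus ?case by (auto simp: t_def mult_ac)
  qed
  thus ?thesis using that[OF M(1)] I by (simp add: p_power_periodic_def)
qed

end

section \<open>Products, geometric sequences, and limits along \<open>m q^i\<close>\<close>

context prime_nat
begin

lemma p_power_periodic_dvd:
  assumes U: "p_power_periodic M U" and dvd: "M dvd M'"
  shows "p_power_periodic M' U"
  unfolding p_power_periodic_def
proof (intro conjI allI)
  show "U n \<in> pideal p 0" for n using U by (simp add: p_power_periodic_def)
  fix k
  obtain n0 where n0: "\<And>n. n \<ge> n0 \<Longrightarrow> U (n + M * p ^ k) - U n \<in> pideal p (Suc k)"
    using U unfolding p_power_periodic_def by blast
  have iter: "U (n + j * (M * p ^ k)) - U n \<in> pideal p (Suc k)" if "n \<ge> n0" for n j
    by (rule pideal_iterate[where U = U and t = "M * p ^ k" and n = n, OF n0 that])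
  obtain j where "M' = M * j" using dvd by (rule dvdE)
  with iter[of _ j] show "\<exists>n0. \<forall>n\<ge>n0. U (n + M' * p ^ k) - U n \<in> pideal p (Suc k)"
    by (auto simp: mult_ac)
qed

lemma p_power_periodic_mult:
  assumes U: "p_power_periodic M U" and V: "p_power_periodic M V"
  shows "p_power_periodic M (\<lambda>n. U n * V n)"
  unfolding p_power_periodic_def
proof (intro conjI allI)
  have I: "U n \<in> pideal p 0" "V n \<in> pideal p 0" for n using U V by (simp_all add: p_power_periodic_def)
  show "U n * V n \<in> pideal p 0" for n using pideal_mult_left[OF I] .
  fix k
  obtain n0 n1 where
    "\<And>n. n \<ge> n0 \<Longrightarrow> U (n + M * p ^ k) - U n \<in> pideal p (Suc k)"
    "\<And>n. n \<ge> n1 \<Longrightarrow> V (n + M * p ^ k) - V n \<in> pideal p (Suc k)"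
    using U V unfolding p_power_periodic_def by meson
  hence "U (n + M * p ^ k) * V (n + M * p ^ k) - U n * V n \<in> pideal p (Suc k)" if "n \<ge> max n0 n1" for n
    using that by (intro pideal_mult_diff I) auto
  thus "\<exists>n0. \<forall>n\<ge>n0. U (n + M * p ^ k) * V (n + M * p ^ k) - U n * V n \<in> pideal p (Suc k)" by blast
qed

lemma p_power_periodic_const: "x \<in> pideal p 0 \<Longrightarrow> p_power_periodic M (\<lambda>_. x)"
  by (simp add: p_power_periodic_def)

lemma pideal_power_diff:
  assumes "x - y \<in> pideal p k" "x \<in> pideal p 0" "y \<in> pideal p 0"
  shows "x ^ n - y ^ n \<in> pideal p k"
  by (induction n) (use assms in \<open>auto intro: pideal_mult_diff pideal_power\<close>)

text \<open>If p divides \<open>x\<close>, high powers vanish modulo \<open>p^(k+1)\<close>.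
  Otherwise Euler's theorem applies, and \<open>(p - 1) * p ^ k\<close> is the totient of
  \<open>p^(k+1)\<close>.\<close>

lemma p_power_periodic_power:
  assumes x: "x \<in> pideal p 0"
  shows "p_power_periodic (p - 1) (\<lambda>n. x ^ n)"
  unfolding p_power_periodic_def
proof (intro conjI allI)
  show "x ^ n \<in> pideal p 0" for n by (rule pideal_power[OF x])
  fix k
  show "\<exists>n0. \<forall>n\<ge>n0. x ^ (n + (p - 1) * p ^ k) - x ^ n \<in> pideal p (Suc k)"
  proof (cases "x \<in> pideal p 1")
    case True
    have "x ^ n \<in> pideal p n" for n
      by (induction n) (use True pideal_mult[of x 1] in auto)
    hence "x ^ n \<in> pideal p (Suc k)" if "n \<ge> Suc k" for n using that by (rule pideal_antimono)
    hence "x ^ (n + (p - 1) * p ^ k) - x ^ n \<in> pideal p (Suc k)" if "n \<ge> Suc k" for n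
      using that by (intro pideal_diff) auto
    thus ?thesis by blast
  next
    case False
    define r where "r = nat (presidue (Suc k) x)"
    have r: "x - of_nat r \<in> pideal p (Suc k)"
      using presidue[OF x, of "Suc k"] by (simp add: r_def)
    have "\<not> p dvd r"
    proof
      assume "p dvd r"
      hence "(of_int (int r) :: rat) \<in> pideal p 1" by (intro pideal_of_int) simp
      hence "of_nat r \<in> pideal p 1" by simp
      from pideal_add[OF pideal_antimono[OF r, of 1] this] False show False by simp
    qed
    hence "coprime r (p ^ Suc k)"
      using prime_imp_power_coprime[OF prime, of r "Suc k"] by (simp add: coprime_commute)
    hence "[r ^ totient (p ^ Suc k) = 1] (mod p ^ Suc k)" by (rule euler_theorem)
    moreover have "totient (p ^ Suc k) = (p - 1) * p ^ k"
      using totient_prime_power_Suc[OF prime, of k] by (simp add: mult.commute)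
    ultimately have "[int (r ^ ((p - 1) * p ^ k)) = int 1] (mod int (p ^ Suc k))"
      by (simp only: cong_int_iff)
    hence "int p ^ Suc k dvd int (r ^ ((p - 1) * p ^ k)) - 1" by (simp add: cong_iff_dvd_diff)
    hence "of_int (int (r ^ ((p - 1) * p ^ k)) - 1) \<in> pideal p (Suc k)" by (rule pideal_of_int)
    hence "of_nat r ^ ((p - 1) * p ^ k) - 1 \<in> pideal p (Suc k)" by simp
    moreover have "x ^ ((p - 1) * p ^ k) - of_nat r ^ ((p - 1) * p ^ k) \<in> pideal p (Suc k)"
      by (rule pideal_power_diff[OF r x]) simp
    ultimately have "x ^ ((p - 1) * p ^ k) - 1 \<in> pideal p (Suc k)" by (rule pideal_diff_trans[rotated])
    from pideal_mult_left[OF pideal_power[OF x] this]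
    have "x ^ (n + (p - 1) * p ^ k) - x ^ n \<in> pideal p (Suc k)" for n
      by (simp add: power_add right_diff_distrib)
    thus ?thesis by blast
  qed
qed

text \<open>
  The exponent \<open>N\<close> is chosen such that the part of \<open>M\<close> prime to \<open>p\<close> divides \<open>p ^ N - 1\<close>: then
  \<open>m q ^ (i + 1) - m q ^ i\<close> with \<open>q = p ^ N\<close> is divisible by \<open>M p ^ k\<close> for large \<open>i\<close>.
\<close>
lemma p_power_periodic_limits:
  assumes "M \<ge> 1"
  obtains N where "N \<ge> 1"
    "\<And>U m. p_power_periodic M U \<Longrightarrow> m \<ge> 1 \<Longrightarrow> limit_exists_in_Zp p (\<lambda>i. U (m * (p ^ N) ^ i))"
proof -
  have "M \<noteq> 0" "\<not> is_unit p" using assms p_gt_1 by auto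
  then obtain M' where M': "M = p ^ multiplicity p M * M'" "\<not> p dvd M'"
    by (rule multiplicity_decompose')
  define e where "e = multiplicity p M"
  define N where "N = totient M'"
  have "M' > 0" using M' by (auto intro: gr0I)
  hence N: "N \<ge> 1" by (simp add: N_def Suc_le_eq)
  have "coprime p M'" using M'(2) prime by (simp add: prime_imp_coprime)
  hence "[p ^ N = 1] (mod M')" unfolding N_def by (rule euler_theorem)
  moreover have "1 \<le> p ^ N" using p_gt_1 by simp
  ultimately have dvd: "M' dvd p ^ N - 1" by (simp only: cong_def mod_eq_dvd_iff_nat)
  have "limit_exists_in_Zp p (\<lambda>i. U (m * (p ^ N) ^ i))" if U: "p_power_periodic M U" and m: "m \<ge> 1" for U m
  proof (rule limit_exists_in_ZpI)
    show "U (m * (p ^ N) ^ i) \<in> pideal p 0" for i using U by (simp add: p_power_periodic_def)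
    fix k
    obtain n0 where n0: "\<And>n. n \<ge> n0 \<Longrightarrow> U (n + M * p ^ k) - U n \<in> pideal p (Suc k)"
      using U unfolding p_power_periodic_def by blast
    have iter: "U (n + j * (M * p ^ k)) - U n \<in> pideal p (Suc k)" if "n \<ge> n0" for n j
      by (rule pideal_iterate[where U = U and t = "M * p ^ k" and n = n, OF n0 that])
    \<comment> \<open>The bound on \<open>i\<close> has two purposes: the index passes
      \<open>n0\<close>, and \<open>q^i\<close> absorbs the p-part \<open>p^(e+k)\<close> of
      \<open>M * p ^ k\<close>. The prime-to-p part divides \<open>q - 1\<close>.\<close>
    have "U (m * (p ^ N) ^ Suc i) - U (m * (p ^ N) ^ i) \<in> pideal p k" if i: "i \<ge> n0 + e + k" for i
    proof -
      have q: "p ^ N > 1" using p_gt_1 N by (intro one_less_power) auto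
      have "n0 \<le> i" using i by simp
      also have "i < 2 ^ i" by (rule less_exp)
      also have "2 ^ i \<le> (p ^ N) ^ i" using q by (intro power_mono) auto
      also have "\<dots> \<le> m * (p ^ N) ^ i" using m by simp
      finally have big: "m * (p ^ N) ^ i \<ge> n0" by simp
      have "e + k \<le> N * i" using i N by (metis add_leD2 add.assoc le_trans mult_le_mono1 nat_mult_1)
      hence "p ^ (e + k) dvd (p ^ N) ^ i" by (simp add: power_mult [symmetric] le_imp_power_dvd)
      from mult_dvd_mono[OF this dvd] have "M * p ^ k dvd (p ^ N) ^ i * (p ^ N - 1)"
        by (subst M'(1)) (simp add: e_def power_add mult_ac)
      hence "M * p ^ k dvd m * ((p ^ N) ^ i * (p ^ N - 1))" by (rule dvd_mult)
      then obtain j where j: "m * ((p ^ N) ^ i * (p ^ N - 1)) = j * (M * p ^ k)" by (metis dvdE mult.commute)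
      have "m * (p ^ N) ^ Suc i = m * (p ^ N) ^ i + m * ((p ^ N) ^ i * (p ^ N - 1))"
        using q by (simp add: algebra_simps diff_mult_distrib2)
      hence "m * (p ^ N) ^ Suc i = m * (p ^ N) ^ i + j * (M * p ^ k)" by (simp only: j)
      with iter[OF big, of j] show ?thesis by (auto intro: pideal_antimono)
    qed
    thus "\<exists>i0. \<forall>i\<ge>i0. U (m * (p ^ N) ^ Suc i) - U (m * (p ^ N) ^ i) \<in> pideal p k" by blast
  qed
  with N show ?thesis using that by blast
qed

end

section \<open>Reduction of points\<close>

context prime_nat
begin

section \<open>The reduction map as a homomorphism onto the residue field\<close>

abbreviation Fp :: "int ring" where "Fp \<equiv> residue_ring (int p)"
abbreviation res :: "rat \<Rightarrow> int" where "res \<equiv> presidue 1"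

text \<open>Otherwise the simplifier turns \<open>pideal p 1\<close> and \<open>presidue 1\<close> into a form the lemmas do not match.\<close>

declare One_nat_def [simp del]

lemma Fp_simps:
  "carrier Fp = {0..int p - 1}" "\<zero>\<^bsub>Fp\<^esub> = 0" "\<one>\<^bsub>Fp\<^esub> = 1"
  "x \<oplus>\<^bsub>Fp\<^esub> y = (x + y) mod int p" "x \<otimes>\<^bsub>Fp\<^esub> y = x * y mod int p"
  using p_gt_1 by (simp_all add: residue_ring_def)

lemma Fp_field: "Ring.field Fp"
proof -
  interpret residues_prime p Fp by unfold_locales (simp_all add: prime)
  show ?thesis by (rule is_field)
qed

lemma res_carrier [simp]: "x \<in> pideal p 0 \<Longrightarrow> res x \<in> carrier Fp"
  using presidue(1)[of x 1] by (simp add: Fp_simps)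

lemma res_eqI: "x \<in> pideal p 0 \<Longrightarrow> x - of_int r \<in> pideal p 1 \<Longrightarrow> res x = r mod int p"
proof (rule presidue_eqI)
  assume x: "x \<in> pideal p 0" "x - of_int r \<in> pideal p 1"
  have "of_int (r - r mod int p) \<in> pideal p 1" by (intro pideal_of_int) simp
  with pideal_add[OF x(2) this] show "x - of_int (r mod int p) \<in> pideal p 1" by simp
  show "r mod int p \<in> {0..<int p ^ 1}" using p_gt_1 by simp
qed

lemma res_eq_0_iff: "x \<in> pideal p 0 \<Longrightarrow> res x = 0 \<longleftrightarrow> x \<in> pideal p 1"
  using presidue_eq_iff[of x 0 1] res_eqI[of 0 0] by simp

lemma res_hom:
  assumes "x \<in> pideal p 0" "y \<in> pideal p 0"
  shows "res x \<oplus>\<^bsub>Fp\<^esub> res y = res (x + y)" "res x \<otimes>\<^bsub>Fp\<^esub> res y = res (x * y)"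
proof -
  note x = presidue(2)[OF assms(1), of 1] and y = presidue(2)[OF assms(2), of 1]
  have "(x + y) - of_int (res x + res y) \<in> pideal p 1" using pideal_add[OF x y] by (simp add: algebra_simps)
  thus "res x \<oplus>\<^bsub>Fp\<^esub> res y = res (x + y)"
    unfolding Fp_simps by (intro res_eqI [symmetric] pideal_add assms)
  have "x * y - of_int (res x) * of_int (res y) \<in> pideal p 1"
    by (rule pideal_mult_diff[OF x y]) (use assms in simp_all)
  thus "res x \<otimes>\<^bsub>Fp\<^esub> res y = res (x * y)"
    unfolding Fp_simps by (intro res_eqI [symmetric] pideal_mult_left assms) simp
qed

lemma res_0_1: "res 0 = \<zero>\<^bsub>Fp\<^esub>" "res 1 = \<one>\<^bsub>Fp\<^esub>"
  using res_eqI[of 0 0] res_eqI[of 1 1] p_gt_1 by (simp_all add: Fp_simps)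

lemma res_hom':
  assumes "x \<in> pideal p 0"
  shows "\<ominus>\<^bsub>Fp\<^esub> res x = res (- x)"
    "y \<in> pideal p 0 \<Longrightarrow> res x \<ominus>\<^bsub>Fp\<^esub> res y = res (x - y)"
    "[(2::nat)] \<cdot>\<^bsub>Fp\<^esub> res x = res (2 * x)" "[(3::nat)] \<cdot>\<^bsub>Fp\<^esub> res x = res (3 * x)"
    "x \<notin> pideal p 1 \<Longrightarrow> inv\<^bsub>Fp\<^esub> res x = res (inverse x)"
proof -
  interpret R: Ring.field Fp by (rule Fp_field)
  have neg: "\<ominus>\<^bsub>Fp\<^esub> res x = res (- x)" if "x \<in> pideal p 0" for x
  proof (rule R.minus_equality)
    show "res (- x) \<oplus>\<^bsub>Fp\<^esub> res x = \<zero>\<^bsub>Fp\<^esub>"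
      using res_hom(1)[OF pideal_uminus[OF that] that] by (simp add: res_0_1)
  qed (use that in \<open>simp_all add: pideal_uminus\<close>)
  show "\<ominus>\<^bsub>Fp\<^esub> res x = res (- x)" by (rule neg[OF assms(1)])
  show "res x \<ominus>\<^bsub>Fp\<^esub> res y = res (x - y)" if "y \<in> pideal p 0"
    using res_hom(1)[OF assms(1) pideal_uminus[OF that]] by (simp add: a_minus_def neg that)
  have xx: "x + x \<in> pideal p 0" by (intro pideal_add assms)
  have two: "[(2::nat)] \<cdot>\<^bsub>Fp\<^esub> res x = res (x + x)"
    using assms by (simp add: numeral_2_eq_2 R.add.nat_pow_Suc res_hom)
  thus "[(2::nat)] \<cdot>\<^bsub>Fp\<^esub> res x = res (2 * x)" by (simp only: mult_2)
  have "[(3::nat)] \<cdot>\<^bsub>Fp\<^esub> res x = [(2::nat)] \<cdot>\<^bsub>Fp\<^esub> res x \<oplus>\<^bsub>Fp\<^esub> res x"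
    by (simp only: numeral_3_eq_3 numeral_2_eq_2 R.add.nat_pow_Suc)
  also have "\<dots> = res (x + x + x)" by (simp only: two res_hom(1)[OF xx assms])
  also have "x + x + x = 3 * x" by simp
  finally show "[(3::nat)] \<cdot>\<^bsub>Fp\<^esub> res x = res (3 * x)" .
  assume u: "x \<notin> pideal p 1"
  hence "x \<noteq> 0" by auto
  show "inv\<^bsub>Fp\<^esub> res x = res (inverse x)"
  proof (rule R.comm_inv_char)
    show "res x \<otimes>\<^bsub>Fp\<^esub> res (inverse x) = \<one>\<^bsub>Fp\<^esub>"
      using res_hom(2)[OF assms(1) pideal_inverse[OF assms(1) u]] \<open>x \<noteq> 0\<close> by (simp add: res_0_1)
  qed (use assms pideal_inverse[OF assms(1) u] in simp_all)
qed

lemma rat_mod_eq_res: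
  assumes "x \<in> pideal p 0"
  shows "rat_mod p x = res x"
proof -
  interpret R: Ring.field Fp by (rule Fp_field)
  obtain a b where q: "quotient_of x = (a, b)" by force
  have b: "b > 0" and cop: "coprime a b" and x: "x = of_int a / of_int b"
    using quotient_of_denom_pos[OF q] quotient_of_coprime[OF q] quotient_of_div[OF q] by auto
  have pb: "\<not> int p dvd b"
  proof
    assume "int p dvd b"
    obtain c d where cd: "\<not> int p dvd d" "d \<noteq> 0" "x = of_int (int p ^ 0 * c) / of_int d"
      using assms by (rule pidealE)
    have "(of_int (a * d) :: rat) = of_int (c * b)" using cd x b by (simp add: field_simps)
    hence "a * d = c * b" by (simp only: of_int_eq_iff)
    hence "int p dvd a * d" using \<open>int p dvd b\<close> by simp
    hence "int p dvd a" using cd prime_int by (simp add: prime_dvd_mult_iff)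
    hence "is_unit (int p)" using \<open>int p dvd b\<close> cop by (metis coprime_common_divisor)
    thus False using p_gt_1 by simp
  qed
  have rb: "res (of_int b) = b mod int p" "res (of_int a) = a mod int p" by (rule res_eqI; simp)+
  have bu: "of_int b \<notin> pideal p 1" using pb by (simp add: of_int_pideal_iff)
  have "rat_mod p x = res (of_int a) \<otimes>\<^bsub>Fp\<^esub> inv\<^bsub>Fp\<^esub> res (of_int b)"
    by (simp add: rat_mod_def q rb)
  also have "\<dots> = res (of_int a * inverse (of_int b))"
    using bu by (simp add: res_hom' res_hom(2) pideal_inverse)
  finally show ?thesis by (simp add: x divide_inverse)
qed

lemma not_pideal_0_inverse:
  assumes "x \<notin> pideal p 0"
  shows "inverse x \<in> pideal p 1"
proof -
  obtain a b where q: "quotient_of x = (a, b)" by force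
  have b: "b > 0" and cop: "coprime a b" and x: "x = of_int a / of_int b"
    using quotient_of_denom_pos[OF q] quotient_of_coprime[OF q] quotient_of_div[OF q] by auto
  have pb: "int p dvd b" using assms pidealI[of b x 0 a] x by auto
  have "\<not> int p dvd a"
  proof
    assume "int p dvd a"
    hence "is_unit (int p)" using pb cop by (metis coprime_common_divisor)
    thus False using p_gt_1 by simp
  qed
  moreover obtain c where "b = int p * c" using pb by (rule dvdE)
  ultimately show ?thesis using x by (intro pidealI[of a _ _ c]) simp_all
qed

text \<open>The p-integral rationals are integrally closed: if \<open>l\<close> were not p-integral,
  dividing by \<open>l\<^sup>2\<close> would put 1 into the maximal ideal.\<close>

lemma pideal_0_quadratic:
  assumes "l\<^sup>2 + a * l \<in> pideal p 0" "a \<in> pideal p 0"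
  shows "l \<in> pideal p 0"
proof (rule ccontr)
  assume "l \<notin> pideal p 0"
  hence i: "inverse l \<in> pideal p 1" and l: "l \<noteq> 0" by (auto simp: not_pideal_0_inverse)
  have "(l\<^sup>2 + a * l) * (inverse l * inverse l) \<in> pideal p 1"
    by (intro pideal_mult_left[OF assms(1)] pideal_mult_left[OF pideal_imp_0[OF i] i])
  moreover have "a * inverse l \<in> pideal p 1" by (rule pideal_mult_left[OF assms(2) i])
  ultimately have "(l\<^sup>2 + a * l) * (inverse l * inverse l) - a * inverse l \<in> pideal p 1" by (rule pideal_diff)
  moreover have "(l\<^sup>2 + a * l) * (inverse l * inverse l) - a * inverse l = 1"
  proof -
    have "l * inverse l = 1" using l by simp
    thus ?thesis by Groebner_Basis.algebra
  qed
  ultimately show False using one_notin_pideal by simp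
qed

lemma reduce_wpoint_ne_Infinity:
  "reduce_wpoint p R \<noteq> Infinity \<longleftrightarrow> (\<exists>x y. R = Affine x y \<and> x \<in> pideal p 0 \<and> y \<in> pideal p 0)"
  by (cases R) (simp_all add: padic_ord_nonneg_iff)

section \<open>Units from the order of the reduced point\<close>

context
  fixes e1 e2 e3 e4 e6 :: rat
  assumes coeffs: "e1 \<in> pideal p 0" "e2 \<in> pideal p 0" "e3 \<in> pideal p 0" "e4 \<in> pideal p 0" "e6 \<in> pideal p 0"
begin

text \<open>\<open>B\<close> is the division polynomial of index 2 at the point and
  \<open>xd\<close> the x-coordinate of its double. \<open>B\<close> is a unit because doubling does
  not give infinity modulo p, and \<open>x - xd\<close> because tripling does not.\<close>

lemma order_mod_gt_3:
  assumes xy: "x \<in> pideal p 0" "y \<in> pideal p 0"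
    and ord: "order_mod p (WCurve e1 e2 e3 e4 e6) (Affine x y) > 3"
  defines "B \<equiv> 2 * y + e1 * x + e3"
  defines "l \<equiv> (3 * x\<^sup>2 + 2 * e2 * x + e4 - e1 * y) / B"
  defines "xd \<equiv> l\<^sup>2 + e1 * l - e2 - 2 * x"
  shows "B \<in> pideal p 0" "B \<notin> pideal p 1" "l \<in> pideal p 0" "xd \<in> pideal p 0" "x - xd \<notin> pideal p 1"
proof -
  define C where "C = WCurve (res e1) (res e2) (res e3) (res e4) (res e6)"
  define P where "P = Affine (res x) (res y)"
  have red: "reduce_wcurve p (WCurve e1 e2 e3 e4 e6) = C" "reduce_wpoint p (Affine x y) = P"
    using xy by (simp_all add: reduce_wcurve_def C_def P_def rat_mod_eq_res coeffs padic_ord_nonneg_iff)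
  \<comment> \<open>Numbers below a \<open>LEAST\<close> fail its predicate even if no number
    satisfies it, so the existence of a finite order is not presupposed.\<close>
  have L: "\<not> (0 < n \<and> P [^]\<^bsub>wgroup Fp C\<^esub> n = \<one>\<^bsub>wgroup Fp C\<^esub>)" if "n \<le> 3" for n :: nat
    using ord that not_less_Least[of n "\<lambda>n. 0 < n \<and> P [^]\<^bsub>wgroup Fp C\<^esub> n = \<one>\<^bsub>wgroup Fp C\<^esub>"]
    unfolding order_mod_def elem_order_def red by linarith
  have ne2: "wadd Fp C P P \<noteq> Infinity"
    using L[of 2] by (simp add: nat_pow_def wgroup_def numeral_2_eq_2)
  have ne3: "wadd Fp C (wadd Fp C P P) P \<noteq> Infinity"
    using L[of 3] by (simp add: nat_pow_def wgroup_def numeral_3_eq_3)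
  note [simp] = pideal_add pideal_diff pideal_mult_left pideal_uminus coeffs xy
  show B: "B \<in> pideal p 0" by (simp add: B_def)
  have hB: "res y \<oplus>\<^bsub>Fp\<^esub> res y \<oplus>\<^bsub>Fp\<^esub> res e1 \<otimes>\<^bsub>Fp\<^esub> res x \<oplus>\<^bsub>Fp\<^esub> res e3 = res B"
    unfolding B_def mult_2 by (simp add: res_hom)
  have "res B \<noteq> \<zero>\<^bsub>Fp\<^esub>"
    using ne2 unfolding C_def P_def wadd.simps hB by auto
  thus Bu: "B \<notin> pideal p 1" using res_eq_0_iff[OF B] by (simp add: Fp_simps)
  have iB: "inverse B \<in> pideal p 0" by (rule pideal_inverse[OF B Bu])
  have l_eq: "l = (3 * (x * x) + 2 * (e2 * x) + e4 - e1 * y) * inverse (2 * y + e1 * x + e3)"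
    by (simp add: l_def B_def divide_inverse power2_eq_square mult.assoc)
  show l: "l \<in> pideal p 0" unfolding l_eq B_def [symmetric] using iB by simp
  have xd_eq: "xd = l * l + e1 * l - e2 - x - x" by (simp add: xd_def power2_eq_square)
  show xd: "xd \<in> pideal p 0" unfolding xd_eq using l by simp
  define yd where "yd = - (y + l * (xd - x)) - e1 * xd - e3"
  have yd: "yd \<in> pideal p 0" unfolding yd_def using l xd by simp
  have hl: "([(3::nat)] \<cdot>\<^bsub>Fp\<^esub> (res x \<otimes>\<^bsub>Fp\<^esub> res x) \<oplus>\<^bsub>Fp\<^esub> [(2::nat)] \<cdot>\<^bsub>Fp\<^esub> (res e2 \<otimes>\<^bsub>Fp\<^esub> res x) \<oplus>\<^bsub>Fp\<^esub> res e4 \<ominus>\<^bsub>Fp\<^esub> res e1 \<otimes>\<^bsub>Fp\<^esub> res y)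
      \<otimes>\<^bsub>Fp\<^esub> inv\<^bsub>Fp\<^esub> ([(2::nat)] \<cdot>\<^bsub>Fp\<^esub> res y \<oplus>\<^bsub>Fp\<^esub> res e1 \<otimes>\<^bsub>Fp\<^esub> res x \<oplus>\<^bsub>Fp\<^esub> res e3) = res l"
    unfolding l_eq using iB Bu by (simp add: res_hom res_hom' B_def)
  have hx: "res l \<otimes>\<^bsub>Fp\<^esub> res l \<oplus>\<^bsub>Fp\<^esub> res e1 \<otimes>\<^bsub>Fp\<^esub> res l \<ominus>\<^bsub>Fp\<^esub> res e2 \<ominus>\<^bsub>Fp\<^esub> res x \<ominus>\<^bsub>Fp\<^esub> res x = res xd"
    unfolding xd_eq using l by (simp add: res_hom res_hom')
  have hy: "\<ominus>\<^bsub>Fp\<^esub> (res y \<oplus>\<^bsub>Fp\<^esub> res l \<otimes>\<^bsub>Fp\<^esub> (res xd \<ominus>\<^bsub>Fp\<^esub> res x)) \<ominus>\<^bsub>Fp\<^esub> res e1 \<otimes>\<^bsub>Fp\<^esub> res xd \<ominus>\<^bsub>Fp\<^esub> res e3 = res yd"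
    unfolding yd_def using l xd by (simp add: res_hom res_hom')
  have dbl: "wadd Fp C P P = Affine (res xd) (res yd)"
    unfolding C_def P_def wadd.simps hB Let_def hl hx hy using \<open>res B \<noteq> \<zero>\<^bsub>Fp\<^esub>\<close> by (simp add: hl hx hy)
  show "x - xd \<notin> pideal p 1"
  proof
    assume d: "x - xd \<in> pideal p 1"
    \<comment> \<open>The negative of the double lies on the tangent through \<open>(x, y)\<close>.
      Congruent x-coordinates therefore make it congruent to the point itself, which means that
      tripling gives infinity.\<close>
    have "yd + y + e1 * x + e3 = (l + e1) * (x - xd)" by (simp add: yd_def algebra_simps)
    also have "\<dots> \<in> pideal p 1" by (rule pideal_mult_left[OF _ d]) (use l in simp)
    finally have "res (yd + y + e1 * x + e3) = 0" using yd by (subst res_eq_0_iff) simp_all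
    moreover have "res yd \<oplus>\<^bsub>Fp\<^esub> res y \<oplus>\<^bsub>Fp\<^esub> res e1 \<otimes>\<^bsub>Fp\<^esub> res x \<oplus>\<^bsub>Fp\<^esub> res e3 = res (yd + y + e1 * x + e3)"
      using yd by (simp add: res_hom)
    moreover have "res xd = res x"
      using d presidue_eq_iff[OF xy(1) xd, of 1] by simp
    ultimately have cond: "res xd = res x \<and>
        res yd \<oplus>\<^bsub>Fp\<^esub> res y \<oplus>\<^bsub>Fp\<^esub> res e1 \<otimes>\<^bsub>Fp\<^esub> res x \<oplus>\<^bsub>Fp\<^esub> res e3 = \<zero>\<^bsub>Fp\<^esub>"
      by (simp only: Fp_simps(2))
    have "wadd Fp C (wadd Fp C P P) P = Infinity"
      unfolding dbl unfolding C_def P_def wadd.simps by (rule if_P[OF cond])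
    with ne3 show False by simp
  qed
qed

end

end

section \<open>Translated division polynomials\<close>

text \<open>\<open>l\<close> and \<open>l'\<close> are the slopes from \<open>(x2, y2)\<close> to
  \<open>(x1, y1)\<close> and to its negative. Both solve monic quadratics with p-integral
  coefficients, because sum and difference of the points have p-integral x-coordinates. As
  \<open>(l - l') * (x1 - x2)\<close> is \<open>2 * y1 + e1 * x1 + e3\<close>, which p does not
  divide, p does not divide \<open>x1 - x2\<close> either.\<close>

lemma (in prime_nat) reduction_chord:
  fixes e1 e2 e3 e4 e6 x1 y1 x2 y2 :: rat
  defines "E \<equiv> WCurve e1 e2 e3 e4 e6"
  assumes coeffs: "e1 \<in> pideal p 0" "e2 \<in> pideal p 0"
    and xy: "x1 \<in> pideal p 0" "x2 \<in> pideal p 0"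
    and on: "Affine x1 y1 \<in> wpoints rat_field E" "Affine x2 y2 \<in> wpoints rat_field E"
    and B: "2 * y1 + e1 * x1 + e3 \<notin> pideal p 1"
    and add: "reduce_wpoint p (wadd rat_field E (Affine x2 y2) (Affine x1 y1)) \<noteq> Infinity"
    and sub: "reduce_wpoint p (wadd rat_field E (Affine x2 y2) (wneg rat_field E (Affine x1 y1))) \<noteq> Infinity"
  defines "l \<equiv> (y1 - y2) / (x1 - x2)"
  shows "x1 \<noteq> x2" "x1 - x2 \<notin> pideal p 1" "l\<^sup>2 + e1 * l - e2 - x2 - x1 \<in> pideal p 0"
proof -
  have neg: "wneg rat_field E (Affine x1 y1) = Affine x1 (- y1 - e1 * x1 - e3)"
    unfolding E_def by (rule wneg_field)
  have ne: "wadd rat_field E (Affine x2 y2) (Affine x1 y1) \<noteq> Infinity"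
      "wadd rat_field E (Affine x2 y2) (Affine x1 (- y1 - e1 * x1 - e3)) \<noteq> Infinity"
    using add sub unfolding neg by auto
  show x: "x1 \<noteq> x2"
  proof
    assume eq: "x1 = x2"
    have "y1\<^sup>2 + e1 * x1 * y1 + e3 * y1 = y2\<^sup>2 + e1 * x2 * y2 + e3 * y2"
      using on unfolding wpoints_def mem_Collect_eq E_def on_wcurve_field eq by simp
    hence "(y2 - y1) * (y2 + y1 + e1 * x1 + e3) = 0" unfolding eq by Groebner_Basis.algebra
    hence "y2 + y1 + e1 * x1 + e3 = 0 \<or> y2 + (- y1 - e1 * x1 - e3) + e1 * x1 + e3 = 0" by auto
    thus False using ne eq unfolding E_def wadd_eq_Infinity_iff by blast
  qed
  have quad: "m \<in> pideal p 0" if "m\<^sup>2 + e1 * m - e2 - x2 - x1 \<in> pideal p 0" for m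
  proof (rule pideal_0_quadratic)
    have "m\<^sup>2 + e1 * m = (m\<^sup>2 + e1 * m - e2 - x2 - x1) + e2 + x2 + x1" by simp
    also have "\<dots> \<in> pideal p 0" by (intro pideal_add that coeffs xy)
    finally show "m\<^sup>2 + e1 * m \<in> pideal p 0" .
  qed (rule coeffs)
  have int: "m\<^sup>2 + e1 * m - e2 - x2 - x1 \<in> pideal p 0"
    if "reduce_wpoint p (wadd rat_field E (Affine x2 y2) (Affine x1 y)) \<noteq> Infinity" "m = (y - y2) / (x1 - x2)" for m y
    using that(1) x unfolding reduce_wpoint_ne_Infinity E_def that(2) by (simp only: wadd_chord) auto
  define l' where "l' = (- y1 - e1 * x1 - e3 - y2) / (x1 - x2)"
  show l: "l\<^sup>2 + e1 * l - e2 - x2 - x1 \<in> pideal p 0" by (rule int[OF add]) (simp add: l_def)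
  have l': "l'\<^sup>2 + e1 * l' - e2 - x2 - x1 \<in> pideal p 0" by (rule int[OF sub[unfolded neg]]) (simp add: l'_def)
  have eq: "(l - l') * (x1 - x2) = 2 * y1 + e1 * x1 + e3"
  proof -
    have "x1 - x2 \<noteq> 0" using x by simp
    hence "l * (x1 - x2) = y1 - y2" "l' * (x1 - x2) = - y1 - e1 * x1 - e3 - y2"
      by (simp_all only: l_def l'_def nonzero_eq_divide_eq times_divide_eq_left nonzero_mult_div_cancel_right not_False_eq_True)
    thus ?thesis unfolding left_diff_distrib by simp
  qed
  have "l - l' \<in> pideal p 0" by (rule pideal_diff[OF quad[OF l] quad[OF l']])
  from pideal_mult_left[OF this, of "x1 - x2" 1] show "x1 - x2 \<notin> pideal p 1"
    using B unfolding eq by blast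
qed

section \<open>Both recurrences for the translated division polynomials\<close>

context uniformized
begin

abbreviation \<open>sg \<equiv> weierstrass_sigma L\<close>

text \<open>The index is shifted by one: the sequence starts with \<open>\<Psi>\<close> at \<open>-1\<close>.\<close>

definition psi_seq :: "complex \<Rightarrow> complex \<Rightarrow> nat \<Rightarrow> complex" where
  "psi_seq w1 w2 n =
     inverse (sg w2) * (sg w1 * sg w2 / sg (w1 + w2)) powi (int n - 1) * sg w1 powi (- ((int n - 1)\<^sup>2)) *
     sg (of_int (int n - 1) * w1 + w2)"

context
  fixes w1 w2 :: complex
  assumes w: "w1 \<notin> L" "w2 \<notin> L" "w1 + w2 \<notin> L"
begin

lemma sg_nonzero: "sg w1 \<noteq> 0" "sg w2 \<noteq> 0" "sg (w1 + w2) \<noteq> 0"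
  using w by (simp_all add: sigma_eq_0_iff)

lemma Psi_eq_psi_seq: "Psi L n w1 w2 = psi_seq w1 w2 (Suc n)"
proof -
  let ?s = "sg w1" and ?t = "sg (w1 + w2)" and ?r = "sg w2"
  note nz = sg_nonzero
  have 1: "?s powi (int n ^ 2 - int n) = ?s powi (int n ^ 2) / ?s ^ n"
    using nz by (simp add: power_int_diff)
  have 2: "?r powi (1 - int n) = ?r / ?r ^ n" using nz by (simp add: power_int_diff)
  have 3: "?s powi (- (int n ^ 2)) = inverse (?s powi (int n ^ 2))" by (simp add: power_int_minus)
  have "Psi L n w1 w2 = sg (of_nat n * w1 + w2) / (?s powi (int n ^ 2) / ?s ^ n * ?t ^ n * (?r / ?r ^ n))"
    unfolding Psi_def 1 2 by simp
  also have "\<dots> = inverse ?r * (?s * ?r / ?t) ^ n * inverse (?s powi (int n ^ 2)) * sg (of_nat n * w1 + w2)"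
    using nz by (simp add: power_divide power_mult_distrib divide_simps)
  also have "\<dots> = psi_seq w1 w2 (Suc n)" by (simp add: psi_seq_def 3)
  finally show ?thesis .
qed

text \<open>Up to a factor \<open>c * \<mu> ^ i\<close> and a power with exponent
  \<open>i\<^sup>2\<close>, the sequence is sigma along an arithmetic progression. Relative to the
  base index \<open>n\<close>, the mixed terms of the quadratic exponent go into \<open>c\<close>
  and \<open>\<mu>\<close>, so only small \<open>i\<close> remain.\<close>

lemma psi_seq_step:
  obtains c \<mu> where "\<And>i. psi_seq w1 w2 (n + i) =
    c * \<mu> ^ i * inverse (sg w1) ^ (i\<^sup>2) * sg (of_int (int n - 1 + int i) * w1 + w2)"
proof
  let ?s = "sg w1"
  define \<Lambda> where "\<Lambda> = sg w1 * sg w2 / sg (w1 + w2)"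
  define j where "j = int n - 1"
  have nz: "\<Lambda> \<noteq> 0" "?s \<noteq> 0" using sg_nonzero by (simp_all add: \<Lambda>_def)
  fix i
  have "(j + int i)\<^sup>2 = j\<^sup>2 + 2 * j * int i + int (i\<^sup>2)" by (simp add: power2_eq_square algebra_simps)
  hence "- ((j + int i)\<^sup>2) = - (j\<^sup>2) + (- (2 * j)) * int i + - int (i\<^sup>2)" by simp
  hence p1: "?s powi (- ((j + int i)\<^sup>2)) = ?s powi (- (j\<^sup>2)) * (?s powi (- (2 * j))) ^ i * inverse ?s ^ (i\<^sup>2)"
    using nz by (simp only: power_int_add power_int_mult power_int_minus power_int_of_nat power_inverse simp_thms)
  have p2: "\<Lambda> powi (j + int i) = \<Lambda> powi j * \<Lambda> ^ i" using nz by (simp add: power_int_add)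
  have e: "int (n + i) - 1 = j + int i" "int n - 1 = j" by (simp_all add: j_def)
  show "psi_seq w1 w2 (n + i) = (inverse (sg w2) * \<Lambda> powi j * ?s powi (- (j\<^sup>2))) * (\<Lambda> * ?s powi (- (2 * j))) ^ i *
      inverse ?s ^ (i\<^sup>2) * sg (of_int (int n - 1 + int i) * w1 + w2)"
    unfolding psi_seq_def \<Lambda>_def [symmetric] e p1 p2 power_mult_distrib by (simp only: mult_ac)
qed

text \<open>The values of \<open>\<Psi>\<close> at -1, 0, 1, 2. The outer two are the addition
  formula at \<open>w2\<close>, \<open>w1\<close> and at \<open>w1 + w2\<close>,
  \<open>w1\<close>.\<close>

lemma psi_seq_init:
  "psi_seq w1 w2 0 = xp w1 - xp w2" "psi_seq w1 w2 1 = 1" "psi_seq w1 w2 2 = 1"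
  "psi_seq w1 w2 3 = xp w1 - xp (w1 + w2)"
proof -
  let ?s = "sg w1" and ?t = "sg (w1 + w2)" and ?r = "sg w2"
  note nz = sg_nonzero
  show "psi_seq w1 w2 1 = 1" using nz by (simp add: psi_seq_def)
  have "psi_seq w1 w2 2 = inverse ?r * (?s * ?r / ?t) * inverse ?s * ?t"
    by (simp add: psi_seq_def power_int_minus)
  also have "\<dots> = (inverse ?r * ?r) * (?s * inverse ?s) * (inverse ?t * ?t)"
    by (simp only: divide_inverse mult_ac)
  also have "\<dots> = 1" using nz by simp
  finally show "psi_seq w1 w2 2 = 1" .
  have a: "?t * sg (w2 - w1) = - ?r\<^sup>2 * ?s\<^sup>2 * (xp w2 - xp w1)"
    using sigma_add[OF w(2) w(1)] by (simp add: add.commute)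
  have "psi_seq w1 w2 0 = inverse ?r * (?t / (?s * ?r)) * inverse ?s * sg (w2 - w1)"
    by (simp add: psi_seq_def power_int_minus)
  also have "\<dots> = (?t * sg (w2 - w1)) / (?r\<^sup>2 * ?s\<^sup>2)"
    using nz by (simp add: divide_inverse power2_eq_square)
  also have "\<dots> = xp w1 - xp w2" unfolding a using nz by simp
  finally show "psi_seq w1 w2 0 = xp w1 - xp w2" .
  have "w1 + w2 + w1 = 2 * w1 + w2" "w1 + w2 - w1 = w2" by simp_all
  with sigma_add[OF w(3) w(1)] have b: "sg (2 * w1 + w2) * ?r = - ?t\<^sup>2 * ?s\<^sup>2 * (xp (w1 + w2) - xp w1)"
    by metis
  have "psi_seq w1 w2 3 = inverse ?r * (?s * ?r / ?t)\<^sup>2 * inverse ?s ^ 4 * sg (2 * w1 + w2)"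
    by (simp add: psi_seq_def power_int_minus power_inverse)
  also have "\<dots> = (sg (2 * w1 + w2) * ?r) / (?t\<^sup>2 * ?s\<^sup>2)"
  proof -
    have "inverse ?r * (?s * ?r / ?t)\<^sup>2 * inverse ?s ^ 4 * sg (2 * w1 + w2) =
        (inverse ?r * ?r) * (?s * inverse ?s)\<^sup>2 * ((sg (2 * w1 + w2) * ?r) / (?t\<^sup>2 * ?s\<^sup>2))"
      by (simp only: divide_inverse power2_eq_square power4_eq_xxxx inverse_mult_distrib mult_ac)
    thus ?thesis using nz by simp
  qed
  also have "\<dots> = xp w1 - xp (w1 + w2)" unfolding b using nz by simp
  finally show "psi_seq w1 w2 3 = xp w1 - xp (w1 + w2)" .
qed

context
  assumes w': "2 * w1 \<notin> L"
begin

text \<open>The values \<open>\<sigma>(m w1) / \<sigma>(w1)^(m^2)\<close> are up to sign the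
  division polynomials at the first point: minus the one of index 2, the one of index 3, and the
  quotient of those of indices 4 and 2.\<close>

lemma sigma_multiples:
  defines "T \<equiv> inverse (sg w1)"
  shows "sg (2 * w1) * T ^ 4 = - dxp w1"
    and "sg (3 * w1) * T ^ 9 = (dxp w1)\<^sup>2 * (xp w1 - xp (2 * w1))"
    and "sg (4 * w1) * T ^ 12 / sg (2 * w1) = (dxp w1) ^ 3 * dxp (2 * w1)"
    and "sg (2 * w1) \<noteq> 0"
proof -
  let ?s = "sg w1"
  have s: "?s \<noteq> 0" by (rule sg_nonzero)
  have sT: "?s * T = 1" using s by (simp add: T_def)
  show d0: "sg (2 * w1) \<noteq> 0" using w' by (simp add: sigma_eq_0_iff)
  have d: "sg (2 * w1) = - (?s ^ 4 * dxp w1)" by (rule sigma_double[OF w(1)])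
  show 1: "sg (2 * w1) * T ^ 4 = - dxp w1" using sT unfolding d by Groebner_Basis.algebra
  have "sg (2 * w1 + w1) * sg (2 * w1 - w1) = - (sg (2 * w1))\<^sup>2 * ?s\<^sup>2 * (xp (2 * w1) - xp w1)"
    by (rule sigma_add[OF w' w(1)])
  moreover have "2 * w1 + w1 = 3 * w1" "2 * w1 - w1 = w1" by simp_all
  ultimately have "sg (3 * w1) * ?s = - (sg (2 * w1))\<^sup>2 * ?s\<^sup>2 * (xp (2 * w1) - xp w1)" by metis
  hence "sg (3 * w1) * ?s = (- (sg (2 * w1))\<^sup>2 * ?s * (xp (2 * w1) - xp w1)) * ?s"
    by Groebner_Basis.algebra
  hence e: "sg (3 * w1) = - (sg (2 * w1))\<^sup>2 * ?s * (xp (2 * w1) - xp w1)"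
    using mult_right_cancel[OF s] by blast
  have "sg (3 * w1) * T ^ 9 = (sg (2 * w1) * T ^ 4)\<^sup>2 * (xp w1 - xp (2 * w1))"
    using sT unfolding e by Groebner_Basis.algebra
  thus "sg (3 * w1) * T ^ 9 = (dxp w1)\<^sup>2 * (xp w1 - xp (2 * w1))" unfolding 1 by simp
  have "sg (2 * (2 * w1)) = - (sg (2 * w1) ^ 4 * dxp (2 * w1))" by (rule sigma_double[OF w'])
  hence g: "sg (4 * w1) = - (sg (2 * w1) ^ 4 * dxp (2 * w1))" by simp
  have "sg (4 * w1) * T ^ 12 = (- ((sg (2 * w1) * T ^ 4) ^ 3 * dxp (2 * w1))) * sg (2 * w1)"
    unfolding g by Groebner_Basis.algebra
  hence "sg (4 * w1) * T ^ 12 / sg (2 * w1) = - ((sg (2 * w1) * T ^ 4) ^ 3 * dxp (2 * w1))"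
    using nonzero_divide_eq_eq[OF d0] by blast
  thus "sg (4 * w1) * T ^ 12 / sg (2 * w1) = (dxp w1) ^ 3 * dxp (2 * w1)" unfolding 1 by simp
qed

lemma psi_seq_somos4:
  "psi_seq w1 w2 (n + 4) * psi_seq w1 w2 n =
     (dxp w1)\<^sup>2 * psi_seq w1 w2 (n + 3) * psi_seq w1 w2 (n + 1) +
     - ((dxp w1)\<^sup>2 * (xp w1 - xp (2 * w1))) * (psi_seq w1 w2 (n + 2))\<^sup>2"
proof -
  obtain c \<mu> where step: "\<And>i. psi_seq w1 w2 (n + i) =
      c * \<mu> ^ i * inverse (sg w1) ^ (i\<^sup>2) * sg (of_int (int n - 1 + int i) * w1 + w2)"
    using psi_seq_step by blast
  define v where "v = (\<lambda>i::nat. sg (of_int (int n - 1 + int i) * w1 + w2))"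
  define T where "T = inverse (sg w1)"
  have sT: "sg w1 * T = 1" using sg_nonzero by (simp add: T_def)
  define a where "a = of_int (int n - 1 + 2) * w1 + w2"
  have "a + 2 * w1 = of_int (int n - 1 + int 4) * w1 + w2" "a - 2 * w1 = of_int (int n - 1 + int 0) * w1 + w2"
    "a + w1 = of_int (int n - 1 + int 3) * w1 + w2" "a - w1 = of_int (int n - 1 + int 1) * w1 + w2"
    "a = of_int (int n - 1 + int 2) * w1 + w2" "2 * w1 + w1 = 3 * w1" "2 * w1 - w1 = w1"
    by (simp_all add: a_def algebra_simps)
  \<comment> \<open>With \<open>a\<close> at the middle of the five terms, the steps 2, 1, 0 give
    the index pairs (4, 0), (3, 1), (2, 2).\<close>
  with sigma_three_term[of a "2 * w1" w1 0]
  have rel: "v 4 * v 0 * sg w1 * sg w1 - v 3 * v 1 * sg (2 * w1) * sg (2 * w1) + v 2 * v 2 * sg (3 * w1) * sg w1 = 0"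
    by (simp only: v_def add_0_right diff_zero)
  have st: "psi_seq w1 w2 (n + 4) = c * \<mu> ^ 4 * T ^ 16 * v 4" "psi_seq w1 w2 n = c * v 0"
    "psi_seq w1 w2 (n + 3) = c * \<mu> ^ 3 * T ^ 9 * v 3" "psi_seq w1 w2 (n + 1) = c * \<mu> * T * v 1"
    "psi_seq w1 w2 (n + 2) = c * \<mu>\<^sup>2 * T ^ 4 * v 2"
    using step[of 4] step[of 0] step[of 3] step[of 1] step[of 2] by (simp_all add: v_def T_def)
  have "v 4 * v 0 = T\<^sup>2 * (v 3 * v 1 * sg (2 * w1) * sg (2 * w1)) - T * (v 2 * v 2 * sg (3 * w1))"
    using rel sT by Groebner_Basis.algebra
  hence "T ^ 16 * (v 4 * v 0) = (sg (2 * w1) * T ^ 4)\<^sup>2 * (T ^ 10 * v 3 * v 1) - (sg (3 * w1) * T ^ 9) * (T ^ 8 * v 2 * v 2)"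
    by Groebner_Basis.algebra
  hence key: "T ^ 16 * (v 4 * v 0) = (dxp w1)\<^sup>2 * (T ^ 10 * v 3 * v 1)
      - ((dxp w1)\<^sup>2 * (xp w1 - xp (2 * w1))) * (T ^ 8 * v 2 * v 2)"
    unfolding sigma_multiples(1,2)[folded T_def] by (simp only: power2_minus)
  have "c * \<mu> ^ 4 * T ^ 16 * v 4 * (c * v 0) = c\<^sup>2 * \<mu> ^ 4 * (T ^ 16 * (v 4 * v 0))"
    by (simp only: power2_eq_square mult_ac)
  also note key
  also have "c\<^sup>2 * \<mu> ^ 4 * (A * (T ^ 10 * v 3 * v 1) - B * (T ^ 8 * v 2 * v 2)) =
      A * (c * \<mu> ^ 3 * T ^ 9 * v 3) * (c * \<mu> * T * v 1) + - B * (c * \<mu>\<^sup>2 * T ^ 4 * v 2)\<^sup>2" for A B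
    by Groebner_Basis.algebra
  finally show ?thesis unfolding st .
qed

lemma psi_seq_somos5:
  "psi_seq w1 w2 (n + 5) * psi_seq w1 w2 n =
     ((dxp w1)\<^sup>2 * (xp w1 - xp (2 * w1))) * psi_seq w1 w2 (n + 4) * psi_seq w1 w2 (n + 1) +
     - ((dxp w1) ^ 3 * dxp (2 * w1)) * psi_seq w1 w2 (n + 3) * psi_seq w1 w2 (n + 2)"
proof -
  obtain c \<mu> where step: "\<And>i. psi_seq w1 w2 (n + i) =
      c * \<mu> ^ i * inverse (sg w1) ^ (i\<^sup>2) * sg (of_int (int n - 1 + int i) * w1 + w2)"
    using psi_seq_step by blast
  define v where "v = (\<lambda>i::nat. sg (of_int (int n - 1 + int i) * w1 + w2))"
  define T where "T = inverse (sg w1)"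
  have sT: "sg w1 * T = 1" using sg_nonzero by (simp add: T_def)
  \<comment> \<open>Six consecutive terms have no middle one. From the midpoint \<open>a\<close> the
    half steps \<open>5 * h\<close>, \<open>3 * h\<close>, \<open>h\<close> reach them all, while
    sums and differences of these are again multiples of \<open>w1\<close>.\<close>
  define h where "h = w1 / 2"
  have w1: "w1 = 2 * h" by (simp add: h_def)
  define a where "a = of_int (2 * int n + 3) * h + w2"
  have "a + 5 * h = of_int (int n - 1 + int 5) * w1 + w2" "a - 5 * h = of_int (int n - 1 + int 0) * w1 + w2"
    "a + 3 * h = of_int (int n - 1 + int 4) * w1 + w2" "a - 3 * h = of_int (int n - 1 + int 1) * w1 + w2"
    "a + h = of_int (int n - 1 + int 3) * w1 + w2" "a - h = of_int (int n - 1 + int 2) * w1 + w2"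
    "3 * h + h = 2 * w1" "3 * h - h = w1" "5 * h + h = 3 * w1" "5 * h - h = 2 * w1"
    "5 * h + 3 * h = 4 * w1" "5 * h - 3 * h = w1"
    by (simp_all add: a_def w1 algebra_simps)
  with sigma_three_term[of a "5 * h" "3 * h" h]
  have rel: "v 5 * v 0 * sg (2 * w1) * sg w1 - v 4 * v 1 * sg (3 * w1) * sg (2 * w1) + v 3 * v 2 * sg (4 * w1) * sg w1 = 0"
    by (simp only: v_def)
  have st: "psi_seq w1 w2 (n + 5) = c * \<mu> ^ 5 * T ^ 25 * v 5" "psi_seq w1 w2 n = c * v 0"
    "psi_seq w1 w2 (n + 4) = c * \<mu> ^ 4 * T ^ 16 * v 4" "psi_seq w1 w2 (n + 1) = c * \<mu> * T * v 1"
    "psi_seq w1 w2 (n + 3) = c * \<mu> ^ 3 * T ^ 9 * v 3" "psi_seq w1 w2 (n + 2) = c * \<mu>\<^sup>2 * T ^ 4 * v 2"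
    using step[of 5] step[of 0] step[of 4] step[of 1] step[of 3] step[of 2] by (simp_all add: v_def T_def)
  define i where "i = inverse (sg (2 * w1))"
  have i: "sg (2 * w1) * i = 1" using sigma_multiples(4) by (simp add: i_def)
  have "v 5 * v 0 = T * (v 4 * v 1 * sg (3 * w1)) - v 3 * v 2 * sg (4 * w1) * i"
    using rel sT i by Groebner_Basis.algebra
  hence "T ^ 25 * (v 5 * v 0) = (sg (3 * w1) * T ^ 9) * (T ^ 17 * v 4 * v 1) - (sg (4 * w1) * T ^ 12 * i) * (T ^ 13 * v 3 * v 2)"
    by Groebner_Basis.algebra
  hence key: "T ^ 25 * (v 5 * v 0) = ((dxp w1)\<^sup>2 * (xp w1 - xp (2 * w1))) * (T ^ 17 * v 4 * v 1)
      - ((dxp w1) ^ 3 * dxp (2 * w1)) * (T ^ 13 * v 3 * v 2)"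
    unfolding i_def divide_inverse [symmetric] sigma_multiples(2,3)[folded T_def] .
  have "c * \<mu> ^ 5 * T ^ 25 * v 5 * (c * v 0) = c\<^sup>2 * \<mu> ^ 5 * (T ^ 25 * (v 5 * v 0))"
    by (simp only: power2_eq_square mult_ac)
  also note key
  also have "c\<^sup>2 * \<mu> ^ 5 * (A * (T ^ 17 * v 4 * v 1) - B * (T ^ 13 * v 3 * v 2)) =
      A * (c * \<mu> ^ 4 * T ^ 16 * v 4) * (c * \<mu> * T * v 1) + - B * (c * \<mu> ^ 3 * T ^ 9 * v 3) * (c * \<mu>\<^sup>2 * T ^ 4 * v 2)" for A B
    by Groebner_Basis.algebra
  finally show ?thesis unfolding st .
qed

end

end

end

section \<open>Rationality and p-integrality of the terms, and conclusion\<close>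

text \<open>Rationality, p-integrality and the absence of two adjacent multiples of p support each
  other and are proved in one induction. The last uses that \<open>b\<close> is a unit: two adjacent
  multiples of p make the preceding term one as well.\<close>

lemma (in prime_nat) rational_somos_pair:
  fixes f :: "nat \<Rightarrow> complex" and a b c d x0 x3 :: rat
  assumes abcd: "a \<in> pideal p 0" "b \<in> pideal p 0" "c \<in> pideal p 0" "d \<in> pideal p 0" "b \<notin> pideal p 1"
    and init: "f 0 = of_rat x0" "f 1 = 1" "f 2 = 1" "f 3 = of_rat x3"
      "x0 \<in> pideal p 0" "x0 \<notin> pideal p 1" "x3 \<in> pideal p 0"
    and rel4: "\<And>n. f (n + 4) * f n = of_rat a * f (n + 3) * f (n + 1) + of_rat b * (f (n + 2))\<^sup>2"
    and rel5: "\<And>n. f (n + 5) * f n = of_rat c * f (n + 4) * f (n + 1) + of_rat d * f (n + 3) * f (n + 2)"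
  obtains W where "\<And>n. f n = of_rat (W n)" "somos_pair a b c d W"
proof -
  \<comment> \<open>Where a rational preimage exists it is unique, so exhibiting one computes
    \<open>W n\<close>.\<close>
  define W where "W = (\<lambda>n. SOME w. f n = (of_rat w :: complex))"
  have WI: "W n = w \<and> f n = of_rat (W n)" if "f n = of_rat w" for n w
    using that unfolding W_def by simp
  have W0: "W 0 = x0" "W 1 = 1" "W 2 = 1" "W 3 = x3"
  proof -
    have "f 1 = of_rat 1" "f 2 = of_rat 1" using init(2,3) by simp_all
    with init(1,4) show "W 0 = x0" "W 1 = 1" "W 2 = 1" "W 3 = x3" using WI by blast+
  qed
  have quot: "f n = of_rat (x / y)" if "f n * of_rat y = of_rat x" "y \<noteq> 0" for n x y
    using that by (simp add: of_rat_divide eq_divide_eq)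
  have main: "f n = of_rat (W n) \<and> W n \<in> pideal p 0 \<and> (n \<ge> 1 \<longrightarrow> W n \<notin> pideal p 1 \<or> W (n - 1) \<notin> pideal p 1)" for n
  proof (induction n rule: less_induct)
    case (less n)
    show ?case
    proof (cases "n < 4")
      case True
      hence "n = 0 \<or> n = 1 \<or> n = 2 \<or> n = 3" by auto
      thus ?thesis using init W0 one_notin_pideal by (elim disjE) simp_all
    next
      case False
      define m where "m = n - 4"
      have n: "n = m + 4" using False by (simp add: m_def)
      note IH = less.IH[unfolded n]
      have F: "f (m + i) = of_rat (W (m + i))" "W (m + i) \<in> pideal p 0" if "i < 4" for i
        using IH[of "m + i"] that by auto
      have F0: "f m = of_rat (W m)" "W m \<in> pideal p 0" using F[of 0] by simp_all
      have r4: "f (m + 4) * of_rat (W m) = of_rat (a * W (m + 3) * W (m + 1) + b * (W (m + 2))\<^sup>2)"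
        using rel4[of m] F[of 1] F[of 2] F[of 3] F0 by (simp add: of_rat_add of_rat_mult of_rat_power)
      have i4: "a * W (m + 3) * W (m + 1) + b * (W (m + 2))\<^sup>2 \<in> pideal p 0"
        by (intro pideal_add pideal_mult_left pideal_power abcd F) simp_all
      have int: "f (m + 4) = of_rat (W (m + 4)) \<and> W (m + 4) \<in> pideal p 0"
      proof (cases "W m \<in> pideal p 1")
        case False
        hence "W m \<noteq> 0" by auto
        from WI[OF quot[OF r4 this]] have
          "W (m + 4) = (a * W (m + 3) * W (m + 1) + b * (W (m + 2))\<^sup>2) / W m" "f (m + 4) = of_rat (W (m + 4))" by auto
        thus ?thesis using pideal_mult_left[OF i4 pideal_inverse[OF F0(2) False]] by (simp add: divide_inverse)
      next
        case True
        \<comment> \<open>The long relation needs the term before \<open>W m\<close>. It exists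
          since \<open>x0\<close> is a unit, which is why the sequence starts one step
          early.\<close>
        hence "m \<noteq> 0" using W0 init by (auto intro: gr0I)
        then obtain k where m: "m = k + 1" by (metis Suc_eq_plus1 not0_implies_Suc)
        have u: "W k \<notin> pideal p 1" using IH[of m] True m by auto
        hence "W k \<noteq> 0" by auto
        have Fk: "f k = of_rat (W k)" "W k \<in> pideal p 0" using IH[of k] m by auto
        have e: "k + 5 = m + 4" "k + 4 = m + 3" "k + 3 = m + 2" "k + 2 = m + 1" "k + 1 = m" using m by simp_all
        have r5: "f (m + 4) * of_rat (W k) = of_rat (c * W (m + 3) * W m + d * W (m + 2) * W (m + 1))"
          using rel5[of k, unfolded e] F(1)[of 1] F(1)[of 2] F(1)[of 3] F0(1) Fk(1)
          by (simp add: of_rat_add of_rat_mult)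
        have i5: "c * W (m + 3) * W m + d * W (m + 2) * W (m + 1) \<in> pideal p 0"
          by (intro pideal_add pideal_mult_left abcd F F0) simp_all
        from WI[OF quot[OF r5 \<open>W k \<noteq> 0\<close>]] have
          "W (m + 4) = (c * W (m + 3) * W m + d * W (m + 2) * W (m + 1)) / W k" "f (m + 4) = of_rat (W (m + 4))" by auto
        thus ?thesis using pideal_mult_left[OF i5 pideal_inverse[OF Fk(2) u]] by (simp add: divide_inverse)
      qed
      have "W (m + 4) \<notin> pideal p 1 \<or> W (m + 3) \<notin> pideal p 1"
      proof (rule ccontr)
        assume "\<not> ?thesis"
        hence z: "W (m + 4) \<in> pideal p 1" "W (m + 3) \<in> pideal p 1" by auto
        have "(of_rat (W (m + 4) * W m) :: complex) = of_rat (a * W (m + 3) * W (m + 1) + b * (W (m + 2))\<^sup>2)"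
          using r4 int by (simp add: of_rat_mult)
        hence eq: "b * (W (m + 2))\<^sup>2 = W (m + 4) * W m - a * W (m + 3) * W (m + 1)"
          unfolding of_rat_eq_iff by simp
        have "b * (W (m + 2))\<^sup>2 \<in> pideal p 1" unfolding eq
          by (intro pideal_diff pideal_mult_right[OF z(1)] pideal_mult_right[OF pideal_mult_left[OF _ z(2)]] abcd F F0) simp
        hence "W (m + 2) * W (m + 2) \<in> pideal p 1"
          using pideal_unit_cancel[OF abcd(2,5)] by (simp add: power2_eq_square)
        hence "W (m + 2) \<in> pideal p 1" using pideal_1_prime F[of 2] by auto
        moreover have "W (m + 3) \<notin> pideal p 1 \<or> W (m + 3 - 1) \<notin> pideal p 1" using IH[of "m + 3"] by simp
        moreover have "m + 3 - 1 = m + 2" by simp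
        ultimately show False using z(2) by simp
      qed
      moreover have n': "n - 1 = m + 3" using n by simp
      ultimately show ?thesis using int unfolding n' unfolding n by blast
    qed
  qed
  have fW: "f n = of_rat (W n)" for n using main by blast
  have "somos_pair a b c d W"
    unfolding somos_pair_def
  proof (intro allI conjI)
    fix n
    show "W n \<in> pideal p 0" using main by blast
    show "W n \<notin> pideal p 1 \<or> W (n + 1) \<notin> pideal p 1" using main[of "n + 1"] by auto
    have "(of_rat (W (n + 4) * W n) :: complex) = of_rat (a * W (n + 3) * W (n + 1) + b * (W (n + 2))\<^sup>2)"
      using rel4[of n] by (simp add: fW of_rat_add of_rat_mult of_rat_power)
    thus "W (n + 4) * W n = a * W (n + 3) * W (n + 1) + b * (W (n + 2))\<^sup>2" by (simp only: of_rat_eq_iff)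
    have "(of_rat (W (n + 5) * W n) :: complex) = of_rat (c * W (n + 4) * W (n + 1) + d * W (n + 3) * W (n + 2))"
      using rel5[of n] by (simp add: fW of_rat_add of_rat_mult)
    thus "W (n + 5) * W n = c * W (n + 4) * W (n + 1) + d * W (n + 3) * W (n + 2)" by (simp only: of_rat_eq_iff)
  qed
  with fW show ?thesis using that by blast
qed

text \<open>The chord and tangent formulas are evaluated over the rationals and carried over by
  \<open>of_rat\<close>. So the values of \<open>xp\<close> and \<open>dxp\<close> in the
  coefficients and starting terms of the recurrences are images of p-integral rationals.\<close>

lemma (in prime_nat) Psi_p_power_periodic:
  fixes e1 e2 e3 e4 e6 :: rat and w1 w2 :: complex
  defines "E \<equiv> WCurve e1 e2 e3 e4 e6"
  assumes coeffs: "e1 \<in> pideal p 0" "e2 \<in> pideal p 0" "e3 \<in> pideal p 0" "e4 \<in> pideal p 0" "e6 \<in> pideal p 0"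
    and unif: "uniformizes L (map_wcurve of_rat E)"
    and param1: "map_wpoint of_rat R1 = wparam L (map_wcurve of_rat E) w1"
    and param2: "map_wpoint of_rat R2 = wparam L (map_wcurve of_rat E) w2"
    and on: "R1 \<in> wpoints rat_field E" "R2 \<in> wpoints rat_field E"
    and red: "\<And>R. R \<in> {R1, R2, wadd rat_field E R2 R1, wadd rat_field E R2 (wneg rat_field E R1)} \<Longrightarrow>
      reduce_wpoint p R \<noteq> Infinity"
    and ord: "order_mod p E R1 > 3"
  obtains M V where "M \<ge> 1" "p_power_periodic M V" "\<And>n. Psi L n w1 w2 = of_rat (V n)"
proof -
  interpret U: uniformized L "of_rat e1" "of_rat e2" "of_rat e3" "of_rat e4" "of_rat e6"
    using unif by unfold_locales (simp add: E_def)
  obtain x1 y1 where R1: "R1 = Affine x1 y1" "x1 \<in> pideal p 0" "y1 \<in> pideal p 0"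
    using red[of R1] unfolding reduce_wpoint_ne_Infinity by auto
  obtain x2 y2 where R2: "R2 = Affine x2 y2" "x2 \<in> pideal p 0" "y2 \<in> pideal p 0"
    using red[of R2] unfolding reduce_wpoint_ne_Infinity by auto
  have p1: "U.param w1 = Affine (of_rat x1) (of_rat y1)" and p2: "U.param w2 = Affine (of_rat x2) (of_rat y2)"
    using param1 param2 by (simp_all add: R1 R2 E_def)
  have wL: "w1 \<notin> L" "w2 \<notin> L"
    using U.param_eq_Infinity_iff[of w1] U.param_eq_Infinity_iff[of w2] p1 p2 by auto
  have xy: "U.xp w1 = of_rat x1" "U.yp w1 = of_rat y1" "U.xp w2 = of_rat x2" "U.yp w2 = of_rat y2"
    using p1 p2 U.param_notin[OF wL(1)] U.param_notin[OF wL(2)] by simp_all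
  define B where "B = 2 * y1 + e1 * x1 + e3"
  define l where "l = (3 * x1\<^sup>2 + 2 * e2 * x1 + e4 - e1 * y1) / B"
  define xd where "xd = l\<^sup>2 + e1 * l - e2 - 2 * x1"
  define yd where "yd = - (y1 + l * (xd - x1)) - e1 * xd - e3"
  define Bd where "Bd = 2 * yd + e1 * xd + e3"
  note o3 = order_mod_gt_3[OF coeffs R1(2,3) ord[unfolded R1(1) E_def],
      folded B_def, folded l_def, folded xd_def]
  have B0: "B \<noteq> 0" using o3(2) by auto
  have yd: "yd \<in> pideal p 0" unfolding yd_def
    by (intro pideal_diff pideal_uminus pideal_add pideal_mult_left coeffs o3 R1)
  have Bd: "Bd \<in> pideal p 0" unfolding Bd_def
    by (intro pideal_add pideal_mult_left coeffs o3 yd) simp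
  define k where "k = (y1 - y2) / (x1 - x2)"
  define xs where "xs = k\<^sup>2 + e1 * k - e2 - x2 - x1"
  have sum_ne: "reduce_wpoint p (wadd rat_field E R2 R1) \<noteq> Infinity"
    and diff_ne: "reduce_wpoint p (wadd rat_field E R2 (wneg rat_field E R1)) \<noteq> Infinity"
    by (rule red, simp)+
  note ch = reduction_chord[OF coeffs(1,2) R1(2) R2(2) on[unfolded R1(1) R2(1) E_def] o3(2)[unfolded B_def]
      sum_ne[unfolded R1(1) R2(1) E_def] diff_ne[unfolded R1(1) R2(1) E_def], folded k_def, folded xs_def]
  have "(of_rat x2 :: complex) \<noteq> of_rat x1" using ch(1) by (simp add: of_rat_eq_iff)
  from wadd_chord[OF this] obtain z where "U.param (w2 + w1) = Affine (of_rat xs) z"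
    unfolding U.param_add p1 p2 by (simp add: xs_def k_def of_rat_add of_rat_diff of_rat_mult of_rat_power of_rat_divide)
  hence "U.param (w1 + w2) = Affine (of_rat xs) z" by (simp add: add.commute)
  hence w12: "w1 + w2 \<notin> L" and xs: "U.xp (w1 + w2) = of_rat xs"
    using U.param_eq_Infinity_iff[of "w1 + w2"] U.param_notin[of "w1 + w2"] by auto
  have BC: "2 * of_rat y1 + of_rat e1 * of_rat x1 + of_rat e3 = (of_rat B :: complex)"
    by (simp add: B_def of_rat_add of_rat_mult)
  have lC: "(3 * (of_rat x1)\<^sup>2 + 2 * of_rat e2 * of_rat x1 + of_rat e4 - of_rat e1 * of_rat y1) / of_rat B = (of_rat l :: complex)"
    by (simp add: l_def of_rat_add of_rat_mult of_rat_diff of_rat_power of_rat_divide)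
  have xC: "(of_rat l)\<^sup>2 + of_rat e1 * of_rat l - of_rat e2 - 2 * of_rat x1 = (of_rat xd :: complex)"
    by (simp add: xd_def of_rat_add of_rat_mult of_rat_diff of_rat_power)
  have "(2 * of_rat y1 + of_rat e1 * of_rat x1 + of_rat e3 :: complex) \<noteq> 0"
    unfolding BC using B0 by simp
  from wadd_tangent[OF this, of "of_rat e2" "of_rat e4" "of_rat e6"]
  have "U.param (w1 + w1) = Affine (of_rat xd) (- (of_rat y1 + of_rat l * (of_rat xd - of_rat x1)) - of_rat e1 * of_rat xd - of_rat e3)"
    unfolding U.param_add p1 BC lC xC .
  hence pd: "U.param (2 * w1) = Affine (of_rat xd) (of_rat yd)"
    by (simp add: yd_def of_rat_add of_rat_mult of_rat_diff of_rat_minus flip: mult_2)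
  hence wd: "2 * w1 \<notin> L" using U.param_eq_Infinity_iff[of "2 * w1"] by auto
  have xyd: "U.xp (2 * w1) = of_rat xd" "U.yp (2 * w1) = of_rat yd"
    using pd U.param_notin[OF wd] by simp_all
  have D: "U.dxp w1 = of_rat B" "U.dxp (2 * w1) = of_rat Bd"
    unfolding U.dxp_eq xy xyd by (simp_all add: B_def Bd_def of_rat_add of_rat_mult)
  \<comment> \<open>This is the division polynomial of index 3 at the first point.\<close>
  have unit: "B\<^sup>2 * (x1 - xd) \<in> pideal p 0" "B\<^sup>2 * (x1 - xd) \<notin> pideal p 1"
  proof -
    show "B\<^sup>2 * (x1 - xd) \<in> pideal p 0" by (intro pideal_mult_left pideal_power pideal_diff o3 R1)
    show "B\<^sup>2 * (x1 - xd) \<notin> pideal p 1"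
    proof
      assume "B\<^sup>2 * (x1 - xd) \<in> pideal p 1"
      hence "B * (B * (x1 - xd)) \<in> pideal p 1" by (simp add: power2_eq_square mult.assoc)
      hence "B * (x1 - xd) \<in> pideal p 1" by (rule pideal_unit_cancel[OF o3(1,2)])
      hence "x1 - xd \<in> pideal p 1" by (rule pideal_unit_cancel[OF o3(1,2)])
      with o3(5) show False by contradiction
    qed
  qed
  have B2: "B\<^sup>2 \<in> pideal p 0" by (rule pideal_power[OF o3(1)])
  have unit': "- (B\<^sup>2 * (x1 - xd)) \<in> pideal p 0" "- (B\<^sup>2 * (x1 - xd)) \<notin> pideal p 1"
    using unit pideal_uminus[of "- (B\<^sup>2 * (x1 - xd))" 1] pideal_uminus by auto
  have BBd: "- (B ^ 3 * Bd) \<in> pideal p 0" by (intro pideal_uminus pideal_mult_left pideal_power o3 Bd)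
  obtain W where W: "\<And>n. U.psi_seq w1 w2 n = of_rat (W n)"
    "somos_pair (B\<^sup>2) (- (B\<^sup>2 * (x1 - xd))) (B\<^sup>2 * (x1 - xd)) (- (B ^ 3 * Bd)) W"
  proof (rule rational_somos_pair[of "B\<^sup>2" "- (B\<^sup>2 * (x1 - xd))" "B\<^sup>2 * (x1 - xd)" "- (B ^ 3 * Bd)"
        "U.psi_seq w1 w2" "x1 - x2" "x1 - xs"])
    note init = U.psi_seq_init[OF wL w12]
    show "U.psi_seq w1 w2 0 = of_rat (x1 - x2)" "U.psi_seq w1 w2 1 = 1" "U.psi_seq w1 w2 2 = 1"
      "U.psi_seq w1 w2 3 = of_rat (x1 - xs)"
      unfolding init xy xs by (simp_all add: of_rat_diff)
    show "U.psi_seq w1 w2 (n + 4) * U.psi_seq w1 w2 n =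
      of_rat (B\<^sup>2) * U.psi_seq w1 w2 (n + 3) * U.psi_seq w1 w2 (n + 1) +
      of_rat (- (B\<^sup>2 * (x1 - xd))) * (U.psi_seq w1 w2 (n + 2))\<^sup>2" for n
      using U.psi_seq_somos4[OF wL w12 wd, of n] unfolding D xy xyd
      by (simp only: of_rat_minus of_rat_mult of_rat_power of_rat_diff)
    show "U.psi_seq w1 w2 (n + 5) * U.psi_seq w1 w2 n =
      of_rat (B\<^sup>2 * (x1 - xd)) * U.psi_seq w1 w2 (n + 4) * U.psi_seq w1 w2 (n + 1) +
      of_rat (- (B ^ 3 * Bd)) * U.psi_seq w1 w2 (n + 3) * U.psi_seq w1 w2 (n + 2)" for n
      using U.psi_seq_somos5[OF wL w12 wd, of n] unfolding D xy xyd
      by (simp only: of_rat_minus of_rat_mult of_rat_power of_rat_diff)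
    show "x1 - x2 \<in> pideal p 0" "x1 - xs \<in> pideal p 0" by (intro pideal_diff R1 R2 ch)+
  qed (use unit unit' B2 BBd ch in blast)+
  \<comment> \<open>Dropping the term at -1 realigns the index with that of
    \<open>Psi\<close>.\<close>
  from somos_pair_shift[OF W(2), of 1]
  obtain M where M: "M \<ge> 1" "p_power_periodic M (\<lambda>n. W (n + 1))"
    using somos_pair_p_power_periodic[OF B2 unit'(1) unit(1) BBd] by blast
  have "Psi L n w1 w2 = of_rat (W (n + 1))" for n
    unfolding U.Psi_eq_psi_seq[OF wL w12] W(1) by (simp only: Suc_eq_plus1)
  with M show ?thesis using that by blast
qed

theorem theorem1p5:
  fixes W :: "nat \<Rightarrow> rat" and E :: "rat wcurve"
    and P1 P2 Q1 Q2 :: "rat wpoint" and p :: nat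
  assumes "somos5 W" and "W 0 * W 1 \<noteq> 0"
    and "elliptic_curve E"
    and "P1 \<in> wpoints rat_field E" and "P2 \<in> wpoints rat_field E"
    and "Q1 \<in> wpoints rat_field E" and "Q2 \<in> wpoints rat_field E"
    and "somos5_associated W E (P1, P2) (Q1, Q2)"
    and "Factorial_Ring.prime p" and "odd p"
    and "p_integral_wcurve p E"
    and "\<And>R. R \<in> {P1, P2, Q1, Q2} \<Longrightarrow> nonsingular_mod p E R"
    and "\<And>R. R \<in> {P1, P2, wadd rat_field E P2 P1, wadd rat_field E P2 (wneg rat_field E P1),
                     Q1, Q2, wadd rat_field E Q2 Q1, wadd rat_field E Q2 (wneg rat_field E Q1)}
              \<Longrightarrow> reduce_wpoint p R \<noteq> Infinity"
    and "order_mod p E P1 > 3" and "order_mod p E Q1 > 3"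
    and "padic_ord p (W 2 / W 0) \<ge> 0" and "padic_ord p (W 3 / W 1) \<ge> 0"
    and "padic_ord p (W 0) \<ge> 0" and "padic_ord p (W 1) \<ge> 0"
  shows "\<exists>N\<ge>1. \<forall>m\<ge>1.
           limit_exists_in_Zp p (\<lambda>i. W (2 * m * (p ^ N) ^ i)) \<and>
           limit_exists_in_Zp p (\<lambda>i. W (2 * m * (p ^ N) ^ i + 1))"
proof -
  interpret prime_nat p by unfold_locales (rule assms(9))
  obtain e1 e2 e3 e4 e6 where E: "E = WCurve e1 e2 e3 e4 e6" by (cases E)
  have coeffs: "e1 \<in> pideal p 0" "e2 \<in> pideal p 0" "e3 \<in> pideal p 0" "e4 \<in> pideal p 0" "e6 \<in> pideal p 0"
    using assms(11) by (simp_all add: p_integral_wcurve_def E padic_ord_nonneg_iff)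
  obtain L z1 z2 where unif: "uniformizes L (map_wcurve of_rat E)"
    and P: "map_wpoint of_rat P1 = wparam L (map_wcurve of_rat E) (2 * z1)"
      "map_wpoint of_rat P2 = wparam L (map_wcurve of_rat E) z2"
    and Q: "map_wpoint of_rat Q1 = wparam L (map_wcurve of_rat E) (2 * z1)"
      "map_wpoint of_rat Q2 = wparam L (map_wcurve of_rat E) (z1 + z2)"
    and W: "\<And>n. n \<ge> 1 \<Longrightarrow> of_rat (W (2 * n)) = of_rat (W 2 / W 0) ^ n * of_rat (W 0) * Psi L n (2 * z1) z2"
      "\<And>n. n \<ge> 1 \<Longrightarrow> of_rat (W (2 * n + 1)) = of_rat (W 3 / W 1) ^ n * of_rat (W 1) * Psi L n (2 * z1) (z1 + z2)"
    using assms(8) unfolding somos5_associated_def fst_conv snd_conv by blast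
  obtain M1 V1 where V1: "M1 \<ge> 1" "p_power_periodic M1 V1" "\<And>n. Psi L n (2 * z1) z2 = of_rat (V1 n)"
    by (rule Psi_p_power_periodic[OF coeffs unif[unfolded E] P[unfolded E] assms(4,5)[unfolded E]
          assms(13)[unfolded E] assms(14)[unfolded E]]) auto
  obtain M2 V2 where V2: "M2 \<ge> 1" "p_power_periodic M2 V2" "\<And>n. Psi L n (2 * z1) (z1 + z2) = of_rat (V2 n)"
    by (rule Psi_p_power_periodic[OF coeffs unif[unfolded E] Q[unfolded E] assms(6,7)[unfolded E]
          assms(13)[unfolded E] assms(15)[unfolded E]]) auto
  \<comment> \<open>A common multiple for both points and for the geometric factors, so that one
    exponent \<open>N\<close> serves even and odd indices.\<close>
  define M where "M = M1 * M2 * (p - 1)"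
  have dvd: "M1 dvd M" "M2 dvd M" "p - 1 dvd M" by (simp_all add: M_def)
  have "M > 0" using V1(1) V2(1) p_gt_1 by (auto simp: M_def)
  hence "M \<ge> 1" by linarith
  then obtain N where N: "N \<ge> 1"
    "\<And>U m. p_power_periodic M U \<Longrightarrow> m \<ge> 1 \<Longrightarrow> limit_exists_in_Zp p (\<lambda>i. U (m * (p ^ N) ^ i))"
    using p_power_periodic_limits by blast
  have per: "p_power_periodic M (\<lambda>n. x ^ n * y * V n)"
    if "padic_ord p x \<ge> 0" "padic_ord p y \<ge> 0" "p_power_periodic M' V" "M' dvd M" for x y V M'
  proof (intro p_power_periodic_mult p_power_periodic_const)
    show "p_power_periodic M (\<lambda>n. x ^ n)"
      by (rule p_power_periodic_dvd[OF p_power_periodic_power dvd(3)]) (use that in \<open>simp add: padic_ord_nonneg_iff\<close>)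
    show "y \<in> pideal p 0" using that by (simp add: padic_ord_nonneg_iff)
    show "p_power_periodic M V" using that(3,4) by (rule p_power_periodic_dvd)
  qed
  have even: "W (2 * n) = (W 2 / W 0) ^ n * W 0 * V1 n" if "n \<ge> 1" for n
  proof -
    have "(of_rat (W (2 * n)) :: complex) = of_rat ((W 2 / W 0) ^ n * W 0 * V1 n)"
      unfolding W(1)[OF that] V1(3) by (simp only: of_rat_mult of_rat_power)
    thus ?thesis by (simp only: of_rat_eq_iff)
  qed
  have odd: "W (2 * n + 1) = (W 3 / W 1) ^ n * W 1 * V2 n" if "n \<ge> 1" for n
  proof -
    have "(of_rat (W (2 * n + 1)) :: complex) = of_rat ((W 3 / W 1) ^ n * W 1 * V2 n)"
      unfolding W(2)[OF that] V2(3) by (simp only: of_rat_mult of_rat_power)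
    thus ?thesis by (simp only: of_rat_eq_iff)
  qed
  show ?thesis
  proof (intro exI conjI allI impI)
    show "N \<ge> 1" by (rule N(1))
    fix m :: nat assume m: "m \<ge> 1"
    have n: "m * (p ^ N) ^ i \<ge> 1" for i
    proof -
      have "m * (p ^ N) ^ i > 0" using m p_gt_1 by auto
      thus ?thesis by linarith
    qed
    show "limit_exists_in_Zp p (\<lambda>i. W (2 * m * (p ^ N) ^ i))"
      using N(2)[OF per[OF assms(16,18) V1(2) dvd(1)] m] by (simp only: mult.assoc even[OF n])
    show "limit_exists_in_Zp p (\<lambda>i. W (2 * m * (p ^ N) ^ i + 1))"
      using N(2)[OF per[OF assms(17,19) V2(2) dvd(2)] m] by (simp only: mult.assoc odd[OF n])
  qed
qed

end
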